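(* Let $\Gamma_1,\dots,\Gamma_n$ be non-abelian limit groups and let $N$ be the kernel of an epimorphism $\Gamma_1\times\cdots\times\Gamma_n\to\mathbb{Z}$. Then there is a subgroup of finite index $N_0\subset N$ such that at least one of the homology groups $H_k(N_0;\mathbb{Q})$, $0\le k\le n$, has infinite $\mathbb{Q}$-dimension.
   Context: A limit group is a finitely generated group $L$ that is fully residually free: for every finite subset $T\subset L$ there is a homomorphism from $L$ to a free group that is injective on $T$. *)

theory Defs
  imports "HOL-Algebra.Algebra"
begin

definition fin_gen_group :: "('a, 'b) monoid_scheme \<Rightarrow> bool" where
  "fin_gen_group G \<longleftrightarrow> group G \<and>
     (\<exists>A. finite A \<and> A \<subseteq> carrier G \<and> generate G A = carrier G)"

definition non_abelian :: "('a, 'b) monoid_scheme \<Rightarrow> bool" where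
  "non_abelian G \<longleftrightarrow> (\<exists>x\<in>carrier G. \<exists>y\<in>carrier G. x \<otimes>\<^bsub>G\<^esub> y \<noteq> y \<otimes>\<^bsub>G\<^esub> x)"

text \<open>A letter is a generator together with a flag; True means the inverse of the generator.\<close>

definition cancels :: "'g \<times> bool \<Rightarrow> 'g \<times> bool \<Rightarrow> bool" where
  "cancels a b \<longleftrightarrow> fst a = fst b \<and> snd a \<noteq> snd b"

fun reduced_word :: "('g \<times> bool) list \<Rightarrow> bool" where
  "reduced_word (a # b # w) = (\<not> cancels a b \<and> reduced_word (b # w))"
| "reduced_word _ = True"

fun cons_red :: "'g \<times> bool \<Rightarrow> ('g \<times> bool) list \<Rightarrow> ('g \<times> bool) list" where
  "cons_red a [] = [a]"
| "cons_red a (b # w) = (if cancels a b then w else a # b # w)"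

definition reduce_word :: "('g \<times> bool) list \<Rightarrow> ('g \<times> bool) list" where
  "reduce_word w = foldr cons_red w []"

definition free_group_on :: "'g set \<Rightarrow> ('g \<times> bool) list monoid" where
  "free_group_on S = \<lparr>carrier = {w. reduced_word w \<and> fst ` set w \<subseteq> S},
                      monoid.mult = (\<lambda>u v. reduce_word (u @ v)),
                      one = []\<rparr>"

text \<open>Fully residually free: for every finite subset T there is a homomorphism to a free
  group injective on T. Free groups are taken on a countable basis (any homomorphic image
  of a finitely generated group in a free group is free of finite rank).\<close>

definition limit_group :: "('a, 'b) monoid_scheme \<Rightarrow> bool" where
  "limit_group L \<longleftrightarrow> fin_gen_group L \<and>
     (\<forall>T. finite T \<and> T \<subseteq> carrier L \<longrightarrow>
        (\<exists>(S::nat set) h. h \<in> hom L (free_group_on S) \<and> inj_on h T))"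

text \<open>Bar k-simplices [g1|...|gk] are lists of length k of group elements.
  Faces of [g1|...|gk] (k>=1): index 0 drops g1, index i (0<i<k) multiplies g_i g_(i+1),
  index k drops g_k.  Boundary (trivial coefficients Q): sum of (-1)^i times face i.\<close>

definition bar_face :: "('a, 'b) monoid_scheme \<Rightarrow> nat \<Rightarrow> 'a list \<Rightarrow> 'a list" where
  "bar_face G i gs =
     (if i = 0 then tl gs
      else if i = length gs then butlast gs
      else take (i - 1) gs @ [gs ! (i - 1) \<otimes>\<^bsub>G\<^esub> gs ! i] @ drop (i + 1) gs)"

definition bar_chains :: "('a, 'b) monoid_scheme \<Rightarrow> nat \<Rightarrow> ('a list \<Rightarrow> rat) set" where
  "bar_chains G k = {c. finite {gs. c gs \<noteq> 0} \<and>
      (\<forall>gs. c gs \<noteq> 0 \<longrightarrow> length gs = k \<and> set gs \<subseteq> carrier G)}"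

definition bar_boundary :: "('a, 'b) monoid_scheme \<Rightarrow> ('a list \<Rightarrow> rat) \<Rightarrow> ('a list \<Rightarrow> rat)" where
  "bar_boundary G c = (\<lambda>ys. \<Sum>gs\<in>{gs. c gs \<noteq> 0 \<and> gs \<noteq> []}.
      c gs * (\<Sum>i\<in>{0..length gs}. (if bar_face G i gs = ys then (-1) ^ i else 0)))"

definition bar_cycles :: "('a, 'b) monoid_scheme \<Rightarrow> nat \<Rightarrow> ('a list \<Rightarrow> rat) set" where
  "bar_cycles G k = {c \<in> bar_chains G k. bar_boundary G c = (\<lambda>_. 0)}"

definition bar_boundaries :: "('a, 'b) monoid_scheme \<Rightarrow> nat \<Rightarrow> ('a list \<Rightarrow> rat) set" where
  "bar_boundaries G k = bar_boundary G ` bar_chains G (Suc k)"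

definition rat_span :: "('x \<Rightarrow> rat) set \<Rightarrow> ('x \<Rightarrow> rat) set" where
  "rat_span S = {f. \<exists>F a. finite F \<and> F \<subseteq> S \<and> f = (\<lambda>x. \<Sum>s\<in>F. a s * s x)}"

text \<open>H_k(G;Q) = Z_k / B_k has finite Q-dimension iff it is spanned by the classes of
  finitely many cycles.\<close>

definition homology_finite_dim :: "('a, 'b) monoid_scheme \<Rightarrow> nat \<Rightarrow> bool" where
  "homology_finite_dim G k \<longleftrightarrow>
     (\<exists>S. finite S \<and> S \<subseteq> bar_cycles G k \<and>
        bar_cycles G k \<subseteq> {(\<lambda>x. s x + b x) | s b. s \<in> rat_span S \<and> b \<in> bar_boundaries G k})"

end

(* If a nonabelian limit group G maps nontrivially to the integers, then G has a derivation d with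
   values in Q(t), twisted by the character g |-> t^(phi g), and an element l with phi l = 0 and
   d l /= 0. Otherwise the Fox rows of finitely many relators would have corank at most one over
   Q(t). Residual freeness of G allows one to evaluate the powers of the Gram operator of these rows
   simultaneously in a finite p-group P and in P x Z/s with equal normalised traces: in P the two
   independent homomorphisms to Z/p of a nonabelian p-group produce a kernel of normalised dimension
   at least 2, while a Nakayama argument and the bound det >= 1 for integral matrices keep it below
   7/4 in P x Z/s.

   For a product, the cup product of these derivations over the k factors on which phi is nonzero is
   a cocycle with trivial coefficients on the kernel N. Commuting elements, one in each such factor,
   give k-tori in N, and conjugating one of them by powers of t yields tori whose pairings with the
   cocycle are linearly independent over Q, so H_k(N; Q) is infinite-dimensional. *)

theory Submission
  imports Defs
    "Jordan_Normal_Form.Jordan_Normal_Form_Existence"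
    "Jordan_Normal_Form.Jordan_Normal_Form_Uniqueness"
    "HOL-Number_Theory.Cong"
    "HOL-Combinatorics.Permutations"
    "HOL-Computational_Algebra.Polynomial_Factorial"
    "HOL-Library.Function_Algebras"
begin

text \<open>Nullities do not pass to finite quotients, but traces do: for a fixed power of the Gram
  operator the normalised trace depends only on which of finitely many words become trivial. A word
  trivial in \<Gamma> has exponent 0, so P and P x Z/s give the same traces as soon as P keeps the
  other words nontrivial. The share of a trace due to small nonzero eigenvalues must then be bounded
  uniformly in P, which is where integrality enters.

  The prime is dictated by the relators, because the Fox rows have to stay injective after
  reduction; it is fixed before P, which is possible since free groups are residually p for every
  prime p. The map to a free group is needed once more: a homomorphism to Z/p lifts to an integral
  derivation because the edges of a Cayley graph may carry arbitrary weights. The factor Z/s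
  imitates the variable t; as s need not be a power of p, it cannot join the p-group, and
  wrap-around is avoided by windows. The value 7/4 is 1 for the omitted generator plus 1/4 each for
  the window margins, the small eigenvalues and the finite power.\<close>

no_notation Polynomials.var (\<open>X\<index>\<close>)

section \<open>Spectra of integral Gram matrices\<close>

definition hermitian_mat :: "complex mat \<Rightarrow> bool" where
  "hermitian_mat M \<longleftrightarrow> (\<forall>i<dim_row M. \<forall>j<dim_row M. M $$ (i,j) = cnj (M $$ (j,i)))"

lemma hermitian_matD:
  "hermitian_mat M \<Longrightarrow> M \<in> carrier_mat n n \<Longrightarrow> i < n \<Longrightarrow> j < n \<Longrightarrow> M $$ (i,j) = cnj (M $$ (j,i))"
  unfolding hermitian_mat_def by (metis carrier_matD(1))

lemma hermitian_swap:
  assumes M: "M \<in> carrier_mat n n" and h: "hermitian_mat M"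
    and v: "v \<in> carrier_vec n" and w: "w \<in> carrier_vec n"
  shows "(M *\<^sub>v v) \<bullet>c w = v \<bullet>c (M *\<^sub>v w)"
proof -
  have "(M *\<^sub>v v) \<bullet>c w = (\<Sum>i<n. \<Sum>j<n. M $$ (i,j) * v $ j * cnj (w $ i))"
    using M v w by (simp add: scalar_prod_def sum_distrib_right lessThan_atLeast0)
  also have "\<dots> = (\<Sum>j<n. \<Sum>i<n. M $$ (i,j) * v $ j * cnj (w $ i))"
    by (rule sum.swap)
  also have "\<dots> = (\<Sum>j<n. \<Sum>i<n. v $ j * (cnj (M $$ (j,i)) * cnj (w $ i)))"
  proof (intro sum.cong refl)
    fix j i assume "j \<in> {..<n}" "i \<in> {..<n}"
    hence e: "M $$ (i,j) = cnj (M $$ (j,i))" by (intro hermitian_matD[OF h M]) simp_all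
    show "M $$ (i,j) * v $ j * cnj (w $ i) = v $ j * (cnj (M $$ (j,i)) * cnj (w $ i))"
      by (subst e) (simp add: mult_ac)
  qed
  also have "\<dots> = v \<bullet>c (M *\<^sub>v w)"
    using M v w by (simp add: scalar_prod_def sum_distrib_left lessThan_atLeast0 mult.assoc)
  finally show ?thesis .
qed

lemma hermitian_eigenvalue_real:
  assumes M: "M \<in> carrier_mat n n" and h: "hermitian_mat M" and e: "eigenvalue M e"
  shows "cnj e = e"
proof -
  obtain v where v: "v \<in> carrier_vec n" "v \<noteq> 0\<^sub>v n" "M *\<^sub>v v = e \<cdot>\<^sub>v v"
    using e M unfolding eigenvalue_def eigenvector_def by auto
  have "e * (v \<bullet>c v) = (M *\<^sub>v v) \<bullet>c v" using v by simp
  also have "\<dots> = v \<bullet>c (M *\<^sub>v v)" by (rule hermitian_swap[OF M h v(1) v(1)])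
  also have "\<dots> = cnj e * (v \<bullet>c v)" using v by (simp add: conjugate_smult_vec)
  finally have "e * (v \<bullet>c v) = cnj e * (v \<bullet>c v)" .
  moreover have "v \<bullet>c v \<noteq> 0" using v conjugate_square_eq_0_vec[of v n] by auto
  ultimately show ?thesis by simp
qed

text \<open>With H = M - e, again self-adjoint because e is real, the squared norm of H v is the
  product of H H v with v. This is what excludes Jordan blocks of size 2.\<close>

lemma hermitian_kernel_square:
  assumes M: "M \<in> carrier_mat n n" and h: "hermitian_mat M" and e: "cnj e = e"
    and v: "v \<in> carrier_vec n" and k: "char_matrix M e *\<^sub>v (char_matrix M e *\<^sub>v v) = 0\<^sub>v n"
  shows "char_matrix M e *\<^sub>v v = 0\<^sub>v n"
proof -
  let ?H = "char_matrix M e"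
  have H: "?H \<in> carrier_mat n n" using M by simp
  have hH: "hermitian_mat ?H"
    unfolding hermitian_mat_def
  proof (intro allI impI)
    fix i j assume ij: "i < dim_row ?H" "j < dim_row ?H"
    have n: "dim_row ?H = n" using M by (simp add: char_matrix_def)
    have H': "?H $$ (a,b) = M $$ (a,b) - (if a = b then e else 0)" if "a < n" "b < n" for a b
      using M that by (simp add: char_matrix_def)
    from n ij have ij': "i < n" "j < n" by simp_all
    hence e': "M $$ (i,j) = cnj (M $$ (j,i))" by (intro hermitian_matD[OF h M])
    show "?H $$ (i,j) = cnj (?H $$ (j,i))" using ij' e by (simp add: H' e'[symmetric])
  qed
  have Hv: "?H *\<^sub>v v \<in> carrier_vec n" using H v by auto
  have "(?H *\<^sub>v v) \<bullet>c (?H *\<^sub>v v) = (?H *\<^sub>v (?H *\<^sub>v v)) \<bullet>c v"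
    using hermitian_swap[OF H hH Hv v] by simp
  also have "\<dots> = 0" unfolding k using v by simp
  finally show ?thesis using conjugate_square_eq_0_vec[OF Hv] by simp
qed

lemma jordan_matrix_one_blocks:
  assumes "\<forall>x\<in>set xs. fst x = 1"
  shows "jordan_matrix xs = mat (length xs) (length xs) (\<lambda>(i,j). if i = j then snd (xs ! i) else 0)"
  using assms
proof (induction xs)
  case Nil then show ?case by (auto simp: jordan_matrix_def)
next
  case (Cons x xs)
  obtain a where x: "x = (1, a)" using Cons.prems by (cases x) auto
  have s: "sum_list (map fst xs) = length xs" using Cons.prems by (induction xs) auto
  have IH: "jordan_matrix xs = mat (length xs) (length xs) (\<lambda>(i,j). if i = j then snd (xs ! i) else 0)"
    using Cons by simp
  show ?case unfolding x jordan_matrix_Cons s IH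
    by (rule eq_matI) (auto simp: nth_Cons' jordan_block_def)
qed

text \<open>A Jordan block of size at least 2 would separate the kernel of (M - e)^2 from that of M
  - e. The matrices P and Q are inverse to each other, not necessarily unitary; traces and kernels
  ask for no more.\<close>

lemma hermitian_diagonalizable:
  assumes M: "M \<in> carrier_mat n n" and h: "hermitian_mat M"
  obtains es P Q where "length es = n" "P \<in> carrier_mat n n" "Q \<in> carrier_mat n n"
    "P * Q = 1\<^sub>m n" "Q * P = 1\<^sub>m n"
    "M = P * mat n n (\<lambda>(i,j). if i = j then es ! i else 0) * Q"
    "char_poly M = (\<Prod>e\<leftarrow>es. [:- e, 1:])"
proof -
  obtain as where as: "char_poly M = (\<Prod>a\<leftarrow>as. [:- a, 1:])" "length as = n"
    using char_poly_factorized[OF M] by auto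
  obtain nas where nas: "jordan_nf M nas" using jordan_nf_exists[OF M as(1)] by auto
  have cp: "char_poly M = (\<Prod>(k,a)\<leftarrow>nas. [:- a, 1:] ^ k)" using jordan_nf_char_poly[OF nas] .
  have ones: "\<forall>x\<in>set nas. fst x = 1"
  proof
    fix x assume x: "x \<in> set nas"
    obtain k e where xe: "x = (k, e)" by (cases x)
    have k0: "k \<noteq> 0" using nas x xe unfolding jordan_nf_def by force
    have "poly (char_poly M) e = 0" unfolding cp poly_prod_list
      using x xe k0 by (auto simp: prod_list_zero_iff intro!: image_eqI[of _ _ "(k,e)"])
    hence "eigenvalue M e" using eigenvalue_root_char_poly[OF M] by simp
    hence re: "cnj e = e" using hermitian_eigenvalue_real[OF M h] by simp
    let ?H = "char_matrix M e"
    have H: "?H \<in> carrier_mat n n" using M by simp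
    have H2: "?H ^\<^sub>m 2 = ?H * ?H" using H by (simp add: numeral_2_eq_2)
    have "mat_kernel (?H ^\<^sub>m 2) = mat_kernel (?H ^\<^sub>m 1)"
      unfolding H2 mat_kernel_def using H hermitian_kernel_square[OF M h re]
      by (auto simp: assoc_mult_mat_vec[of _ n n _ n])
    hence "dim_gen_eigenspace M e 2 = dim_gen_eigenspace M e 1"
      unfolding dim_gen_eigenspace_def kernel_dim_def using H by (simp add: H2)
    hence eq: "(\<Sum>k\<leftarrow>map fst [(k, a)\<leftarrow>nas . a = e]. min 2 k) = (\<Sum>k\<leftarrow>map fst [(k, a)\<leftarrow>nas . a = e]. min 1 k)"
      unfolding dim_gen_eigenspace[OF nas] .
    \<comment> \<open>Termwise min 1 k <= min 2 k, with strict inequality as soon as a block has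
      size at least 2.\<close>
    have gen: "(\<Sum>k\<leftarrow>xs. min 2 k) = (\<Sum>k\<leftarrow>xs. min 1 (k::nat)) \<Longrightarrow> \<forall>k\<in>set xs. k \<le> 1" for xs
    proof (induction xs)
      case (Cons a xs)
      have "(\<Sum>k\<leftarrow>xs. min 1 k) \<le> (\<Sum>k\<leftarrow>xs. min 2 (k::nat))" by (rule sum_list_mono) auto
      with Cons show ?case by (auto simp: min_def split: if_splits)
    qed simp
    have "k \<in> set (map fst [(k, a)\<leftarrow>nas . a = e])" using x xe by force
    with gen[OF eq] k0 show "fst x = 1" using xe by (metis One_nat_def fst_conv le_less_Suc_eq less_Suc_eq_le less_one nat_less_le)
  qed
  obtain P Q where sw: "similar_mat_wit M (jordan_matrix nas) P Q"
    using nas unfolding jordan_nf_def similar_mat_def by auto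
  have len: "length nas = n"
  proof -
    have "sum_list (map fst nas) = length nas" using ones by (induction nas) auto
    moreover have "jordan_matrix nas \<in> carrier_mat n n" using sw M unfolding similar_mat_wit_def Let_def by auto
    ultimately show ?thesis by (metis carrier_matD(1) jordan_matrix_dim(1))
  qed
  have jm: "jordan_matrix nas = mat n n (\<lambda>(i,j). if i = j then (map snd nas) ! i else 0)"
    unfolding jordan_matrix_one_blocks[OF ones] len by (rule eq_matI) (auto simp: len)
  have cp': "char_poly M = (\<Prod>e\<leftarrow>map snd nas. [:- e, 1:])"
    unfolding cp using ones by (induction nas) auto
  show ?thesis
    by (rule that[of "map snd nas" P Q]) (use sw len M cp' in \<open>auto simp: similar_mat_wit_def Let_def jm\<close>)
qed

section \<open>Linear systems over fields and their integral solutions\<close>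

lemma underdetermined_system:
  fixes c :: "'v \<Rightarrow> 'u \<Rightarrow> 'k::field"
  assumes "finite V" "finite U" "card V < card U"
  shows "\<exists>f. (\<exists>u\<in>U. f u \<noteq> 0) \<and> (\<forall>v\<in>V. (\<Sum>u\<in>U. c v u * f u) = 0)"
  using assms
proof (induction V arbitrary: U c rule: finite_induct)
  case empty
  then obtain u where "u \<in> U" by fastforce
  then show ?case by (intro exI[of _ "\<lambda>_. 1"]) auto
next
  case (insert v V)
  show ?case
  proof (cases "\<forall>u\<in>U. c v u = 0")
    case True
    have "card V < card U" using insert by simp
    from insert.IH[OF insert.prems(1) this, of c] obtain f where
      f: "\<exists>u\<in>U. f u \<noteq> 0" "\<forall>v\<in>V. (\<Sum>u\<in>U. c v u * f u) = 0" by blast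
    have "(\<Sum>u\<in>U. c v u * f u) = 0" using True by simp
    with f show ?thesis by (intro exI[of _ f]) simp
  next
    case False
    then obtain u0 where u0: "u0 \<in> U" "c v u0 \<noteq> 0" by auto
    let ?U = "U - {u0}"
    have fin: "finite ?U" and "card V < card ?U" using insert u0 by auto
    from insert.IH[OF this, of "\<lambda>w u. c w u - c w u0 * c v u / c v u0"] obtain f where
      f: "\<exists>u\<in>?U. f u \<noteq> 0" "\<forall>w\<in>V. (\<Sum>u\<in>?U. (c w u - c w u0 * c v u / c v u0) * f u) = 0"
      by blast
    define s where "s = (\<Sum>u\<in>?U. c v u * f u)"
    \<comment> \<open>u0 is the pivot of the equation v: the other equations were reduced modulo v
      before the induction hypothesis was applied, and the value at u0 is now chosen to solve
      v.\<close>
    define g where "g = f(u0 := - s / c v u0)"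
    have split: "(\<Sum>u\<in>U. c w u * g u) = c w u0 * (- s / c v u0) + (\<Sum>u\<in>?U. c w u * f u)" for w
    proof -
      have "(\<Sum>u\<in>U. c w u * g u) = c w u0 * g u0 + (\<Sum>u\<in>?U. c w u * g u)"
        by (rule sum.remove[OF insert.prems(1) u0(1)])
      also have "(\<Sum>u\<in>?U. c w u * g u) = (\<Sum>u\<in>?U. c w u * f u)"
        by (rule sum.cong) (auto simp: g_def)
      finally show ?thesis by (simp add: g_def)
    qed
    have "(\<Sum>u\<in>U. c v u * g u) = 0" unfolding split using u0 by (simp add: s_def)
    moreover have "(\<Sum>u\<in>U. c w u * g u) = 0" if w: "w \<in> V" for w
    proof -
      have "0 = (\<Sum>u\<in>?U. c w u * f u - c w u0 / c v u0 * (c v u * f u))"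
        using f(2)[rule_format, OF w] by (simp add: algebra_simps)
      also have "\<dots> = (\<Sum>u\<in>?U. c w u * f u) - c w u0 / c v u0 * s"
        by (simp add: sum_subtractf s_def sum_distrib_left)
      finally show ?thesis unfolding split by (simp add: field_simps)
    qed
    moreover have "\<exists>u\<in>U. g u \<noteq> 0" using f(1) by (auto simp: g_def)
    ultimately show ?thesis by auto
  qed
qed

lemma common_denominator:
  fixes f :: "'u \<Rightarrow> rat"
  assumes "finite U"
  shows "\<exists>N::int. N \<noteq> 0 \<and> (\<forall>u\<in>U. \<exists>m::int. of_int N * f u = of_int m)"
  using assms
proof (induction rule: finite_induct)
  case empty show ?case by (intro exI[of _ 1]) auto
next
  case (insert x U)
  then obtain N :: int where N: "N \<noteq> 0" "\<forall>u\<in>U. \<exists>m::int. of_int N * f u = of_int m" by blast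
  obtain a b where ab: "f x = of_int a / of_int b" "b > 0"
    by (metis quotient_of_div quotient_of_denom_pos surj_pair)
  show ?case
  proof (rule exI[of _ "b * N"], intro conjI ballI)
    show "b * N \<noteq> 0" using ab N by simp
    fix u assume u: "u \<in> insert x U"
    show "\<exists>m::int. of_int (b * N) * f u = of_int m"
    proof (cases "u = x")
      case True
      have "of_int (b * N) * f u = of_int (a * N)" using ab True by simp
      then show ?thesis by blast
    next
      case False
      with u N(2) obtain m where "of_int N * f u = of_int m" by blast
      hence "of_int (b * N) * f u = of_int (b * m)" by (simp add: mult.assoc)
      then show ?thesis by blast
    qed
  qed
qed

text \<open>A Q-linear functional from C to Q that sends \<open>v u0\<close> to 1 carries the
  solution to a rational one, since the equations have integer coefficients; then denominators are
  cleared. Coordinates that vanish keep vanishing, so the support does not grow.\<close>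

lemma integer_solution_of_complex:
  fixes c :: "'w \<Rightarrow> 'u \<Rightarrow> int" and v :: "'u \<Rightarrow> complex"
  assumes U: "finite U" and u0: "u0 \<in> U" "v u0 \<noteq> 0"
    and sol: "\<And>w. w \<in> W \<Longrightarrow> (\<Sum>u\<in>U. of_int (c w u) * v u) = 0"
  shows "\<exists>f::'u \<Rightarrow> int. (\<exists>u\<in>U. f u \<noteq> 0) \<and> (\<forall>w\<in>W. (\<Sum>u\<in>U. c w u * f u) = 0) \<and> (\<forall>u\<in>U. v u = 0 \<longrightarrow> f u = 0)"
proof -
  interpret CR: vector_space "\<lambda>(r::rat) (z::complex). of_rat r * z"
    by unfold_locales (auto simp: algebra_simps of_rat_add of_rat_mult)
  interpret RR: vector_space "\<lambda>(r::rat) (z::rat). r * z"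
    by unfold_locales (auto simp: algebra_simps)
  interpret P: vector_space_pair "\<lambda>(r::rat) (z::complex). of_rat r * z" "\<lambda>(r::rat) (z::rat). r * z" ..
  have "CR.independent {v u0}" using u0 by (simp add: CR.dependent_single)
  from P.linear_independent_extend[OF this, of "\<lambda>_. 1"] obtain g where
    g: "Vector_Spaces.linear (\<lambda>(r::rat) (z::complex). of_rat r * z) (\<lambda>(r::rat) (z::rat). r * z) g" "g (v u0) = 1"
    by auto
  interpret g: Vector_Spaces.linear "\<lambda>(r::rat) (z::complex). of_rat r * z" "\<lambda>(r::rat) (z::rat). r * z" g by fact
  have gi: "g (of_int m * z) = of_int m * g z" for m z
    using g.scale[of "of_int m" z] by simp
  obtain N :: int where N: "N \<noteq> 0" "\<forall>u\<in>U. \<exists>m::int. of_int N * g (v u) = of_int m"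
    using common_denominator[OF U, of "\<lambda>u. g (v u)"] by blast
  then obtain f :: "'u \<Rightarrow> int" where f: "\<And>u. u \<in> U \<Longrightarrow> of_int N * g (v u) = of_int (f u)" by metis
  have "f u0 \<noteq> 0" using f[OF u0(1)] g(2) N by auto
  moreover have "(\<Sum>u\<in>U. c w u * f u) = 0" if w: "w \<in> W" for w
  proof -
    have "of_int (\<Sum>u\<in>U. c w u * f u) = (\<Sum>u\<in>U. of_int (c w u) * (of_int N * g (v u)))"
      by (simp add: f)
    also have "\<dots> = of_int N * (\<Sum>u\<in>U. g (of_int (c w u) * v u))"
      unfolding sum_distrib_left by (intro sum.cong refl) (simp add: gi)
    also have "(\<Sum>u\<in>U. g (of_int (c w u) * v u)) = g (\<Sum>u\<in>U. of_int (c w u) * v u)"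
      by (rule g.sum[symmetric])
    also have "\<dots> = 0" unfolding sol[OF w] by (rule g.zero)
    finally show ?thesis by (metis mult_zero_right of_int_eq_0_iff)
  qed
  moreover have "f u = 0" if "u \<in> U" "v u = 0" for u
    using f[OF that(1)] that(2) g.zero by simp
  ultimately show ?thesis using u0(1) by (intro exI[of _ f]) auto
qed

lemma index_mult_mat_sum:
  assumes "A \<in> carrier_mat n n" "B \<in> carrier_mat n n" "i < n" "j < n"
  shows "(A * B) $$ (i,j) = (\<Sum>k<n. A $$ (i,k) * B $$ (k,j))"
  using assms by (simp add: scalar_prod_def lessThan_atLeast0)

text \<open>X indexes the unknowns and Y the equations. A bound C for the absolute row sums of the
  Gram matrix also bounds its eigenvalues.\<close>

locale gram =
  fixes X :: "'x set" and Y :: "'y set" and a :: "'y \<Rightarrow> 'x \<Rightarrow> int" and C :: int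
  assumes finX: "finite X" and finY: "finite Y" and C1: "1 \<le> C"
    and row_sum: "\<And>x. x \<in> X \<Longrightarrow> (\<Sum>x'\<in>X. \<bar>\<Sum>y\<in>Y. a y x * a y x'\<bar>) \<le> C"
begin

definition M :: "'x \<Rightarrow> 'x \<Rightarrow> int" where "M x x' = (\<Sum>y\<in>Y. a y x * a y x')"

text \<open>The eigenvalues of T lie between 0 and C, and C itself belongs to the kernel of the
  system. Hence the trace of the k-th power divided by C^k is at least the nullity and approaches it
  as k grows.\<close>

definition T :: "'x \<Rightarrow> 'x \<Rightarrow> int" where "T x x' = C * of_bool (x = x') - M x x'"

fun Tpow :: "nat \<Rightarrow> 'x \<Rightarrow> 'x \<Rightarrow> int" where
  "Tpow 0 x x' = of_bool (x = x')"
| "Tpow (Suc k) x x' = (\<Sum>z\<in>X. T x z * Tpow k z x')"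

text \<open>The Gram matrix is transported along an enumeration of X. The last clause keeps the
  arithmetic information: the monic polynomial of the eigenvalues has integer coefficients.\<close>

lemma diagonalization:
  "\<exists>(e :: nat \<Rightarrow> complex) p q.
    (\<forall>x\<in>X. \<forall>x'\<in>X. (\<Sum>k<card X. p x k * q k x') = of_bool (x = x')) \<and>
    (\<forall>k<card X. \<forall>l<card X. (\<Sum>x\<in>X. q k x * p x l) = of_bool (k = l)) \<and>
    (\<forall>x\<in>X. \<forall>x'\<in>X. of_int (M x x') = (\<Sum>k<card X. p x k * e k * q k x')) \<and>
    (\<exists>P :: int poly. map_poly of_int P = (\<Prod>k<card X. [:- e k, 1:]))"
proof -
  define n where "n = card X"
  obtain \<beta> where \<beta>: "bij_betw \<beta> {..<n} X"
    using ex_bij_betw_nat_finite[OF finX] by (auto simp: n_def lessThan_atLeast0)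
  define Mi where "Mi = mat n n (\<lambda>(i,j). M (\<beta> i) (\<beta> j))"
  define Mc :: "complex mat" where "Mc = map_mat of_int Mi"
  have Mi: "Mi \<in> carrier_mat n n" by (simp add: Mi_def)
  have Mc: "Mc \<in> carrier_mat n n" by (simp add: Mc_def Mi)
  have sym: "M x x' = M x' x" for x x' unfolding M_def by (simp add: mult.commute)
  have "hermitian_mat Mc" unfolding hermitian_mat_def Mc_def Mi_def using sym by auto
  from hermitian_diagonalizable[OF Mc this] obtain es P Q where
    d: "length es = n" "P \<in> carrier_mat n n" "Q \<in> carrier_mat n n"
    "P * Q = 1\<^sub>m n" "Q * P = 1\<^sub>m n"
    "Mc = P * mat n n (\<lambda>(i,j). if i = j then es ! i else 0) * Q"
    "char_poly Mc = (\<Prod>e\<leftarrow>es. [:- e, 1:])" .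
  let ?D = "mat n n (\<lambda>(i,j). if i = j then es ! i else 0)"
  define \<gamma> where "\<gamma> = inv_into {..<n} \<beta>"
  have \<gamma>: "\<gamma> x < n" "\<beta> (\<gamma> x) = x" if "x \<in> X" for x
    using that \<beta> unfolding \<gamma>_def bij_betw_def by (metis inv_into_into lessThan_iff, metis f_inv_into_f)
  have \<gamma>\<beta>: "\<gamma> (\<beta> k) = k" if "k < n" for k
    using that \<beta> unfolding \<gamma>_def bij_betw_def by (auto simp: inv_into_f_f)
  define p where "p = (\<lambda>x k. P $$ (\<gamma> x, k))"
  define q where "q = (\<lambda>k x. Q $$ (k, \<gamma> x))"
  have PQ: "(\<Sum>k<n. P $$ (i,k) * Q $$ (k,j)) = of_bool (i = j)" if "i < n" "j < n" for i j
  proof -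
    have "(\<Sum>k<n. P $$ (i,k) * Q $$ (k,j)) = (P * Q) $$ (i,j)"
      using that d(2,3) by (simp add: scalar_prod_def lessThan_atLeast0)
    also have "\<dots> = of_bool (i = j)" unfolding d(4) using that by simp
    finally show ?thesis .
  qed
  have QP: "(\<Sum>k<n. Q $$ (i,k) * P $$ (k,j)) = of_bool (i = j)" if "i < n" "j < n" for i j
  proof -
    have "(\<Sum>k<n. Q $$ (i,k) * P $$ (k,j)) = (Q * P) $$ (i,j)"
      using that d(2,3) by (simp add: scalar_prod_def lessThan_atLeast0)
    also have "\<dots> = of_bool (i = j)" unfolding d(5) using that by simp
    finally show ?thesis .
  qed
  have PD: "(P * ?D) $$ (i,k) = P $$ (i,k) * es ! k" if "i < n" "k < n" for i k
  proof -
    have "(P * ?D) $$ (i,k) = (\<Sum>l<n. P $$ (i,l) * (if l = k then es ! l else 0))"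
      using that d(2) by (simp add: scalar_prod_def lessThan_atLeast0)
    also have "\<dots> = (\<Sum>l<n. if l = k then P $$ (i,k) * es ! k else 0)"
      by (intro sum.cong) auto
    finally show ?thesis using that by simp
  qed
  have MP: "Mc $$ (i,j) = (\<Sum>k<n. P $$ (i,k) * es ! k * Q $$ (k,j))" if "i < n" "j < n" for i j
  proof -
    have PDc: "P * ?D \<in> carrier_mat n n" using d(2) by simp
    have "Mc $$ (i,j) = (P * ?D * Q) $$ (i,j)" by (simp add: d(6)[symmetric])
    also have "\<dots> = (\<Sum>k<n. (P * ?D) $$ (i,k) * Q $$ (k,j))"
      by (rule index_mult_mat_sum[OF PDc d(3) that])
    finally show ?thesis using that PD by simp
  qed
  have "\<exists>P :: int poly. map_poly of_int P = (\<Prod>k<n. [:- es ! k, 1:])"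
  proof (intro exI[of _ "char_poly Mi"])
    have "map_poly of_int (char_poly Mi) = char_poly Mc"
      unfolding Mc_def by (rule of_int_hom.char_poly_hom[OF Mi, symmetric])
    also have "\<dots> = (\<Prod>k<n. [:- es ! k, 1:])" unfolding d(7) d(1)[symmetric]
      by (simp add: prod.list_conv_set_nth lessThan_atLeast0)
    finally show "map_poly of_int (char_poly Mi) = (\<Prod>k<n. [:- es ! k, 1:])" .
  qed
  show ?thesis unfolding n_def[symmetric]
  proof (rule exI[of _ "\<lambda>k. es ! k"], rule exI[of _ p], rule exI[of _ q], intro conjI ballI allI impI)
    fix x x' assume x: "x \<in> X" "x' \<in> X"
    have "\<gamma> x = \<gamma> x' \<longleftrightarrow> x = x'" using \<gamma> x by metis
    then show "(\<Sum>k<n. p x k * q k x') = of_bool (x = x')" using PQ \<gamma> x by (simp add: p_def q_def)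
  next
    fix x x' assume x: "x \<in> X" "x' \<in> X"
    show "of_int (M x x') = (\<Sum>k<n. p x k * es ! k * q k x')"
      using MP[of "\<gamma> x" "\<gamma> x'"] \<gamma> x by (simp add: p_def q_def Mc_def Mi_def)
  next
    fix k l assume kl: "k < n" "l < n"
    have "(\<Sum>x\<in>X. q k x * p x l) = (\<Sum>i<n. q k (\<beta> i) * p (\<beta> i) l)"
      by (rule sum.reindex_bij_betw[OF \<beta>, symmetric])
    also have "\<dots> = (\<Sum>i<n. Q $$ (k,i) * P $$ (i,l))"
      by (intro sum.cong) (auto simp: q_def p_def \<gamma>\<beta>)
    finally show "(\<Sum>x\<in>X. q k x * p x l) = of_bool (k = l)" using QP kl by simp
  qed fact
qed

text \<open>The lower bound on the product of the nonzero eigenvalues is the determinant bound. It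
  limits the proportion of nonzero eigenvalues below a threshold in terms of C and the threshold
  alone.\<close>

definition spectral :: "(nat \<Rightarrow> real) \<Rightarrow> ('x \<Rightarrow> nat \<Rightarrow> complex) \<Rightarrow> (nat \<Rightarrow> 'x \<Rightarrow> complex) \<Rightarrow> bool" where
  "spectral r p q \<longleftrightarrow>
    (\<forall>x\<in>X. \<forall>x'\<in>X. (\<Sum>k<card X. p x k * q k x') = of_bool (x = x')) \<and>
    (\<forall>k<card X. \<forall>l<card X. (\<Sum>x\<in>X. q k x * p x l) = of_bool (k = l)) \<and>
    (\<forall>x\<in>X. \<forall>x'\<in>X. of_int (M x x') = (\<Sum>k<card X. p x k * of_real (r k) * q k x')) \<and>
    (\<forall>k<card X. 0 \<le> r k \<and> r k \<le> C) \<and>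
    1 \<le> (\<Prod>k\<in>{k\<in>{..<card X}. r k \<noteq> 0}. r k) \<and>
    (\<forall>k<card X. \<forall>y\<in>Y. r k = 0 \<longrightarrow> (\<Sum>x\<in>X. of_int (a y x) * p x k) = 0)"

lemma spectralD:
  assumes "spectral r p q"
  shows "\<And>x x'. x \<in> X \<Longrightarrow> x' \<in> X \<Longrightarrow> (\<Sum>k<card X. p x k * q k x') = of_bool (x = x')"
    "\<And>k l. k < card X \<Longrightarrow> l < card X \<Longrightarrow> (\<Sum>x\<in>X. q k x * p x l) = of_bool (k = l)"
    "\<And>x x'. x \<in> X \<Longrightarrow> x' \<in> X \<Longrightarrow> complex_of_int (M x x') = (\<Sum>k<card X. p x k * of_real (r k) * q k x')"
    "\<And>k. k < card X \<Longrightarrow> 0 \<le> r k" "\<And>k. k < card X \<Longrightarrow> r k \<le> C"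
    "1 \<le> (\<Prod>k\<in>{k\<in>{..<card X}. r k \<noteq> 0}. r k)"
    "\<And>k y. k < card X \<Longrightarrow> r k = 0 \<Longrightarrow> y \<in> Y \<Longrightarrow> (\<Sum>x\<in>X. of_int (a y x) * p x k) = 0"
  using assms unfolding spectral_def by - (elim conjE; blast)+

lemma integer_spectrum: "\<exists>r p q. spectral r p q"
proof -
  define n where "n = card X"
  obtain e :: "nat \<Rightarrow> complex" and p q where d:
    "\<And>x x'. x \<in> X \<Longrightarrow> x' \<in> X \<Longrightarrow> (\<Sum>k<n. p x k * q k x') = of_bool (x = x')"
    "\<And>k l. k < n \<Longrightarrow> l < n \<Longrightarrow> (\<Sum>x\<in>X. q k x * p x l) = of_bool (k = l)"
    "\<And>x x'. x \<in> X \<Longrightarrow> x' \<in> X \<Longrightarrow> of_int (M x x') = (\<Sum>k<n. p x k * e k * q k x')"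
    "\<exists>P :: int poly. map_poly of_int P = (\<Prod>k<n. [:- e k, 1:])"
    using diagonalization[folded n_def] by blast
  have col: "(\<Sum>x'\<in>X. of_int (M x x') * p x' k) = e k * p x k" if x: "x \<in> X" and k: "k < n" for x k
  proof -
    have "(\<Sum>x'\<in>X. of_int (M x x') * p x' k) = (\<Sum>x'\<in>X. \<Sum>l<n. p x l * e l * (q l x' * p x' k))"
      using x by (simp add: d(3) sum_distrib_right mult.assoc)
    also have "\<dots> = (\<Sum>l<n. p x l * e l * (\<Sum>x'\<in>X. q l x' * p x' k))"
      by (subst sum.swap) (simp add: sum_distrib_left)
    also have "\<dots> = (\<Sum>l<n. if l = k then e k * p x k else 0)"
      by (intro sum.cong) (auto simp: d(2) k)
    finally show ?thesis using k by simp
  qed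
  have nz: "\<exists>x\<in>X. p x k \<noteq> 0" if "k < n" for k
  proof (rule ccontr)
    assume "\<not> ?thesis"
    hence "(\<Sum>x\<in>X. q k x * p x k) = 0" by simp
    with d(2)[OF that that] show False by simp
  qed
  \<comment> \<open>The squared norm of the image of the k-th eigenvector under a is the eigenvalue
    times the squared norm of the eigenvector. Hence the eigenvalue is a nonnegative Rayleigh
    quotient, and if it is 0 then every row kills the eigenvector.\<close>
  have quad: "complex_of_real (\<Sum>y\<in>Y. (cmod (\<Sum>x\<in>X. of_int (a y x) * p x k))\<^sup>2)
      = e k * complex_of_real (\<Sum>x\<in>X. (cmod (p x k))\<^sup>2)" if k: "k < n" for k
  proof -
    have "complex_of_real (\<Sum>y\<in>Y. (cmod (\<Sum>x\<in>X. of_int (a y x) * p x k))\<^sup>2)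
      = (\<Sum>y\<in>Y. (\<Sum>x'\<in>X. of_int (a y x') * p x' k) * cnj (\<Sum>x\<in>X. of_int (a y x) * p x k))"
      unfolding of_real_sum by (intro sum.cong refl) (rule complex_norm_square)
    also have "\<dots> = (\<Sum>y\<in>Y. \<Sum>x\<in>X. \<Sum>x'\<in>X. cnj (p x k) * (of_int (a y x) * of_int (a y x') * p x' k))"
      unfolding cnj_sum sum_product by (rule sum.cong[OF refl], subst sum.swap) (simp add: mult_ac)
    also have "\<dots> = (\<Sum>x\<in>X. \<Sum>y\<in>Y. \<Sum>x'\<in>X. cnj (p x k) * (of_int (a y x) * of_int (a y x') * p x' k))"
      by (rule sum.swap)
    also have "\<dots> = (\<Sum>x\<in>X. \<Sum>x'\<in>X. \<Sum>y\<in>Y. cnj (p x k) * (of_int (a y x) * of_int (a y x') * p x' k))"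
      by (intro sum.cong refl) (rule sum.swap)
    also have "\<dots> = (\<Sum>x\<in>X. cnj (p x k) * (\<Sum>x'\<in>X. of_int (M x x') * p x' k))"
      by (simp add: M_def sum_distrib_left sum_distrib_right mult_ac)
    also have "\<dots> = (\<Sum>x\<in>X. e k * (p x k * cnj (p x k)))"
      by (intro sum.cong refl) (simp add: col k)
    also have "\<dots> = e k * complex_of_real (\<Sum>x\<in>X. (cmod (p x k))\<^sup>2)"
      unfolding of_real_sum sum_distrib_left by (simp only: complex_norm_square)
    finally show ?thesis .
  qed
  have pos: "(\<Sum>x\<in>X. (cmod (p x k))\<^sup>2) > 0" if k: "k < n" for k
  proof -
    obtain x where "x \<in> X" "p x k \<noteq> 0" using nz[OF k] by auto
    thus ?thesis by (intro sum_pos2[OF finX, of x]) auto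
  qed
  define r where "r k = (\<Sum>y\<in>Y. (cmod (\<Sum>x\<in>X. of_int (a y x) * p x k))\<^sup>2) / (\<Sum>x\<in>X. (cmod (p x k))\<^sup>2)" for k
  have er: "e k = of_real (r k)" if "k < n" for k
  proof -
    have "complex_of_real (\<Sum>x\<in>X. (cmod (p x k))\<^sup>2) \<noteq> 0" using pos[OF that] by (metis less_irrefl of_real_eq_0_iff)
    then show ?thesis using quad[OF that] unfolding r_def of_real_divide by (simp add: field_simps)
  qed
  have r0: "0 \<le> r k" for k unfolding r_def by (intro divide_nonneg_nonneg sum_nonneg) auto
  \<comment> \<open>Read the eigenvalue equation at a coordinate of largest modulus.\<close>
  have rC: "r k \<le> C" if k: "k < n" for k
  proof -
    have "X \<noteq> {}" using k by (auto simp: n_def)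
    define m where "m = Max ((\<lambda>x. cmod (p x k)) ` X)"
    have mx: "cmod (p x k) \<le> m" if "x \<in> X" for x using that finX by (simp add: m_def)
    have "m \<in> (\<lambda>x. cmod (p x k)) ` X" unfolding m_def using finX \<open>X \<noteq> {}\<close> by (intro Max_in) auto
    then obtain x where x: "x \<in> X" "cmod (p x k) = m" by blast
    obtain x' where "x' \<in> X" "p x' k \<noteq> 0" using nz[OF k] by auto
    hence m0: "m > 0" using mx[of x'] by (meson less_le_trans zero_less_norm_iff)
    have "r k * m = cmod (e k * p x k)" using er[OF k] r0[of k] x by (simp add: norm_mult)
    also have "\<dots> = cmod (\<Sum>x'\<in>X. of_int (M x x') * p x' k)" using col[OF x(1) k] by simp
    also have "\<dots> \<le> (\<Sum>x'\<in>X. \<bar>of_int (M x x')\<bar> * m)"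
      by (intro order_trans[OF norm_sum] sum_mono) (auto simp: norm_mult mx intro!: mult_left_mono)
    also have "\<dots> = of_int (\<Sum>x'\<in>X. \<bar>M x x'\<bar>) * m" by (simp add: sum_distrib_right)
    also have "\<dots> \<le> of_int C * m"
      using row_sum[OF x(1)] m0 by (intro mult_right_mono) (auto simp: M_def simp flip: of_int_abs of_int_sum)
    finally show ?thesis using m0 by simp
  qed
  obtain P :: "int poly" where P: "map_poly of_int P = (\<Prod>k<n. [:- e k, 1:])" using d(4) by blast
  let ?Z = "{k\<in>{..<n}. r k = 0}" and ?N = "{k\<in>{..<n}. r k \<noteq> 0}"
  \<comment> \<open>The zero eigenvalues contribute a power of the variable, so the coefficient in
    the degree of that power is, up to sign, the product of the nonzero ones. It is an integer
    different from 0.\<close>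
  have "(\<Prod>k<n. [:- e k, 1:]) = (\<Prod>k\<in>?Z. [:- e k, 1:]) * (\<Prod>k\<in>?N. [:- e k, 1:])"
    by (subst prod.union_disjoint[symmetric]) (auto intro: prod.cong)
  also have "(\<Prod>k\<in>?Z. [:- e k, 1:]) = (\<Prod>k\<in>?Z. [:0, 1:])"
    by (intro prod.cong refl) (auto simp: er)
  also have "\<dots> = monom 1 (card ?Z)" by (simp add: monom_altdef)
  finally have "coeff (map_poly of_int P) (card ?Z) = coeff (\<Prod>k\<in>?N. [:- e k, 1:]) 0"
    unfolding P by (simp add: coeff_monom_mult)
  also have "\<dots> = (\<Prod>k\<in>?N. - e k)" by (simp add: poly_0_coeff_0[symmetric] poly_prod)
  finally have ci: "of_int (coeff P (card ?Z)) = (\<Prod>k\<in>?N. - e k)" by (simp add: coeff_map_poly)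
  have cm: "cmod (\<Prod>k\<in>?N. - e k) = (\<Prod>k\<in>?N. r k)"
    unfolding prod_norm[symmetric] by (intro prod.cong) (auto simp: er r0)
  have "(\<Prod>k\<in>?N. r k) \<noteq> 0" by auto
  hence "coeff P (card ?Z) \<noteq> 0" using ci cm by (metis norm_zero of_int_0)
  hence "1 \<le> cmod (of_int (coeff P (card ?Z)))" by simp
  hence pr: "1 \<le> (\<Prod>k\<in>?N. r k)" unfolding ci cm .
  have ker: "(\<Sum>x\<in>X. of_int (a y x) * p x k) = 0" if "k < n" "r k = 0" "y \<in> Y" for k y
  proof -
    have "(\<Sum>y\<in>Y. (cmod (\<Sum>x\<in>X. of_int (a y x) * p x k))\<^sup>2) = 0"
      using that(2) pos[OF that(1)] unfolding r_def by auto
    thus ?thesis using that(3) finY by (simp add: sum_nonneg_eq_0_iff)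
  qed
  have Mr: "of_int (M x x') = (\<Sum>k<n. p x k * of_real (r k) * q k x')" if "x \<in> X" "x' \<in> X" for x x'
    unfolding d(3)[OF that] by (intro sum.cong refl) (simp add: er)
  show ?thesis unfolding spectral_def n_def[symmetric]
    by (rule exI[of _ r], rule exI[of _ p], rule exI[of _ q], intro conjI ballI allI impI)
       (rule d Mr r0 rC pr ker; assumption)+
qed

end

section \<open>Bounds for the trace of a power\<close>

context gram
begin

text \<open>T is conjugate to the diagonal matrix with entries \<open>C - r l\<close> through the
  mutually inverse p and q.\<close>

lemma trace_eigenvalues:
  fixes p q and r :: "nat \<Rightarrow> real"
  assumes pq: "\<And>x x'. x \<in> X \<Longrightarrow> x' \<in> X \<Longrightarrow> (\<Sum>k<card X. p x k * q k x') = of_bool (x = x')"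
    and qp: "\<And>k l. k < card X \<Longrightarrow> l < card X \<Longrightarrow> (\<Sum>x\<in>X. q k x * p x l) = of_bool (k = l)"
    and M: "\<And>x x'. x \<in> X \<Longrightarrow> x' \<in> X \<Longrightarrow> complex_of_int (M x x') = (\<Sum>k<card X. p x k * of_real (r k) * q k x')"
  shows "real_of_int (\<Sum>x\<in>X. Tpow k x x) = (\<Sum>l<card X. (C - r l) ^ k)"
proof -
  define n where "n = card X"
  have T: "complex_of_int (T x x') = (\<Sum>l<n. p x l * of_real (C - r l) * q l x')" if "x \<in> X" "x' \<in> X" for x x'
  proof -
    have "complex_of_int (T x x') = of_int C * (\<Sum>l<n. p x l * q l x') - (\<Sum>k<n. p x k * of_real (r k) * q k x')"
      unfolding T_def using that by (simp add: pq M n_def)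
    also have "\<dots> = (\<Sum>l<n. p x l * of_real (C - r l) * q l x')"
      by (simp add: sum_distrib_left sum_subtractf[symmetric] algebra_simps)
    finally show ?thesis .
  qed
  have Tp: "complex_of_int (Tpow k x x') = (\<Sum>l<n. p x l * of_real ((C - r l) ^ k) * q l x')"
    if "x \<in> X" "x' \<in> X" for x x'
    using that
  proof (induction k arbitrary: x x')
    case 0
    then show ?case by (simp add: pq n_def)
  next
    case (Suc k)
    have "complex_of_int (Tpow (Suc k) x x') = (\<Sum>z\<in>X. of_int (T x z) * of_int (Tpow k z x'))" by simp
    also have "\<dots> = (\<Sum>z\<in>X. (\<Sum>l<n. p x l * of_real (C - r l) * q l z) * (\<Sum>m<n. p z m * of_real ((C - r m) ^ k) * q m x'))"
      by (intro sum.cong refl) (simp only: T Suc)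
    also have "\<dots> = (\<Sum>z\<in>X. \<Sum>l<n. \<Sum>m<n. (p x l * of_real (C - r l) * of_real ((C - r m) ^ k) * q m x') * (q l z * p z m))"
      unfolding sum_product by (intro sum.cong refl) (simp only: mult_ac)
    also have "\<dots> = (\<Sum>l<n. \<Sum>z\<in>X. \<Sum>m<n. (p x l * of_real (C - r l) * of_real ((C - r m) ^ k) * q m x') * (q l z * p z m))"
      by (rule sum.swap)
    also have "\<dots> = (\<Sum>l<n. \<Sum>m<n. \<Sum>z\<in>X. (p x l * of_real (C - r l) * of_real ((C - r m) ^ k) * q m x') * (q l z * p z m))"
      by (intro sum.cong refl sum.swap)
    also have "\<dots> = (\<Sum>l<n. \<Sum>m<n. (p x l * of_real (C - r l) * of_real ((C - r m) ^ k) * q m x') * of_bool (l = m))"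
      by (intro sum.cong refl) (simp add: sum_distrib_left[symmetric] qp n_def)
    also have "\<dots> = (\<Sum>l<n. \<Sum>m<n. if m = l then p x l * of_real ((C - r l) ^ Suc k) * q l x' else 0)"
      by (intro sum.cong refl) (auto simp: mult_ac)
    finally show ?case by simp
  qed
  have "complex_of_int (\<Sum>x\<in>X. Tpow k x x) = (\<Sum>x\<in>X. \<Sum>l<n. of_real ((C - r l) ^ k) * (q l x * p x l))"
    by (simp only: of_int_sum, intro sum.cong refl) (simp add: Tp mult_ac)
  also have "\<dots> = (\<Sum>l<n. \<Sum>x\<in>X. of_real ((C - r l) ^ k) * (q l x * p x l))" by (rule sum.swap)
  also have "\<dots> = (\<Sum>l<n. of_real ((C - r l) ^ k))"
    by (intro sum.cong refl) (simp add: sum_distrib_left[symmetric] qp n_def)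
  also have "\<dots> = complex_of_real (\<Sum>l<n. (C - r l) ^ k)" by simp
  finally have "complex_of_real (real_of_int (\<Sum>x\<in>X. Tpow k x x)) = complex_of_real (\<Sum>l<n. (C - r l) ^ k)"
    by (simp only: of_real_of_int_eq)
  then show ?thesis unfolding n_def of_real_eq_iff .
qed

text \<open>The columns of b are solutions of the system without integral relations, so the nullity
  is at least their number. Each zero eigenvalue contributes C^k to the trace, and the others
  contribute at least 0.\<close>

lemma trace_lower_bound:
  fixes b :: "'x \<Rightarrow> 'z \<Rightarrow> int"
  assumes Z: "finite Z"
    and ker: "\<And>y z. y \<in> Y \<Longrightarrow> z \<in> Z \<Longrightarrow> (\<Sum>x\<in>X. a y x * b x z) = 0"
    and inj: "\<And>f::'z \<Rightarrow> int. (\<And>x. x \<in> X \<Longrightarrow> (\<Sum>z\<in>Z. b x z * f z) = 0) \<Longrightarrow> \<forall>z\<in>Z. f z = 0"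
  shows "real (card Z) * of_int C ^ k \<le> of_int (\<Sum>x\<in>X. Tpow k x x)"
proof -
  define n where "n = card X"
  obtain r p q where "spectral r p q" using integer_spectrum by blast
  note d = spectralD[OF this, folded n_def]
  define Z0 where "Z0 = {k\<in>{..<n}. r k = 0}"
  have "card Z \<le> card Z0"
  proof (rule ccontr)
    assume "\<not> ?thesis"
    hence "card Z0 < card Z" by simp
    moreover have "finite Z0" by (simp add: Z0_def)
    \<comment> \<open>With fewer null eigenvectors than columns, some nontrivial combination g of
      the columns has zero coordinate along each of them. The Gram matrix kills g, so the other
      coordinates vanish too and g = 0. A complex relation among integral columns then yields an
      integral one.\<close>
    ultimately obtain f where f: "\<exists>z\<in>Z. f z \<noteq> 0" 
        "\<forall>k\<in>Z0. (\<Sum>z\<in>Z. (\<Sum>x\<in>X. q k x * of_int (b x z)) * f z) = 0"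
      using underdetermined_system[OF _ Z, of Z0 "\<lambda>k z. \<Sum>x\<in>X. q k x * of_int (b x z)"] by blast
    define g where "g x = (\<Sum>z\<in>Z. of_int (b x z) * f z)" for x
    have ag: "(\<Sum>x\<in>X. of_int (a y x) * g x) = 0" if y: "y \<in> Y" for y
    proof -
      have "(\<Sum>x\<in>X. of_int (a y x) * g x) = (\<Sum>x\<in>X. \<Sum>z\<in>Z. of_int (a y x * b x z) * f z)"
        by (simp add: g_def sum_distrib_left mult.assoc)
      also have "\<dots> = (\<Sum>z\<in>Z. \<Sum>x\<in>X. of_int (a y x * b x z) * f z)" by (rule sum.swap)
      also have "\<dots> = (\<Sum>z\<in>Z. of_int (\<Sum>x\<in>X. a y x * b x z) * f z)" by (simp add: sum_distrib_right)
      finally show ?thesis using ker y by simp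
    qed
    have Mg: "(\<Sum>x'\<in>X. of_int (M x x') * g x') = 0" for x
    proof -
      have "(\<Sum>x'\<in>X. of_int (M x x') * g x') = (\<Sum>x'\<in>X. \<Sum>y\<in>Y. of_int (a y x) * (of_int (a y x') * g x'))"
        by (simp add: M_def sum_distrib_right mult.assoc)
      also have "\<dots> = (\<Sum>y\<in>Y. of_int (a y x) * (\<Sum>x'\<in>X. of_int (a y x') * g x'))"
        by (subst sum.swap) (simp add: sum_distrib_left)
      finally show ?thesis using ag by simp
    qed
    define h where "h k = (\<Sum>x\<in>X. q k x * g x)" for k
    have h0: "h k = 0" if k: "k < n" for k
    proof (cases "r k = 0")
      case True
      have "h k = (\<Sum>x\<in>X. \<Sum>z\<in>Z. q k x * of_int (b x z) * f z)" by (simp add: h_def g_def sum_distrib_left mult.assoc)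
      also have "\<dots> = (\<Sum>z\<in>Z. (\<Sum>x\<in>X. q k x * of_int (b x z)) * f z)"
        by (subst sum.swap) (simp add: sum_distrib_right)
      finally show ?thesis using f(2) True k by (simp add: Z0_def)
    next
      case False
      have "0 = (\<Sum>x\<in>X. q k x * (\<Sum>x'\<in>X. of_int (M x x') * g x'))" by (simp add: Mg)
      also have "\<dots> = (\<Sum>x\<in>X. q k x * (\<Sum>x'\<in>X. \<Sum>l<n. p x l * of_real (r l) * q l x' * g x'))"
        by (intro sum.cong refl arg_cong2[of _ _ _ _ "(*)"]) (simp add: d(3) sum_distrib_right)
      also have "\<dots> = (\<Sum>x\<in>X. q k x * (\<Sum>l<n. p x l * of_real (r l) * h l))"
        by (intro sum.cong refl arg_cong2[of _ _ _ _ "(*)"], subst sum.swap)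
           (simp add: h_def sum_distrib_left mult.assoc)
      also have "\<dots> = (\<Sum>l<n. (\<Sum>x\<in>X. q k x * p x l) * (of_real (r l) * h l))"
        unfolding sum_distrib_left sum_distrib_right by (subst sum.swap) (simp add: mult.assoc)
      also have "\<dots> = (\<Sum>l<n. if l = k then of_real (r k) * h k else 0)"
        by (intro sum.cong refl) (auto simp: d(2) k)
      finally show ?thesis using k False by simp
    qed
    have g0: "g x = 0" if x: "x \<in> X" for x
    proof -
      have "0 = (\<Sum>k<n. p x k * h k)" using h0 by simp
      also have "\<dots> = (\<Sum>x'\<in>X. (\<Sum>k<n. p x k * q k x') * g x')"
        unfolding h_def sum_distrib_left sum_distrib_right by (subst sum.swap) (simp add: mult.assoc)
      also have "\<dots> = (\<Sum>x'\<in>X. if x' = x then g x else 0)" by (intro sum.cong refl) (auto simp: d(1) x)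
      finally show ?thesis using x finX by simp
    qed
    obtain z0 where z0: "z0 \<in> Z" "f z0 \<noteq> 0" using f(1) by blast
    have "\<exists>f::'z \<Rightarrow> int. (\<exists>u\<in>Z. f u \<noteq> 0) \<and> (\<forall>w\<in>X. (\<Sum>u\<in>Z. b w u * f u) = 0) \<and> (\<forall>u\<in>Z. (f u::int) = 0 \<longrightarrow> True)"
      using integer_solution_of_complex[of Z z0 f X b] z0 Z g0 unfolding g_def by blast
    then show False using inj by blast
  qed
  hence "real (card Z) * of_int C ^ k \<le> real (card Z0) * of_int C ^ k" using C1 by (intro mult_right_mono) auto
  also have "\<dots> = (\<Sum>l\<in>Z0. (C - r l) ^ k)" by (simp add: Z0_def)
  also have "\<dots> \<le> (\<Sum>l<n. (C - r l) ^ k)" by (rule sum_mono2) (auto simp: Z0_def d(5))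
  also have "\<dots> = of_int (\<Sum>x\<in>X. Tpow k x x)"
    using trace_eigenvalues[of p q r k] d(1-3) by (simp add: n_def)
  finally show ?thesis .
qed

text \<open>The eigenvalues are sorted into zero, nonzero but at most \<epsilon>, and larger.
  Injectivity on vectors supported in W bounds the number of the first by the size of the complement
  of W, the determinant bound controls the second, and each of the third contributes at most (1 -
  \<epsilon> / C)^k after division by C^k.\<close>

lemma trace_upper_bound:
  fixes \<epsilon> :: real
  assumes W: "W \<subseteq> X" and eps: "0 < \<epsilon>" "\<epsilon> < 1"
    and inj: "\<And>f::'x \<Rightarrow> int. (\<And>x. x \<notin> W \<Longrightarrow> f x = 0) \<Longrightarrow> (\<And>y. y \<in> Y \<Longrightarrow> (\<Sum>x\<in>X. a y x * f x) = 0) \<Longrightarrow> \<forall>x\<in>W. f x = 0"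
  shows "of_int (\<Sum>x\<in>X. Tpow k x x) \<le>
    of_int C ^ k * (real (card (X - W)) + card X * (ln C / ln (1 / \<epsilon>)) + card X * (1 - \<epsilon> / C) ^ k)"
proof -
  define n where "n = card X"
  obtain r p q where "spectral r p q" using integer_spectrum by blast
  note d = spectralD[OF this, folded n_def]
  define Z0 where "Z0 = {k\<in>{..<n}. r k = 0}"
  define S where "S = {k\<in>{..<n}. r k \<noteq> 0 \<and> r k \<le> \<epsilon>}"
  define L where "L = {k\<in>{..<n}. r k \<noteq> 0 \<and> \<epsilon> < r k}"
  have fin: "finite Z0" "finite S" "finite L" by (auto simp: Z0_def S_def L_def)
  have parts: "{..<n} = Z0 \<union> S \<union> L" "Z0 \<inter> S = {}" "(Z0 \<union> S) \<inter> L = {}" "S \<inter> L = {}" "{k\<in>{..<n}. r k \<noteq> 0} = S \<union> L"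
    by (auto simp: Z0_def S_def L_def)
  have "card (S \<union> L) \<le> card {..<n}" by (rule card_mono) (auto simp: S_def L_def)
  hence cards: "card S + card L \<le> n" by (simp add: card_Un_disjoint fin parts(4))
  have C1': "1 \<le> real_of_int C" using C1 by simp
  \<comment> \<open>If there were more null eigenvectors than points outside W, a nonzero
    combination of them would vanish outside W.\<close>
  have "card Z0 \<le> card (X - W)"
  proof (rule ccontr)
    assume "\<not> ?thesis"
    hence "card (X - W) < card Z0" by simp
    with underdetermined_system[of "X - W" Z0 p] fin finX obtain f where
      f: "\<exists>l\<in>Z0. f l \<noteq> 0" "\<forall>x\<in>X-W. (\<Sum>l\<in>Z0. p x l * f l) = 0" by blast
    define g where "g x = (if x \<in> X then \<Sum>l\<in>Z0. p x l * f l else 0)" for x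
    obtain l0 where l0: "l0 \<in> Z0" "f l0 \<noteq> 0" using f(1) by blast
    have ag: "(\<Sum>x\<in>X. of_int (a y x) * g x) = 0" if y: "y \<in> Y" for y
    proof -
      have "(\<Sum>x\<in>X. of_int (a y x) * g x) = (\<Sum>x\<in>X. \<Sum>l\<in>Z0. of_int (a y x) * p x l * f l)"
        by (intro sum.cong refl) (simp add: g_def sum_distrib_left mult.assoc)
      also have "\<dots> = (\<Sum>l\<in>Z0. (\<Sum>x\<in>X. of_int (a y x) * p x l) * f l)"
        by (subst sum.swap) (simp add: sum_distrib_right)
      also have "\<dots> = 0" using d(7) y by (intro sum.neutral) (auto simp: Z0_def)
      finally show ?thesis .
    qed
    have "\<exists>x\<in>X. g x \<noteq> 0"
    proof (rule ccontr)
      assume "\<not> ?thesis"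
      hence "0 = (\<Sum>x\<in>X. q l0 x * g x)" by simp
      also have "\<dots> = (\<Sum>x\<in>X. \<Sum>l\<in>Z0. q l0 x * p x l * f l)"
        by (intro sum.cong refl) (simp add: g_def sum_distrib_left mult.assoc)
      also have "\<dots> = (\<Sum>l\<in>Z0. (\<Sum>x\<in>X. q l0 x * p x l) * f l)"
        by (subst sum.swap) (simp add: sum_distrib_right)
      also have "\<dots> = (\<Sum>l\<in>Z0. if l = l0 then f l0 else 0)"
        using l0 by (intro sum.cong refl) (auto simp: d(2) Z0_def)
      finally show False using l0 fin by simp
    qed
    then obtain x0 where x0: "x0 \<in> X" "g x0 \<noteq> 0" by blast
    have "\<exists>f::'x \<Rightarrow> int. (\<exists>u\<in>X. f u \<noteq> 0) \<and> (\<forall>w\<in>Y. (\<Sum>u\<in>X. a w u * f u) = 0) \<and> (\<forall>u\<in>X. g u = 0 \<longrightarrow> f u = 0)"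
      using integer_solution_of_complex[of X x0 g Y a] x0 finX ag by blast
    then obtain F :: "'x \<Rightarrow> int" where F: "\<exists>u\<in>X. F u \<noteq> 0" "\<forall>w\<in>Y. (\<Sum>u\<in>X. a w u * F u) = 0" "\<forall>u\<in>X. g u = 0 \<longrightarrow> F u = 0"
      by blast
    define F' where "F' x = (if x \<in> X then F x else 0)" for x
    have "F' x = 0" if "x \<notin> W" for x
      using that F(3) f(2) by (auto simp: F'_def g_def)
    moreover have "(\<Sum>x\<in>X. a y x * F' x) = 0" if "y \<in> Y" for y
      using F(2) that by (simp add: F'_def)
    ultimately have "\<forall>x\<in>W. F' x = 0" using inj by blast
    then have "\<forall>x\<in>X. F' x = 0" using \<open>\<And>x. x \<notin> W \<Longrightarrow> F' x = 0\<close> by blast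
    then show False using F(1) by (auto simp: F'_def)
  qed
  moreover have "card S * ln (1 / \<epsilon>) \<le> n * ln C"
  proof -
    \<comment> \<open>The product of all nonzero eigenvalues is at least 1, while each small factor
      is at most \<epsilon> and each of the others at most C. Too many small factors are
      impossible.\<close>
    have "1 \<le> (\<Prod>k\<in>S. r k) * (\<Prod>k\<in>L. r k)"
      using d(6) unfolding parts(5) by (simp add: prod.union_disjoint fin parts(4))
    also have "\<dots> \<le> (\<Prod>k\<in>S. \<epsilon>) * (\<Prod>k\<in>L. real_of_int C)"
    proof (rule mult_mono)
      show "(\<Prod>k\<in>S. r k) \<le> (\<Prod>k\<in>S. \<epsilon>)" by (rule prod_mono) (use d(4) in \<open>auto simp: S_def\<close>)
      show "(\<Prod>k\<in>L. r k) \<le> (\<Prod>k\<in>L. real_of_int C)" by (rule prod_mono) (use d(4,5) in \<open>auto simp: L_def\<close>)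
      show "0 \<le> (\<Prod>k\<in>S. \<epsilon>)" using eps by (intro prod_nonneg) auto
      show "0 \<le> (\<Prod>k\<in>L. r k)" by (rule prod_nonneg) (use d(4) in \<open>auto simp: L_def\<close>)
    qed
    also have "\<dots> \<le> \<epsilon> ^ card S * C ^ n"
      using cards C1' eps by (auto intro!: mult_left_mono power_increasing)
    finally have "0 \<le> ln (\<epsilon> ^ card S * C ^ n)" by simp
    also have "\<dots> = card S * ln \<epsilon> + n * ln C" using eps C1' by (simp add: ln_mult ln_realpow)
    finally show ?thesis using eps by (simp add: ln_div)
  qed
  hence "real (card S) \<le> n * (ln C / ln (1 / \<epsilon>))" using eps by (simp add: field_simps)
  moreover have "real (card L) \<le> n" using cards by simp
  ultimately have ineq: "real (card Z0) + card S + card L * (1 - \<epsilon> / C) ^ k \<le>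
     real (card (X - W)) + n * (ln C / ln (1 / \<epsilon>)) + n * (1 - \<epsilon> / C) ^ k"
    using eps C1' by (intro add_mono mult_right_mono zero_le_power) (auto simp: field_simps)
  have "of_int (\<Sum>x\<in>X. Tpow k x x) = (\<Sum>l<n. (C - r l) ^ k)"
    using trace_eigenvalues[of p q r k] d(1-3) by (simp add: n_def)
  also have "\<dots> = (\<Sum>l\<in>Z0. (C - r l) ^ k) + (\<Sum>l\<in>S. (C - r l) ^ k) + (\<Sum>l\<in>L. (C - r l) ^ k)"
    unfolding parts(1) by (simp add: sum.union_disjoint fin parts(2-4) parts(3))
  also have "\<dots> \<le> (\<Sum>l\<in>Z0. of_int C ^ k) + (\<Sum>l\<in>S. of_int C ^ k) + (\<Sum>l\<in>L. (C - \<epsilon>) ^ k)"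
    by (intro add_mono sum_mono power_mono) (use d(4,5) C1 in \<open>auto simp: Z0_def S_def L_def\<close>)
  also have "\<dots> = of_int C ^ k * (real (card Z0) + card S + card L * (1 - \<epsilon> / C) ^ k)"
  proof -
    have "(C - \<epsilon>) ^ k = of_int C ^ k * (1 - \<epsilon> / C) ^ k"
      using C1' by (simp flip: power_mult_distrib add: field_simps)
    then show ?thesis by (simp add: algebra_simps)
  qed
  also have "\<dots> \<le> of_int C ^ k * (real (card (X - W)) + n * (ln C / ln (1 / \<epsilon>)) + n * (1 - \<epsilon> / C) ^ k)"
    using ineq C1' by (intro mult_left_mono) auto
  finally show ?thesis by (simp add: n_def)
qed

end

section \<open>Finite p-groups\<close>

text \<open>Orbits have p-power size, so those with more than one point contribute a multiple of p
  to the cardinality of U.\<close>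

lemma p_group_fixed_points:
  fixes act :: "'g \<Rightarrow> 'u \<Rightarrow> 'u"
  assumes G: "group G" and p: "Factorial_Ring.prime p" and ord: "Coset.order G = p ^ k" and U: "finite U"
    and act_closed: "\<And>g u. g \<in> carrier G \<Longrightarrow> u \<in> U \<Longrightarrow> act g u \<in> U"
    and act_one: "\<And>u. u \<in> U \<Longrightarrow> act \<one>\<^bsub>G\<^esub> u = u"
    and act_mult: "\<And>g h u. g \<in> carrier G \<Longrightarrow> h \<in> carrier G \<Longrightarrow> u \<in> U \<Longrightarrow> act (g \<otimes>\<^bsub>G\<^esub> h) u = act g (act h u)"
  shows "p dvd card U \<longleftrightarrow> p dvd card {u \<in> U. \<forall>g\<in>carrier G. act g u = u}"
proof -
  interpret G: group G by (rule G)
  define \<phi> where "\<phi> g = restrict (act g) U" for g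
  have inv: "act (inv\<^bsub>G\<^esub> g) (act g u) = u" "act g (act (inv\<^bsub>G\<^esub> g) u) = u" if "g \<in> carrier G" "u \<in> U" for g u
    using that act_mult[of "inv\<^bsub>G\<^esub> g" g u] act_mult[of g "inv\<^bsub>G\<^esub> g" u] by (simp_all add: act_one)
  have bij: "\<phi> g \<in> Bij U" if g: "g \<in> carrier G" for g
  proof -
    have "bij_betw (act g) U U"
      by (rule bij_betw_byWitness[where f' = "act (inv\<^bsub>G\<^esub> g)"]) (use g act_closed inv in auto)
    then show ?thesis unfolding \<phi>_def Bij_def by (auto simp: bij_betw_restrict_eq)
  qed
  have "\<phi> \<in> hom G (BijGroup U)"
    unfolding hom_def
  proof (intro CollectI conjI ballI)
    show "\<phi> \<in> carrier G \<rightarrow> carrier (BijGroup U)" using bij by (auto simp: BijGroup_def)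
    fix g h assume gh: "g \<in> carrier G" "h \<in> carrier G"
    show "\<phi> (g \<otimes>\<^bsub>G\<^esub> h) = \<phi> g \<otimes>\<^bsub>BijGroup U\<^esub> \<phi> h"
      using bij gh by (auto simp: BijGroup_def \<phi>_def compose_def act_mult act_closed fun_eq_iff)
  qed
  then interpret group_action G U \<phi>
    by (simp add: group_action_def group_hom_def group_hom_axioms_def group_BijGroup G)
  have orb: "orbit G \<phi> u = (\<lambda>g. act g u) ` carrier G" if "u \<in> U" for u
    using that by (auto simp: orbit_def \<phi>_def)
  have fin: "finite (orbit G \<phi> u)" if "u \<in> U" for u
    using orb[OF that] act_closed that U by (auto intro: finite_subset[of _ U])
  have part: "partition U (orbits G U \<phi>)" by (rule orbit_partition)
  have unionO: "\<Union> (orbits G U \<phi>) = U" using partition.partition_coverture[OF part] .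
  have finO: "finite (orbits G U \<phi>)" using U by (simp add: orbits_def)
  define O1 where "O1 = {R \<in> orbits G U \<phi>. card R = 1}"
  have big: "p dvd card R" if R: "R \<in> orbits G U \<phi>" "card R \<noteq> 1" for R
  proof -
    obtain u where u: "u \<in> U" "R = orbit G \<phi> u" using R by (auto simp: orbits_def)
    have "card R dvd p ^ k" using orbit_stabilizer_theorem[OF u(1)] u ord by (metis dvd_triv_left)
    then obtain i where "card R = p ^ i" using p divides_primepow_nat by blast
    then show ?thesis using R(2) by (cases i) auto
  qed
  have disj: "R \<inter> R' = {}" if "R \<in> orbits G U \<phi>" "R' \<in> orbits G U \<phi>" "R \<noteq> R'" for R R'
    using partition.disjoint_sum partition.unique_class[OF part] unionO that by (metis UnionI disjoint_iff)
  have "card U = (\<Sum>R\<in>orbits G U \<phi>. card R)"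
    by (subst unionO[symmetric], rule card_Union_disjoint) (use disj fin in \<open>auto simp: orbits_def pairwise_def disjnt_def\<close>)
  also have "\<dots> = (\<Sum>R\<in>O1. card R) + (\<Sum>R\<in>orbits G U \<phi> - O1. card R)"
    by (subst add.commute, rule sum.subset_diff) (auto simp: O1_def finO)
  also have "(\<Sum>R\<in>O1. card R) = card O1" by (simp add: O1_def)
  finally have "card U = card O1 + (\<Sum>R\<in>orbits G U \<phi> - O1. card R)" .
  moreover have "p dvd (\<Sum>R\<in>orbits G U \<phi> - O1. card R)" by (rule dvd_sum) (auto simp: O1_def big)
  moreover have "O1 = (\<lambda>u. {u}) ` {u \<in> U. \<forall>g\<in>carrier G. act g u = u}"
  proof (intro equalityI subsetI)
    fix R assume R: "R \<in> O1"
    then obtain u where u: "u \<in> U" "R = orbit G \<phi> u" by (auto simp: O1_def orbits_def)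
    have cR: "card R = 1" using R by (simp add: O1_def)
    have "u \<in> R" using u orb[OF u(1)] act_one[OF u(1)] G.one_closed by (metis image_eqI)
    then have Ru: "R = {u}" using cR by (metis card_1_singletonE singletonD)
    then have "\<forall>g\<in>carrier G. act g u = u" using orb[OF u(1)] u by auto
    then show "R \<in> (\<lambda>u. {u}) ` {u \<in> U. \<forall>g\<in>carrier G. act g u = u}" using u Ru by blast
  next
    fix R assume "R \<in> (\<lambda>u. {u}) ` {u \<in> U. \<forall>g\<in>carrier G. act g u = u}"
    then obtain u where u: "u \<in> U" "\<forall>g\<in>carrier G. act g u = u" "R = {u}" by blast
    have "orbit G \<phi> u = {u}" using orb[OF u(1)] u(2) G.one_closed by force
    then show "R \<in> O1" using u by (auto simp: O1_def orbits_def)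
  qed
  hence "card O1 = card {u \<in> U. \<forall>g\<in>carrier G. act g u = u}" by (simp add: card_image)
  ultimately show ?thesis by (metis dvd_add_left_iff)
qed

text \<open>Translation by a nonzero element is a fixed-point-free action of a group of order p.\<close>

lemma prime_dvd_card_mod_space:
  fixes U :: "('x \<Rightarrow> int) set"
  assumes p: "Factorial_Ring.prime p" and U: "finite U"
    and range: "\<And>u x. u \<in> U \<Longrightarrow> 0 \<le> u x \<and> u x < int p"
    and add: "\<And>u v. u \<in> U \<Longrightarrow> v \<in> U \<Longrightarrow> (\<lambda>x. (u x + v x) mod int p) \<in> U"
    and u0: "u0 \<in> U" "u0 x0 \<noteq> 0"
  shows "p dvd card U"
proof (rule ccontr)
  assume nd: "\<not> p dvd card U"
  have p0: "p > 0" using p by (simp add: prime_gt_0_nat)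
  let ?Z = "integer_mod_group p"
  define act where "act m u = (\<lambda>x. (u x + m * u0 x) mod int p)" for m :: int and u
  have mult: "(\<lambda>x. (u x + int k * u0 x) mod int p) \<in> U" if "u \<in> U" for u k
  proof (induction k)
    case 0
    have "(\<lambda>x. (u x + int 0 * u0 x) mod int p) = u" using range[OF that] by (simp add: fun_eq_iff)
    then show ?case using that by simp
  next
    case (Suc k)
    have "(\<lambda>x. (u x + int (Suc k) * u0 x) mod int p) = (\<lambda>x. ((u x + int k * u0 x) mod int p + u0 x) mod int p)"
      by (simp add: fun_eq_iff mod_simps algebra_simps)
    then show ?case using add[OF Suc u0(1)] by simp
  qed
  interpret G: group ?Z by simp
  have closed: "act m u \<in> U" if "m \<in> carrier ?Z" "u \<in> U" for m u
    using mult[OF that(2), of "nat m"] that(1) p0 by (simp add: act_def carrier_integer_mod_group)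
  have one: "act \<one>\<^bsub>?Z\<^esub> u = u" if "u \<in> U" for u
    using range[OF that] by (simp add: act_def fun_eq_iff)
  have comp: "act (m \<otimes>\<^bsub>?Z\<^esub> m') u = act m (act m' u)" for m m' u
  proof
    fix x
    have "(u x + (m + m') mod int p * u0 x) mod int p = (u x + (m + m') * u0 x) mod int p"
      by (metis mod_add_right_eq mod_mult_left_eq)
    also have "\<dots> = ((u x + m' * u0 x) mod int p + m * u0 x) mod int p"
      by (simp add: mod_simps algebra_simps)
    finally show "act (m \<otimes>\<^bsub>?Z\<^esub> m') u x = act m (act m' u) x" by (simp add: act_def)
  qed
  have ord: "Coset.order ?Z = p ^ 1" using p0 by (simp add: Coset.order_def carrier_integer_mod_group)
  have "\<not> p dvd card {u \<in> U. \<forall>m\<in>carrier ?Z. act m u = u}"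
    using p_group_fixed_points[OF G.group_axioms p ord U closed one comp] nd by blast
  hence "{u \<in> U. \<forall>m\<in>carrier ?Z. act m u = u} \<noteq> {}" by (metis card.empty dvd_0_right)
  then obtain u where u: "u \<in> U" "\<forall>m\<in>carrier ?Z. act m u = u" by blast
  have "1 \<in> carrier ?Z" using prime_gt_1_nat[OF p] by (simp add: carrier_integer_mod_group)
  hence "act 1 u x0 = u x0" using u by metis
  hence "(u x0 + u0 x0) mod int p = u x0 mod int p" using range[OF u(1), of x0] by (simp add: act_def)
  hence "int p dvd u0 x0" by (metis add_diff_cancel_left' mod_eq_dvd_iff)
  then show False using range[OF u0(1), of x0] u0(2) by (metis dvd_imp_mod_0 mod_pos_pos_trivial)
qed

text \<open>U stands for a vector space over the field with p elements, written by residues. The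
  number of its fixed points is divisible by p and 0 is one of them, so there is another.\<close>

lemma p_group_nonzero_fixed_point:
  fixes U :: "('x \<Rightarrow> int) set" and act :: "'g \<Rightarrow> ('x \<Rightarrow> int) \<Rightarrow> 'x \<Rightarrow> int"
  assumes G: "group G" and p: "Factorial_Ring.prime p" and ord: "Coset.order G = p ^ k" and U: "finite U"
    and act: "\<And>g u. g \<in> carrier G \<Longrightarrow> u \<in> U \<Longrightarrow> act g u \<in> U"
       "\<And>u. u \<in> U \<Longrightarrow> act \<one>\<^bsub>G\<^esub> u = u"
       "\<And>g h u. g \<in> carrier G \<Longrightarrow> h \<in> carrier G \<Longrightarrow> u \<in> U \<Longrightarrow> act (g \<otimes>\<^bsub>G\<^esub> h) u = act g (act h u)"
    and range: "\<And>u x. u \<in> U \<Longrightarrow> 0 \<le> u x \<and> u x < int p"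
    and add: "\<And>u v. u \<in> U \<Longrightarrow> v \<in> U \<Longrightarrow> (\<lambda>x. (u x + v x) mod int p) \<in> U"
    and u0: "u0 \<in> U" "u0 x0 \<noteq> 0"
    and zero: "(\<lambda>_. 0) \<in> U" "\<And>g. g \<in> carrier G \<Longrightarrow> act g (\<lambda>_. 0) = (\<lambda>_. 0)"
  shows "\<exists>u\<in>U. u \<noteq> (\<lambda>_. 0) \<and> (\<forall>g\<in>carrier G. act g u = u)"
proof -
  let ?F = "{u \<in> U. \<forall>g\<in>carrier G. act g u = u}"
  have "p dvd card U" by (rule prime_dvd_card_mod_space[OF p U, of u0 x0]) (use range add u0 in blast)+
  hence d: "p dvd card ?F" using p_group_fixed_points[OF G p ord U act] by blast
  have z: "(\<lambda>_. 0) \<in> ?F" using zero by blast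
  have "?F \<noteq> {(\<lambda>_. 0)}"
  proof
    assume e: "?F = {(\<lambda>_. 0)}"
    have "card ?F = 1" unfolding e by simp
    with d prime_gt_1_nat[OF p] show False by simp
  qed
  then show ?thesis using z by blast
qed

section \<open>Homomorphisms from p-groups to Z/p\<close>

definition residue_hom :: "('g, 'b) monoid_scheme \<Rightarrow> nat \<Rightarrow> ('g \<Rightarrow> int) \<Rightarrow> bool" where
  "residue_hom G p f \<longleftrightarrow> (\<forall>g\<in>carrier G. \<forall>h\<in>carrier G. f (g \<otimes>\<^bsub>G\<^esub> h) = (f g + f h) mod int p) \<and>
     (\<forall>g. 0 \<le> f g \<and> f g < int p)"

text \<open>G acts by translation on the functions from G/C to Z/p modulo constants. This space is
  nonzero because C is proper, and an invariant element, normalised to vanish at the identity, is a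
  homomorphism.\<close>

lemma p_group_hom_vanishing_on_subgroup:
  assumes G: "group G" and p: "Factorial_Ring.prime p" and ord: "Coset.order G = p ^ k"
    and C: "subgroup C G" "C \<noteq> carrier G"
  shows "\<exists>f. residue_hom G p f \<and> (\<forall>c\<in>C. f c = 0) \<and> (\<exists>g\<in>carrier G. f g \<noteq> 0)"
proof -
  interpret G: group G by (rule G)
  interpret C: subgroup C G by (rule C)
  have p2: "2 \<le> int p" using p prime_ge_2_nat by simp
  have finG: "finite (carrier G)" using ord p by (metis G.order_gt_0_iff_finite prime_gt_0_nat zero_less_power)
  define U where "U = {f :: _ \<Rightarrow> int. (\<forall>x. 0 \<le> f x \<and> f x < int p) \<and> (\<forall>x. x \<notin> carrier G \<longrightarrow> f x = 0) \<and>
      f \<one>\<^bsub>G\<^esub> = 0 \<and> (\<forall>x\<in>carrier G. \<forall>c\<in>C. f (x \<otimes>\<^bsub>G\<^esub> c) = f x)}"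
  \<comment> \<open>Subtracting the value at the inverse of g restores the value 0 at the identity,
    that is, it picks the normalised representative modulo constants.\<close>
  define act where "act g f = (\<lambda>x. if x \<in> carrier G then (f (inv\<^bsub>G\<^esub> g \<otimes>\<^bsub>G\<^esub> x) - f (inv\<^bsub>G\<^esub> g)) mod int p else 0)"
    for g and f :: "_ \<Rightarrow> int"
  have Ux: "0 \<le> f x" "f x < int p" if "f \<in> U" for f x using that by (auto simp: U_def)
  have finU: "finite U"
    by (rule finite_subset[OF _ finite_set_of_finite_funs[OF finG, of "{0..<int p}" 0]]) (auto simp: U_def)
  have a1: "act g f \<in> U" if "g \<in> carrier G" "f \<in> U" for g f
    using that p2 unfolding U_def act_def by (auto simp: G.m_assoc[symmetric])
  have a2: "act \<one>\<^bsub>G\<^esub> f = f" if "f \<in> U" for f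
    using that by (auto simp: U_def act_def fun_eq_iff)
  have a3: "act (g \<otimes>\<^bsub>G\<^esub> h) f = act g (act h f)" if "g \<in> carrier G" "h \<in> carrier G" "f \<in> U" for g h f
    using that by (auto simp: act_def fun_eq_iff G.inv_mult_group G.m_assoc mod_simps)
  obtain x0 where x0: "x0 \<in> carrier G" "x0 \<notin> C" using C C.subset by blast
  \<comment> \<open>The indicator function of the complement of C is constant on the cosets of C and
    nonzero, since C is proper.\<close>
  define u0 :: "_ \<Rightarrow> int" where "u0 x = (if x \<in> carrier G - C then 1 else 0)" for x
  have mc: "x \<otimes>\<^bsub>G\<^esub> c \<in> C \<longleftrightarrow> x \<in> C" if "x \<in> carrier G" "c \<in> C" for x c
  proof
    assume "x \<otimes>\<^bsub>G\<^esub> c \<in> C"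
    hence "x \<otimes>\<^bsub>G\<^esub> c \<otimes>\<^bsub>G\<^esub> inv\<^bsub>G\<^esub> c \<in> C" using that by blast
    then show "x \<in> C" using that C.subset by (simp add: G.m_assoc subsetD)
  qed (use that in auto)
  have u0: "u0 \<in> U" "u0 x0 \<noteq> 0" using x0 p2 C.subset mc by (auto simp: U_def u0_def)
  have "\<exists>f\<in>U. f \<noteq> (\<lambda>_. 0) \<and> (\<forall>g\<in>carrier G. act g f = f)"
    by (rule p_group_nonzero_fixed_point[OF G p ord finU, of act u0 x0])
       (use a1 a2 a3 u0 p2 in \<open>auto simp: U_def act_def\<close>)
  then obtain f where f: "f \<in> U" "f \<noteq> (\<lambda>_. 0)" "\<And>g. g \<in> carrier G \<Longrightarrow> act g f = f" by blast
  show ?thesis unfolding residue_hom_def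
  proof (intro exI[of _ f] conjI ballI allI)
    fix g h assume gh: "g \<in> carrier G" "h \<in> carrier G"
    have "f h = (f (g \<otimes>\<^bsub>G\<^esub> h) - f g) mod int p"
      using fun_cong[OF f(3)[of "inv\<^bsub>G\<^esub> g"], of h] gh by (simp add: act_def)
    hence "(f g + f h) mod int p = f (g \<otimes>\<^bsub>G\<^esub> h) mod int p" by (simp add: mod_simps)
    then show "f (g \<otimes>\<^bsub>G\<^esub> h) = (f g + f h) mod int p" using Ux[OF f(1)] by simp
  next
    fix c assume c: "c \<in> C"
    then have "f (\<one>\<^bsub>G\<^esub> \<otimes>\<^bsub>G\<^esub> c) = f \<one>\<^bsub>G\<^esub>" using f(1) unfolding U_def by blast
    then show "f c = 0" using f(1) c C.subset by (auto simp: U_def)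
  next
    show "\<exists>g\<in>carrier G. f g \<noteq> 0" using f(1,2) by (auto simp: U_def fun_eq_iff)
  qed (use Ux[OF f(1)] in auto)
qed

lemma residue_hom_not_dvd:
  assumes "residue_hom G p f" "f g \<noteq> 0"
  shows "\<not> int p dvd f g"
proof (rule zdvd_not_zless)
  have "0 \<le> f g \<and> f g < int p" using assms(1) unfolding residue_hom_def by blast
  then show "0 < f g" "f g < int p" using assms(2) by linarith+
qed

text \<open>A nonabelian group is not cyclic, so after f1 and g1 are found, a second nonzero
  homomorphism vanishes on the subgroup generated by g1. The values at g1 and g2 form a triangular
  matrix, which makes f1 and f2 independent.\<close>

lemma nonabelian_p_group_homs:
  assumes G: "group G" and p: "Factorial_Ring.prime p" and ord: "Coset.order G = p ^ k"
    and xy: "x \<in> carrier G" "y \<in> carrier G" "x \<otimes>\<^bsub>G\<^esub> y \<noteq> y \<otimes>\<^bsub>G\<^esub> x"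
  shows "\<exists>f1 f2 g1 g2. residue_hom G p f1 \<and> residue_hom G p f2 \<and> g1 \<in> carrier G \<and> g2 \<in> carrier G \<and>
    \<not> int p dvd f1 g1 \<and> f2 g1 = 0 \<and> \<not> int p dvd f2 g2"
proof -
  interpret G: group G by (rule G)
  have triv: "subgroup {\<one>\<^bsub>G\<^esub>} G" by (rule G.triv_subgroup)
  have "x \<noteq> \<one>\<^bsub>G\<^esub>" using xy by auto
  hence "{\<one>\<^bsub>G\<^esub>} \<noteq> carrier G" using xy by blast
  from p_group_hom_vanishing_on_subgroup[OF G p ord triv this] obtain f1 g1 where
    f1: "residue_hom G p f1" and g1: "g1 \<in> carrier G" "f1 g1 \<noteq> 0" by blast
  have sub: "subgroup (generate G {g1}) G" using g1 by (intro G.generate_is_subgroup) auto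
  have "generate G {g1} \<noteq> carrier G"
  proof
    assume e: "generate G {g1} = carrier G"
    obtain i j :: int where "x = g1 [^]\<^bsub>G\<^esub> i" "y = g1 [^]\<^bsub>G\<^esub> j"
      using xy e G.generate_pow[OF g1(1)] by blast
    hence "x \<otimes>\<^bsub>G\<^esub> y = y \<otimes>\<^bsub>G\<^esub> x" using g1 by (metis G.int_pow_mult add.commute)
    with xy show False by simp
  qed
  from p_group_hom_vanishing_on_subgroup[OF G p ord sub this] obtain f2 g2 where
    f2: "residue_hom G p f2" "\<forall>c\<in>generate G {g1}. f2 c = 0" and g2: "g2 \<in> carrier G" "f2 g2 \<noteq> 0" by blast
  have "f2 g1 = 0" using f2(2) by (simp add: generate.incl)
  then show ?thesis
    using f1 g1(1) f2(1) g2(1) residue_hom_not_dvd[OF f1 g1(2)] residue_hom_not_dvd[OF f2(1) g2(2)]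
    by (intro exI[of _ f1] exI[of _ f2] exI[of _ g1] exI[of _ g2] conjI)
qed

text \<open>These are the fixed points of right translation: a nonzero submodule of a free module
  over the group ring with coefficients in Z/p contains a nonzero element that is constant along the
  group.\<close>

lemma p_group_invariant_vector:
  fixes U :: "('g \<times> 'j \<Rightarrow> int) set"
  assumes G: "group G" and p: "Factorial_Ring.prime p" and ord: "Coset.order G = p ^ k" and J: "finite J"
    and range: "\<And>u x. u \<in> U \<Longrightarrow> 0 \<le> u x \<and> u x < int p"
    and supp: "\<And>u x. u \<in> U \<Longrightarrow> x \<notin> carrier G \<times> J \<Longrightarrow> u x = 0"
    and add: "\<And>u v. u \<in> U \<Longrightarrow> v \<in> U \<Longrightarrow> (\<lambda>x. (u x + v x) mod int p) \<in> U"
    and trans: "\<And>u g. u \<in> U \<Longrightarrow> g \<in> carrier G \<Longrightarrow>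
          (\<lambda>(x,j). if x \<in> carrier G then u (x \<otimes>\<^bsub>G\<^esub> g, j) else 0) \<in> U"
    and zero: "(\<lambda>_. 0) \<in> U"
    and u0: "u0 \<in> U" "u0 x0 \<noteq> 0"
  obtains u j where "u \<in> U" "j \<in> J" "u (\<one>\<^bsub>G\<^esub>, j) \<noteq> 0" "\<And>x j. x \<in> carrier G \<Longrightarrow> u (x, j) = u (\<one>\<^bsub>G\<^esub>, j)"
proof -
  interpret G: group G by (rule G)
  have finG: "finite (carrier G)" using ord p by (metis G.order_gt_0_iff_finite prime_gt_0_nat zero_less_power)
  define act where "act g u = (\<lambda>(x,j). if x \<in> carrier G then u (x \<otimes>\<^bsub>G\<^esub> g, j) else 0)" for g and u :: "'g \<times> 'j \<Rightarrow> int"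
  have finU: "finite U"
    by (rule finite_subset[OF _ finite_set_of_finite_funs[OF finite_cartesian_product[OF finG J], of "{0..<int p}" 0]])
       (use range supp in auto)
  have a2: "act \<one>\<^bsub>G\<^esub> u = u" if "u \<in> U" for u using supp[OF that] by (auto simp: act_def fun_eq_iff)
  have a3: "act (g \<otimes>\<^bsub>G\<^esub> h) u = act g (act h u)" if "g \<in> carrier G" "h \<in> carrier G" "u \<in> U" for g h u
    using that by (auto simp: act_def fun_eq_iff G.m_assoc)
  have a1: "act g u \<in> U" if "g \<in> carrier G" "u \<in> U" for g u
    using trans[OF that(2,1)] unfolding act_def .
  have a4: "act g (\<lambda>_. 0) = (\<lambda>_. 0)" for g by (auto simp: act_def fun_eq_iff)
  have "\<exists>u\<in>U. u \<noteq> (\<lambda>_. 0) \<and> (\<forall>g\<in>carrier G. act g u = u)"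
  proof (rule p_group_nonzero_fixed_point[OF G p ord finU])
    show "act g u \<in> U" if "g \<in> carrier G" "u \<in> U" for g u by (rule a1[OF that])
    show "act \<one>\<^bsub>G\<^esub> u = u" if "u \<in> U" for u by (rule a2[OF that])
    show "act (g \<otimes>\<^bsub>G\<^esub> h) u = act g (act h u)" if "g \<in> carrier G" "h \<in> carrier G" "u \<in> U" for g h u
      by (rule a3[OF that])
    show "0 \<le> u x \<and> u x < int p" if "u \<in> U" for u x by (rule range[OF that])
    show "(\<lambda>x. (u x + v x) mod int p) \<in> U" if "u \<in> U" "v \<in> U" for u v by (rule add[OF that])
  qed (rule u0 zero a4)+
  then obtain u where u: "u \<in> U" "u \<noteq> (\<lambda>_. 0)" "\<And>g. g \<in> carrier G \<Longrightarrow> act g u = u" by blast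
  have c: "u (x, j) = u (\<one>\<^bsub>G\<^esub>, j)" if "x \<in> carrier G" for x j
    using fun_cong[OF u(3)[OF that], of "(\<one>\<^bsub>G\<^esub>, j)"] that by (simp add: act_def)
  obtain x j where xj: "u (x, j) \<noteq> 0" using u(2) by (auto simp: fun_eq_iff)
  hence "(x, j) \<in> carrier G \<times> J" using supp[OF u(1)] by blast
  then have x: "x \<in> carrier G" "j \<in> J" by simp_all
  show ?thesis
  proof (rule that)
    show "u \<in> U" by (rule u(1))
    show "j \<in> J" by (rule x)
    show "u (\<one>\<^bsub>G\<^esub>, j) \<noteq> 0" using xj c[OF x(1)] by simp
    show "u (x, j) = u (\<one>\<^bsub>G\<^esub>, j)" if "x \<in> carrier G" for x j by (rule c[OF that])
  qed
qed

section \<open>Words, and residual finiteness of free groups\<close>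

definition letter_val :: "('a, 'b) monoid_scheme \<Rightarrow> ('i \<Rightarrow> 'a) \<Rightarrow> 'i \<times> bool \<Rightarrow> 'a" where
  "letter_val G y l = (if snd l then inv\<^bsub>G\<^esub> (y (fst l)) else y (fst l))"

definition word_val :: "('a, 'b) monoid_scheme \<Rightarrow> ('i \<Rightarrow> 'a) \<Rightarrow> ('i \<times> bool) list \<Rightarrow> 'a" where
  "word_val G y w = foldr (\<lambda>l a. letter_val G y l \<otimes>\<^bsub>G\<^esub> a) w \<one>\<^bsub>G\<^esub>"

lemma word_val_simps [simp]:
  "word_val G y [] = \<one>\<^bsub>G\<^esub>"
  "word_val G y (l # w) = letter_val G y l \<otimes>\<^bsub>G\<^esub> word_val G y w"
  by (simp_all add: word_val_def)

definition word_inv :: "('i \<times> bool) list \<Rightarrow> ('i \<times> bool) list" where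
  "word_inv w = rev (map (\<lambda>(i,b). (i, \<not> b)) w)"

context group
begin

lemma letter_val_closed [simp]: "(\<And>i. y i \<in> carrier G) \<Longrightarrow> letter_val G y l \<in> carrier G"
  by (simp add: letter_val_def)

lemma word_val_closed [simp]: "(\<And>i. y i \<in> carrier G) \<Longrightarrow> word_val G y w \<in> carrier G"
  by (induction w) auto

lemma word_val_append: "(\<And>i. y i \<in> carrier G) \<Longrightarrow> word_val G y (u @ v) = word_val G y u \<otimes> word_val G y v"
  by (induction u) (auto simp: m_assoc)

lemma letter_val_cancel:
  "(\<And>i. y i \<in> carrier G) \<Longrightarrow> cancels a b \<Longrightarrow> letter_val G y a \<otimes> letter_val G y b = \<one>"
  by (auto simp: cancels_def letter_val_def)

lemma word_val_cons_red: "(\<And>i. y i \<in> carrier G) \<Longrightarrow> word_val G y (cons_red a w) = letter_val G y a \<otimes> word_val G y w"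
proof (cases w)
  case (Cons b w')
  assume y: "\<And>i. y i \<in> carrier G"
  show ?thesis using Cons y letter_val_cancel[of y a b]
    by (auto simp: m_assoc[symmetric])
qed simp

lemma word_val_reduce: "(\<And>i. y i \<in> carrier G) \<Longrightarrow> word_val G y (reduce_word w) = word_val G y w"
  unfolding reduce_word_def by (induction w) (auto simp: word_val_cons_red)

lemma word_val_inv: "(\<And>i. y i \<in> carrier G) \<Longrightarrow> word_val G y (word_inv w) = inv (word_val G y w)"
  by (induction w) (auto simp: word_inv_def word_val_append inv_mult_group letter_val_def)

lemma word_val_hom:
  assumes "group H" "h \<in> hom G H" "\<And>i. y i \<in> carrier G"
  shows "h (word_val G y w) = word_val H (\<lambda>i. h (y i)) w"
proof -
  interpret H: group_hom G H h using assms by (simp add: group_hom_def group_hom_axioms_def group_axioms)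
  have l: "h (letter_val G y l) = letter_val H (\<lambda>i. h (y i)) l" for l using assms(3) by (simp add: letter_val_def)
  show ?thesis by (induction w) (simp_all add: l assms(3))
qed

end

text \<open>Two by two matrices over Z/q, written row by row, that reduce to the identity modulo p.
  For q a power of p they form a p-group; the determinant is only prescribed modulo p.\<close>

definition congruence_group :: "int \<Rightarrow> int \<Rightarrow> (int \<times> int \<times> int \<times> int) monoid" where
  "congruence_group p q = \<lparr>carrier = {a\<in>{0..<q}. a mod p = 1} \<times> {a\<in>{0..<q}. a mod p = 0} \<times>
       {a\<in>{0..<q}. a mod p = 0} \<times> {a\<in>{0..<q}. a mod p = 1},
     monoid.mult = (\<lambda>(a,b,c,d) (a',b',c',d'). ((a * a' + b * c') mod q, (a * b' + b * d') mod q, (c * a' + d * c') mod q, (c * b' + d * d') mod q)),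
     one = (1,0,0,1)\<rparr>"

lemma mod_combination:
  fixes q :: int
  shows "((s mod q) * a + (t mod q) * c) mod q = (s * a + t * c) mod q"
    and "(s * (a mod q) + t * (c mod q)) mod q = (s * a + t * c) mod q"
  by (metis mod_add_eq mod_mult_left_eq, metis mod_add_eq mod_mult_right_eq)

text \<open>The determinant is 1 modulo p, hence by \<open>cop\<close> a unit modulo q; the inverse
  is the adjugate times the inverse of the determinant.\<close>

lemma group_congruence_group:
  assumes p: "1 < p" and q: "p dvd q" "0 < q" and cop: "\<And>x. coprime x p \<Longrightarrow> coprime x q"
  shows "group (congruence_group p q)"
proof (rule groupI)
  have pq: "p \<le> q" using p q zdvd_imp_le by blast
  have mm: "x mod q mod p = x mod p" for x using q(1) by (rule mod_mod_cancel)
  show "\<one>\<^bsub>congruence_group p q\<^esub> \<in> carrier (congruence_group p q)"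
    using p pq by (auto simp: congruence_group_def)
  fix x assume x: "x \<in> carrier (congruence_group p q)"
  obtain a b c d where xe: "x = (a,b,c,d)" by (cases x) auto
  have xr: "0 \<le> a" "a < q" "a mod p = 1" "0 \<le> b" "b < q" "b mod p = 0" "0 \<le> c" "c < q" "c mod p = 0" "0 \<le> d" "d < q" "d mod p = 1"
    using x by (auto simp: congruence_group_def xe)
  show "\<one>\<^bsub>congruence_group p q\<^esub> \<otimes>\<^bsub>congruence_group p q\<^esub> x = x"
    using xr by (auto simp: congruence_group_def xe)
  define D where "D = a * d - b * c"
  have Dp: "D mod p = 1"
  proof -
    have "[D = 1 * 1 - 0 * 0] (mod p)"
      unfolding D_def by (intro cong_diff cong_mult) (use xr p in \<open>auto simp: cong_def\<close>)
    then show ?thesis using p by (simp add: cong_def)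
  qed
  hence "coprime D p" by (metis coprime_1_left coprime_mod_left_iff p not_one_less_zero)
  hence "coprime D q" by (rule cop)
  then obtain e where e: "[D * e = 1] (mod q)" using cong_solve_coprime_int by blast
  have e': "D * e mod q = 1" using e p pq by (simp add: cong_def)
  have ep: "e mod p = 1"
  proof -
    have "(D mod p) * e mod p = 1" using mm[of "D * e"] e' p by (simp add: mod_simps)
    then show ?thesis by (simp add: Dp)
  qed
  show "\<exists>y\<in>carrier (congruence_group p q). y \<otimes>\<^bsub>congruence_group p q\<^esub> x = \<one>\<^bsub>congruence_group p q\<^esub>"
  proof (rule bexI[of _ "(d * e mod q, - b * e mod q, - c * e mod q, a * e mod q)"])
    have h: "(d * e) mod p = 1" "(a * e) mod p = 1" "(- b * e) mod p = 0" "(- c * e) mod p = 0"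
    proof -
      have m: "(x * e) mod p = x mod p" for x
        by (metis ep mod_mult_right_eq mult.right_neutral)
      have z: "(- x) mod p = 0" if "x mod p = 0" for x using that by (metis mod_minus_eq mod_0 minus_zero)
      show "(d * e) mod p = 1" unfolding m by (rule xr)
      show "(a * e) mod p = 1" unfolding m by (rule xr)
      show "(- b * e) mod p = 0" unfolding m by (rule z, rule xr)
      show "(- c * e) mod p = 0" unfolding m by (rule z, rule xr)
    qed
    show "(d * e mod q, - b * e mod q, - c * e mod q, a * e mod q) \<in> carrier (congruence_group p q)"
      using h q(2) by (auto simp: congruence_group_def mm)
    have i: "d * e * a + - b * e * c = D * e" "d * e * b + - b * e * d = 0"
      "- c * e * a + a * e * c = 0" "- c * e * b + a * e * d = D * e" by (auto simp: D_def algebra_simps)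
    have "((d * e mod q) * a + (- b * e mod q) * c) mod q = 1"
      "((d * e mod q) * b + (- b * e mod q) * d) mod q = 0"
      "((- c * e mod q) * a + (a * e mod q) * c) mod q = 0"
      "((- c * e mod q) * b + (a * e mod q) * d) mod q = 1"
      unfolding mod_combination i using e' by simp_all
    then show "(d * e mod q, - b * e mod q, - c * e mod q, a * e mod q) \<otimes>\<^bsub>congruence_group p q\<^esub> x = \<one>\<^bsub>congruence_group p q\<^esub>"
      unfolding congruence_group_def xe by (simp only: monoid.simps partial_object.simps prod.case)
  qed
  fix y assume y: "y \<in> carrier (congruence_group p q)"
  obtain a' b' c' d' where ye: "y = (a',b',c',d')" by (cases y) auto
  have yr: "a' mod p = 1" "b' mod p = 0" "c' mod p = 0" "d' mod p = 1"
    using y by (auto simp: congruence_group_def ye)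
  have c: "[a = 1] (mod p)" "[b = 0] (mod p)" "[c = 0] (mod p)" "[d = 1] (mod p)"
    "[a' = 1] (mod p)" "[b' = 0] (mod p)" "[c' = 0] (mod p)" "[d' = 1] (mod p)"
    using xr yr p by (simp_all add: cong_def)
  have "[a * a' + b * c' = 1 * 1 + 0 * 0] (mod p)" "[a * b' + b * d' = 1 * 0 + 0 * 1] (mod p)"
    "[c * a' + d * c' = 0 * 1 + 1 * 0] (mod p)" "[c * b' + d * d' = 0 * 0 + 1 * 1] (mod p)"
    by (rule cong_add[OF cong_mult[OF c(1,5)] cong_mult[OF c(2,7)]] cong_add[OF cong_mult[OF c(1,6)] cong_mult[OF c(2,8)]]
       cong_add[OF cong_mult[OF c(3,5)] cong_mult[OF c(4,7)]] cong_add[OF cong_mult[OF c(3,6)] cong_mult[OF c(4,8)]])+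
  then show "x \<otimes>\<^bsub>congruence_group p q\<^esub> y \<in> carrier (congruence_group p q)"
    using p q by (auto simp: congruence_group_def xe ye mm cong_def)
  fix z assume "z \<in> carrier (congruence_group p q)"
  obtain a2 b2 c2 d2 where ze: "z = (a2,b2,c2,d2)" by (cases z) auto
  show "x \<otimes>\<^bsub>congruence_group p q\<^esub> y \<otimes>\<^bsub>congruence_group p q\<^esub> z = x \<otimes>\<^bsub>congruence_group p q\<^esub> (y \<otimes>\<^bsub>congruence_group p q\<^esub> z)"
    unfolding congruence_group_def xe ye ze monoid.simps prod.case mod_combination
    by (simp add: algebra_simps)
qed

lemma card_residue_class:
  assumes "0 \<le> r" "r < p"
  shows "card {a\<in>{0..<p * m}. a mod p = r} = nat (m::int)"
proof -
  have "bij_betw (\<lambda>i. p * i + r) {0..<m} {a\<in>{0..<p * m}. a mod p = r}"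
  proof (rule bij_betw_byWitness[where f' = "\<lambda>a. a div p"])
    show "(\<lambda>i. p * i + r) ` {0..<m} \<subseteq> {a\<in>{0..<p * m}. a mod p = r}"
    proof
      fix a assume "a \<in> (\<lambda>i. p * i + r) ` {0..<m}"
      then obtain i where i: "0 \<le> i" "i < m" "a = p * i + r" by auto
      have "p * i + r < p * (i + 1)" using assms by (simp add: distrib_left)
      also have "\<dots> \<le> p * m" using i assms by (intro mult_left_mono) auto
      finally show "a \<in> {a\<in>{0..<p * m}. a mod p = r}" using i assms by simp
    qed
    show "(\<lambda>a. a div p) ` {a\<in>{0..<p * m}. a mod p = r} \<subseteq> {0..<m}"
    proof
      fix b assume "b \<in> (\<lambda>a. a div p) ` {a\<in>{0..<p * m}. a mod p = r}"
      then obtain a where a: "0 \<le> a" "a < p * m" "b = a div p" by auto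
      have "0 \<le> a div p" using a assms by (simp add: pos_imp_zdiv_nonneg_iff)
      moreover have "a div p < m"
      proof (rule ccontr)
        assume "\<not> a div p < m"
        hence "p * m \<le> p * (a div p)" using assms by (intro mult_left_mono) auto
        also have "\<dots> \<le> a" using mult_div_mod_eq[of p a] pos_mod_sign[of p a] assms by linarith
        finally show False using a by simp
      qed
      ultimately show "b \<in> {0..<m}" using a by simp
    qed
  qed (use assms in auto)
  from bij_betw_same_card[OF this] show ?thesis by simp
qed

text \<open>The first column of the integral matrix of a word. The generator i acts as the
  transvection that adds N (u - i v) times (i, 1) to the vector (u, v), and its inverse acts with
  the opposite sign.\<close>

fun schottky_vec :: "int \<Rightarrow> (nat \<times> bool) list \<Rightarrow> int \<times> int" where
  "schottky_vec N [] = (1, 0)"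
| "schottky_vec N ((i,b) # w) = (case schottky_vec N w of (u,v) \<Rightarrow>
     let l = (if b then - 1 else 1) * (u - int i * v) in (u + N * int i * l, v + N * l))"

text \<open>Ping-pong for the parabolic matrices fixing the vectors (i, 1).\<close>

lemma schottky_vec_nonzero:
  assumes N: "4 \<le> N"
  shows "reduced_word ((i,b) # w) \<Longrightarrow> schottky_vec N ((i,b) # w) = (u,v) \<Longrightarrow>
     u - int i * v \<noteq> 0 \<and> N * (u - int i * v)\<^sup>2 \<le> 2 * (if b then - 1 else 1) * v * (u - int i * v)"
proof (induction w arbitrary: i b u v)
  case Nil
  then show ?case using N by (auto simp: Let_def algebra_simps)
next
  case (Cons a w)
  obtain j b' where a: "a = (j, b')" by (cases a)
  obtain u0 v0 where uv0: "schottky_vec N ((j,b') # w) = (u0, v0)" by fastforce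
  define s :: int where "s = (if b then - 1 else 1)"
  define s' :: int where "s' = (if b' then - 1 else 1)"
  define l where "l = u0 - int i * v0"
  define l' where "l' = u0 - int j * v0"
  have s: "s * s = 1" "s' * s' = 1" "s = 1 \<or> s = -1" "s' = 1 \<or> s' = -1" by (auto simp: s_def s'_def)
  have IH: "l' \<noteq> 0" "N * l'\<^sup>2 \<le> 2 * s' * v0 * l'"
    using Cons.IH[OF _ uv0] Cons.prems(1) unfolding a l'_def s'_def by auto
  have uv: "u = u0 + N * int i * (s * l)" "v = v0 + N * (s * l)"
    using Cons.prems(2) uv0 unfolding a by (simp_all add: Let_def l_def s_def)
  have li: "u - int i * v = l" unfolding uv l_def by (simp add: algebra_simps)
  have "2 * s * v * l = 2 * s * v0 * l + 2 * N * (s * s) * l\<^sup>2" unfolding uv by (simp add: algebra_simps power2_eq_square)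
  hence key: "2 * s * v * l = 2 * s * v0 * l + 2 * N * l\<^sup>2" using s by simp
  \<comment> \<open>The inequality says that v has the sign of \<open>s * l\<close> and size at
    least N |l| / 2: the vector lies close to the line fixed by the first letter, which acts
    last.\<close>
  have "l \<noteq> 0 \<and> N * l\<^sup>2 \<le> 2 * s * v * l"
  proof (cases "i = j")
    case True
    \<comment> \<open>A repeated generator occurs with the same sign because the word is reduced, so
      the two displacements add up.\<close>
    hence "b = b'" using Cons.prems(1) unfolding a by (auto simp: cancels_def)
    hence "l = l'" "s = s'" using True by (simp_all add: l_def l'_def s_def s'_def)
    then have "l \<noteq> 0" "N * l\<^sup>2 \<le> 2 * s * v0 * l" using IH by simp_all
    moreover have "0 \<le> N * l\<^sup>2" using N by simp
    ultimately show ?thesis using key by simp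
  next
    case False
    \<comment> \<open>Close to the line of j one has 2 |l'| <= |v0|, by N >= 4, and l' - l is a
      nonzero integral multiple of v0. Hence l cannot be small compared to v0.\<close>
    have "N * \<bar>l'\<bar> * \<bar>l'\<bar> \<le> 2 * \<bar>v0\<bar> * \<bar>l'\<bar>"
    proof -
      have "2 * s' * v0 * l' \<le> \<bar>2 * s' * v0 * l'\<bar>" by simp
      also have "\<dots> = 2 * \<bar>v0\<bar> * \<bar>l'\<bar>" using s by (auto simp: abs_mult)
      finally show ?thesis using IH(2) by (simp add: power2_eq_square abs_mult mult.assoc)
    qed
    hence "N * \<bar>l'\<bar> \<le> 2 * \<bar>v0\<bar>" using IH(1) by (simp add: mult_le_cancel_right)
    moreover have "4 * \<bar>l'\<bar> \<le> N * \<bar>l'\<bar>" using N by (intro mult_right_mono) auto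
    ultimately have A: "2 * \<bar>l'\<bar> \<le> \<bar>v0\<bar>" by linarith
    have "l' - l = (int i - int j) * v0" by (simp add: l_def l'_def algebra_simps)
    moreover have "1 * \<bar>v0\<bar> \<le> \<bar>int i - int j\<bar> * \<bar>v0\<bar>" using False by (intro mult_right_mono) auto
    ultimately have "\<bar>v0\<bar> \<le> \<bar>l' - l\<bar>" by (simp add: abs_mult)
    hence B: "\<bar>v0\<bar> \<le> 2 * \<bar>l\<bar>" using A by linarith
    have l0: "l \<noteq> 0" using A B IH(1) by auto
    have "- (2 * s * v0 * l) \<le> \<bar>2 * s * v0 * l\<bar>" by simp
    moreover have "\<bar>2 * s * v0 * l\<bar> = 2 * \<bar>v0\<bar> * \<bar>l\<bar>" using s by (auto simp: abs_mult)
    moreover have "2 * \<bar>v0\<bar> * \<bar>l\<bar> \<le> 2 * (2 * \<bar>l\<bar>) * \<bar>l\<bar>" using B by (intro mult_right_mono) auto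
    moreover have "2 * (2 * \<bar>l\<bar>) * \<bar>l\<bar> = 4 * l\<^sup>2" by (simp add: power2_eq_square)
    moreover have "4 * l\<^sup>2 \<le> N * l\<^sup>2" using N by (intro mult_right_mono) auto
    ultimately show ?thesis using key l0 by linarith
  qed
  then show ?case unfolding li s_def .
qed

text \<open>Ping-pong over the integers makes the lower left entry of every nonempty reduced word
  nonzero. Modulo a power of p that exceeds the absolute values of these entries on the finite set
  E, they stay nonzero.\<close>

lemma free_group_residually_p:
  fixes E :: "(nat \<times> bool) list set"
  assumes p: "Factorial_Ring.prime p" and E: "finite E" "\<And>w. w \<in> E \<Longrightarrow> reduced_word w \<and> w \<noteq> []"
  obtains P :: "(int \<times> int \<times> int \<times> int) monoid" and y :: "nat \<Rightarrow> int \<times> int \<times> int \<times> int" and k where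
    "group P" "Coset.order P = p ^ k" "\<And>i. y i \<in> carrier P" "\<And>w. w \<in> E \<Longrightarrow> word_val P y w \<noteq> \<one>\<^bsub>P\<^esub>"
proof -
  let ?p = "int p"
  \<comment> \<open>Divisible by p, so that the generators reduce to the identity modulo p, and at
    least 4 even for p = 2, as ping-pong requires.\<close>
  define N where "N = ?p ^ 2"
  have p2: "2 \<le> ?p" using p prime_ge_2_nat by simp
  have N4: "4 \<le> N" using power_mono[of 2 ?p 2] p2 by (simp add: N_def)
  have nz: "snd (schottky_vec N w) \<noteq> 0" if wE: "w \<in> E" for w
  proof -
    obtain i b w' where w: "w = (i,b) # w'" using E(2)[OF wE] by (metis neq_Nil_conv surj_pair)
    obtain u v where uv: "schottky_vec N w = (u,v)" by fastforce
    have h: "u - int i * v \<noteq> 0" "N * (u - int i * v)\<^sup>2 \<le> 2 * (if b then - 1 else 1) * v * (u - int i * v)"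
      using schottky_vec_nonzero[OF N4, of i b w' u v] E(2)[OF wE] uv unfolding w by auto
    have "0 < N * (u - int i * v)\<^sup>2" using N4 h(1) by simp
    with h(2) have "v \<noteq> 0" by auto
    then show ?thesis by (simp add: uv)
  qed
  obtain B where B: "\<And>w. w \<in> E \<Longrightarrow> \<bar>snd (schottky_vec N w)\<bar> < B" "0 < B"
  proof -
    have "finite ((\<lambda>w. \<bar>snd (schottky_vec N w)\<bar>) ` E)" using E by simp
    then obtain M where "\<And>w. w \<in> E \<Longrightarrow> \<bar>snd (schottky_vec N w)\<bar> \<le> M"
      by (metis Max_ge imageI)
    then show ?thesis by (intro that[of "max 1 (M + 1)"]) force+
  qed
  define K where "K = nat B + 3"
  define q where "q = ?p * ?p ^ (K - 1)"
  have qK: "q = ?p ^ K" unfolding q_def K_def by (metis Suc_diff_1 add_gr_0 power_Suc zero_less_numeral)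
  have Bq: "B \<le> q"
  proof -
    have "int (nat B) < 2 ^ nat B" by (rule of_nat_less_two_power)
    also have "(2::int) ^ nat B \<le> ?p ^ nat B" using p2 by (intro power_mono) auto
    also have "\<dots> \<le> ?p ^ K" using p2 by (intro power_increasing) (auto simp: K_def)
    finally show ?thesis unfolding qK using B by simp
  qed
  let ?P = "congruence_group ?p q"
  have q0: "0 < q" using B Bq by simp
  have pq: "?p dvd q" unfolding q_def by simp
  interpret P: group ?P
    by (rule group_congruence_group) (use p2 pq q0 in \<open>auto simp: qK\<close>)
  have ord: "Coset.order ?P = p ^ (4 * (K - 1))"
  proof -
    have "card {a\<in>{0..<q}. a mod ?p = r} = p ^ (K - 1)" if "0 \<le> r" "r < ?p" for r
      unfolding q_def using card_residue_class[OF that, of "?p ^ (K - 1)"]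
      by (simp add: nat_power_eq)
    then have "Coset.order ?P = (p ^ (K - 1)) ^ 4" using p2
      by (simp add: Coset.order_def congruence_group_def card_cartesian_product eval_nat_numeral)
    then show ?thesis by (simp add: power_mult[symmetric] mult.commute)
  qed
  define y where "y i = ((1 + N * int i) mod q, (- N * int i * int i) mod q, N mod q, (1 - N * int i) mod q)" for i
  have mm: "x mod q mod ?p = x mod ?p" for x using pq by (rule mod_mod_cancel)
  have Np: "N mod ?p = 0" by (simp add: N_def power2_eq_square)
  have m1: "(1 + ?p * z) mod ?p = 1" for z using p2 by simp
  have m1': "(1 - N * int i) mod ?p = 1" for i
    using m1[of "- (?p * int i)"] by (simp add: N_def power2_eq_square mult.assoc)
  have y: "y i \<in> carrier ?P" for i
  proof -
    have "(1 + N * int i) mod ?p = 1" "(- N * int i * int i) mod ?p = 0" "(1 - N * int i) mod ?p = 1"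
      using Np p2 m1' by (auto simp: N_def power2_eq_square mod_add_eq mod_diff_eq mult.assoc)
    then show ?thesis using q0 Np by (auto simp: y_def congruence_group_def mm)
  qed
  define y' where "y' i = ((1 - N * int i) mod q, (N * int i * int i) mod q, (- N) mod q, (1 + N * int i) mod q)" for i
  have y': "y' i \<in> carrier ?P" for i
  proof -
    have "(1 + N * int i) mod ?p = 1" "(N * int i * int i) mod ?p = 0" "(1 - N * int i) mod ?p = 1" "(- N) mod ?p = 0"
      using Np p2 m1' by (auto simp: N_def power2_eq_square mod_add_eq mod_diff_eq mult.assoc)
    then show ?thesis using q0 Np by (auto simp: y'_def congruence_group_def mm)
  qed
  have q1: "1 < q" using p2 pq q0 zdvd_imp_le by fastforce
  have yi: "inv\<^bsub>?P\<^esub> (y i) = y' i" for i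
  proof (rule P.inv_equality)
    have "(1 - N * int i) * (1 + N * int i) + (N * int i * int i) * N = 1"
      "(1 - N * int i) * (- N * int i * int i) + (N * int i * int i) * (1 - N * int i) = 0"
      "(- N) * (1 + N * int i) + (1 + N * int i) * N = 0"
      "(- N) * (- N * int i * int i) + (1 + N * int i) * (1 - N * int i) = 1"
      by (simp_all add: algebra_simps)
    then show "y' i \<otimes>\<^bsub>?P\<^esub> y i = \<one>\<^bsub>?P\<^esub>" using q1
      unfolding y_def y'_def congruence_group_def monoid.simps prod.case mod_combination by simp
  qed (use y y' in auto)
  have lv: "letter_val ?P y (i,b) = (let s = (if b then - 1 else 1) in
     ((1 + s * (N * int i)) mod q, (- s * (N * int i * int i)) mod q, (s * N) mod q, (1 - s * (N * int i)) mod q))" for i b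
  proof (cases b)
    case True
    then have "letter_val ?P y (i,b) = y' i" by (simp add: letter_val_def yi)
    then show ?thesis using True by (simp add: y'_def Let_def)
  next
    case False
    then have "letter_val ?P y (i,b) = y i" by (simp add: letter_val_def)
    then show ?thesis using False by (simp add: y_def Let_def)
  qed
  \<comment> \<open>Reduction modulo q respects matrix products, and the first column of a product
    involves only the first column of the right factor.\<close>
  have col: "fst (word_val ?P y w) = fst (schottky_vec N w) mod q \<and>
      fst (snd (snd (word_val ?P y w))) = snd (schottky_vec N w) mod q" for w
  proof (induction w)
    case Nil
    then show ?case using q1 by (simp add: congruence_group_def)
  next
    case (Cons l w)
    obtain i b where l: "l = (i,b)" by (cases l)
    obtain a' b' c' d' where wv: "word_val ?P y w = (a',b',c',d')" by (metis surj_pair)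
    obtain u v where uv: "schottky_vec N w = (u,v)" by fastforce
    have ac: "a' = u mod q" "c' = v mod q" using Cons wv uv by simp_all
    define s :: int where "s = (if b then - 1 else 1)"
    have L: "letter_val ?P y l = ((1 + s * (N * int i)) mod q, (- s * (N * int i * int i)) mod q, (s * N) mod q, (1 - s * (N * int i)) mod q)"
      unfolding l lv s_def Let_def ..
    have "schottky_vec N (l # w) = (u + N * int i * (s * (u - int i * v)), v + N * (s * (u - int i * v)))"
      by (simp add: l uv s_def Let_def)
    moreover have "word_val ?P y (l # w) = letter_val ?P y l \<otimes>\<^bsub>?P\<^esub> (a',b',c',d')" by (simp add: wv)
    moreover have "fst (letter_val ?P y l \<otimes>\<^bsub>?P\<^esub> (a',b',c',d')) = ((1 + s * (N * int i)) * u + (- s * (N * int i * int i)) * v) mod q"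
      "fst (snd (snd (letter_val ?P y l \<otimes>\<^bsub>?P\<^esub> (a',b',c',d')))) = ((s * N) * u + (1 - s * (N * int i)) * v) mod q"
      unfolding L ac unfolding congruence_group_def monoid.simps prod.case fst_conv snd_conv mod_combination by (rule refl)+
    ultimately show ?case by (simp add: algebra_simps)
  qed
  show ?thesis
  proof (rule that[of ?P "4 * (K - 1)" y])
    fix w assume w: "w \<in> E"
    have "snd (schottky_vec N w) mod q \<noteq> 0"
      using nz[OF w] B(1)[OF w] Bq by (metis dvd_eq_mod_eq_0 dvd_imp_le_int order_less_le_trans abs_of_pos linorder_not_less q0)
    then show "word_val ?P y w \<noteq> \<one>\<^bsub>?P\<^esub>" using col[of w] by (auto simp: congruence_group_def)
  qed (use P.group_axioms ord y in auto)
qed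

section \<open>Systems of equations over group rings of p-groups\<close>

text \<open>Infinite descent: a value divisible by all powers of p is 0.\<close>

lemma int_descent:
  fixes Sol :: "('x \<Rightarrow> int) \<Rightarrow> bool"
  assumes p: "1 < p"
    and dvd: "\<And>a x. Sol a \<Longrightarrow> p dvd a x"
    and div: "\<And>a. Sol a \<Longrightarrow> Sol (\<lambda>x. a x div p)"
    and a: "Sol a"
  shows "a x = 0"
proof (rule ccontr)
  assume nz: "a x \<noteq> 0"
  have "p ^ k dvd a x" for k
    using a
  proof (induction k arbitrary: a)
    case (Suc k)
    obtain b where b: "a x = p * b" using dvd[OF Suc.prems, of x] by (auto elim: dvdE)
    have "p ^ k dvd a x div p" using Suc.IH[OF div[OF Suc.prems]] .
    then have "p ^ k dvd b" using b p by simp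
    then show ?case unfolding b by (simp add: mult_dvd_mono)
  qed simp
  hence "\<bar>p ^ nat \<bar>a x\<bar>\<bar> \<le> \<bar>a x\<bar>" by (intro dvd_imp_le_int nz)
  hence "p ^ nat \<bar>a x\<bar> \<le> \<bar>a x\<bar>" by (rule order_trans[OF abs_ge_self])
  moreover have "\<bar>a x\<bar> < 2 ^ nat \<bar>a x\<bar>" using of_nat_less_two_power[of "nat \<bar>a x\<bar>", where 'a = int] by simp
  moreover have "(2::int) ^ nat \<bar>a x\<bar> \<le> p ^ nat \<bar>a x\<bar>" using p by (intro power_mono) auto
  ultimately show False by linarith
qed

text \<open>The row is an element of the free module with basis J over the integral group ring. It
  acts on functions by left translations, and so it commutes with right translations.\<close>

definition row_app :: "('g, 'b) monoid_scheme \<Rightarrow> (int \<times> 'g \<times> 'j) list \<Rightarrow> ('g \<times> 'j \<Rightarrow> int) \<Rightarrow> 'g \<Rightarrow> int" where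
  "row_app G r u g = (\<Sum>(m,x,j)\<leftarrow>r. m * u (inv\<^bsub>G\<^esub> x \<otimes>\<^bsub>G\<^esub> g, j))"

text \<open>Nakayama's lemma for the group ring of a p-group.\<close>

lemma p_group_system_injective:
  fixes R :: "(int \<times> 'g \<times> 'j) list set" and u :: "'g \<times> 'j \<Rightarrow> int"
  assumes G: "group G" and p: "Factorial_Ring.prime p" and ord: "Coset.order G = p ^ k" and J: "finite J"
    and R: "\<And>r m x j. r \<in> R \<Longrightarrow> (m,x,j) \<in> set r \<Longrightarrow> x \<in> carrier G"
    and aug: "\<And>c :: 'j \<Rightarrow> int. (\<And>j. j \<notin> J \<Longrightarrow> c j = 0) \<Longrightarrow>
         (\<And>r. r \<in> R \<Longrightarrow> int p dvd (\<Sum>(m,x,j)\<leftarrow>r. m * c j)) \<Longrightarrow> \<forall>j\<in>J. int p dvd c j"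
    and supp: "\<And>z. z \<notin> carrier G \<times> J \<Longrightarrow> u z = 0"
    and sol: "\<And>r g. r \<in> R \<Longrightarrow> g \<in> carrier G \<Longrightarrow> row_app G r u g = 0"
  shows "u z = 0"
proof -
  interpret G: group G by (rule G)
  have p1: "1 < int p" using prime_gt_1_nat[OF p] by simp
  define Sol where "Sol v \<longleftrightarrow> (\<forall>z. z \<notin> carrier G \<times> J \<longrightarrow> v z = 0) \<and>
      (\<forall>r\<in>R. \<forall>g\<in>carrier G. row_app G r v g = 0)" for v :: "'g \<times> 'j \<Rightarrow> int"
  \<comment> \<open>The solutions modulo p. They form a space stable under right translation, so if
    it were nonzero it would contain a nonzero solution constant along the group, for which the
    system reduces to its augmentation.\<close>
  define U where "U = {v :: 'g \<times> 'j \<Rightarrow> int. (\<forall>z. 0 \<le> v z \<and> v z < int p) \<and> (\<forall>z. z \<notin> carrier G \<times> J \<longrightarrow> v z = 0) \<and>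
      (\<forall>r\<in>R. \<forall>g\<in>carrier G. int p dvd row_app G r v g)}"
  have app_mod: "int p dvd row_app G r (\<lambda>z. v z mod int p) g \<longleftrightarrow> int p dvd row_app G r v g"
    for r :: "(int \<times> 'g \<times> 'j) list" and v g
  proof -
    have "int p dvd (\<Sum>(m,x,j)\<leftarrow>r. m * (v (inv\<^bsub>G\<^esub> x \<otimes>\<^bsub>G\<^esub> g, j) mod int p)) - (\<Sum>(m,x,j)\<leftarrow>r. m * v (inv\<^bsub>G\<^esub> x \<otimes>\<^bsub>G\<^esub> g, j))"
    proof (induction r)
      case (Cons t r)
      obtain m x j where t: "t = (m,x,j)" by (cases t) auto
      have "int p dvd (v (inv\<^bsub>G\<^esub> x \<otimes>\<^bsub>G\<^esub> g, j) mod int p) - v (inv\<^bsub>G\<^esub> x \<otimes>\<^bsub>G\<^esub> g, j)"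
        by (metis dvd_diff_commute dvd_minus_mod)
      from dvd_mult[OF this, of m] Cons show ?case
        unfolding t by (simp add: right_diff_distrib) (smt (verit) dvd_add)
    qed simp
    then show ?thesis unfolding row_app_def by (metis dvd_diff_commute dvd_diff_right_iff)
  qed
  have app_add: "row_app G r (\<lambda>z. v z + w z) g = row_app G r v g + row_app G r w g"
    for r :: "(int \<times> 'g \<times> 'j) list" and v w g
    unfolding row_app_def by (induction r) (auto simp: algebra_simps)
  have zeroU: "(\<lambda>_. 0) \<in> U"
  proof -
    have "row_app G r (\<lambda>_. 0) g = 0" for r :: "(int \<times> 'g \<times> 'j) list" and g unfolding row_app_def by (induction r) auto
    then show ?thesis using p1 by (auto simp: U_def)
  qed
  have addU: "(\<lambda>z. (v z + w z) mod int p) \<in> U" if "v \<in> U" "w \<in> U" for v w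
    using that p1 unfolding U_def by (auto simp: app_mod app_add)
  have transU: "(\<lambda>(x,j). if x \<in> carrier G then v (x \<otimes>\<^bsub>G\<^esub> h, j) else 0) \<in> U"
    if v: "v \<in> U" and h: "h \<in> carrier G" for v h
  proof -
    have e: "row_app G r (\<lambda>(x,j). if x \<in> carrier G then v (x \<otimes>\<^bsub>G\<^esub> h, j) else 0) g = row_app G r v (g \<otimes>\<^bsub>G\<^esub> h)"
      if "r \<in> R" "g \<in> carrier G" for r g
      unfolding row_app_def
      by (intro arg_cong[of _ _ sum_list] map_cong refl) (use R that h in \<open>auto simp: G.m_assoc\<close>)
    have "x \<otimes>\<^bsub>G\<^esub> h \<in> carrier G \<longleftrightarrow> True" if "x \<in> carrier G" for x using that h by simp
    then show ?thesis using v h p1 unfolding U_def by (auto simp: e)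
  qed
  have rangeU: "0 \<le> v z \<and> v z < int p" if "v \<in> U" for v z using that unfolding U_def by blast
  have suppU: "v z = 0" if "v \<in> U" "z \<notin> carrier G \<times> J" for v z using that unfolding U_def by blast
  have triv: "v z = 0" if v: "v \<in> U" for v z
  proof (rule ccontr)
    assume nz: "v z \<noteq> 0"
    have inv: "\<exists>u j. u \<in> U \<and> j \<in> J \<and> u (\<one>\<^bsub>G\<^esub>, j) \<noteq> 0 \<and> (\<forall>x\<in>carrier G. \<forall>j. u (x, j) = u (\<one>\<^bsub>G\<^esub>, j))"
    proof (rule p_group_invariant_vector[OF G p ord J, where U = U and ?u0.0 = v and ?x0.0 = z])
      show "0 \<le> v z \<and> v z < int p" if "v \<in> U" for v z by (rule rangeU[OF that])
      show "v z = 0" if "v \<in> U" "z \<notin> carrier G \<times> J" for v z by (rule suppU[OF that])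
      show "(\<lambda>z. (v z + w z) mod int p) \<in> U" if "v \<in> U" "w \<in> U" for v w by (rule addU[OF that])
      show "(\<lambda>(x,j). if x \<in> carrier G then v (x \<otimes>\<^bsub>G\<^esub> h, j) else 0) \<in> U" if "v \<in> U" "h \<in> carrier G" for v h
        by (rule transU[OF that])
      fix w j
      assume w: "w \<in> U" "j \<in> J" "w (\<one>\<^bsub>G\<^esub>, j) \<noteq> 0" "\<And>x j. x \<in> carrier G \<Longrightarrow> w (x, j) = w (\<one>\<^bsub>G\<^esub>, j)"
      show "\<exists>u j. u \<in> U \<and> j \<in> J \<and> u (\<one>\<^bsub>G\<^esub>, j) \<noteq> 0 \<and> (\<forall>x\<in>carrier G. \<forall>j. u (x, j) = u (\<one>\<^bsub>G\<^esub>, j))"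
        by (rule exI[of _ w], rule exI[of _ j], intro conjI ballI allI w(1-3), rule w(4), assumption)
    qed (rule zeroU v nz)+
    obtain w j where w: "w \<in> U" "j \<in> J" "w (\<one>\<^bsub>G\<^esub>, j) \<noteq> 0" "\<forall>x\<in>carrier G. \<forall>j. w (x, j) = w (\<one>\<^bsub>G\<^esub>, j)"
      using inv by (elim exE conjE)
    define c where "c j = w (\<one>\<^bsub>G\<^esub>, j)" for j
    have "int p dvd (\<Sum>(m,x,j)\<leftarrow>r. m * c j)" if r: "r \<in> R" for r
    proof -
      have "row_app G r w \<one>\<^bsub>G\<^esub> = (\<Sum>(m,x,j)\<leftarrow>r. m * c j)"
        unfolding row_app_def c_def
      proof (intro arg_cong[of _ _ sum_list] map_cong refl)
        fix t assume t: "t \<in> set r"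
        obtain m x j where e: "t = (m, x, j)" by (cases t) auto
        have "inv\<^bsub>G\<^esub> x \<otimes>\<^bsub>G\<^esub> \<one>\<^bsub>G\<^esub> \<in> carrier G" using R[OF r, of m x j] t e by simp
        from w(4)[rule_format, OF this, of j]
        show "(case t of (m, x, j) \<Rightarrow> m * w (inv\<^bsub>G\<^esub> x \<otimes>\<^bsub>G\<^esub> \<one>\<^bsub>G\<^esub>, j)) = (case t of (m, x, j) \<Rightarrow> m * w (\<one>\<^bsub>G\<^esub>, j))"
          unfolding e prod.case by (rule arg_cong)
      qed
      moreover have "int p dvd row_app G r w \<one>\<^bsub>G\<^esub>" using w(1) r G.one_closed unfolding U_def by blast
      ultimately show ?thesis by simp
    qed
    moreover have "c j = 0" if "j \<notin> J" for j using suppU[OF w(1)] that by (simp add: c_def)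
    ultimately have "int p dvd c j" using aug w(2) by blast
    moreover have "0 \<le> c j" "c j < int p" "c j \<noteq> 0" using rangeU[OF w(1)] w(3) by (auto simp: c_def)
    ultimately show False using zdvd_not_zless[of "c j" "int p"] by linarith
  qed
  show ?thesis
  \<comment> \<open>Without nonzero solutions modulo p every integral solution is divisible by p,
    and its quotient by p is again a solution.\<close>
  proof (rule int_descent[of "int p" Sol u])
    show "1 < int p" by (rule p1)
    show "Sol u" using supp sol unfolding Sol_def by blast
  next
    fix v z assume v: "Sol v"
    have "(\<lambda>z. v z mod int p) \<in> U" using v p1 unfolding U_def Sol_def by (auto simp: app_mod)
    from triv[OF this, of z] show "int p dvd v z" by (simp add: dvd_eq_mod_eq_0)
  next
    fix v assume v: "Sol v"
    have d: "int p dvd v z" for z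
    proof -
      have "(\<lambda>z. v z mod int p) \<in> U" using v p1 unfolding U_def Sol_def by (auto simp: app_mod)
      from triv[OF this, of z] show "int p dvd v z" by (simp add: dvd_eq_mod_eq_0)
    qed
    have e: "row_app G r v g = int p * row_app G r (\<lambda>z. v z div int p) g"
      for r :: "(int \<times> 'g \<times> 'j) list" and g
    proof -
      have "v z = int p * (v z div int p)" for z using d by simp
      then have "row_app G r v g = row_app G r (\<lambda>z. int p * (v z div int p)) g" by presburger
      also have "\<dots> = int p * row_app G r (\<lambda>z. v z div int p) g"
        unfolding row_app_def by (induction r) (auto simp: algebra_simps)
      finally show ?thesis .
    qed
    show "Sol (\<lambda>z. v z div int p)" using v p1 unfolding Sol_def by (auto simp: e)
  qed
qed

text \<open>Measure x against a chosen representative of its coset. The extension is needed because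
  the image of the limit group may be a proper subgroup H of P, while the paths that belong to its
  elements run through all of P.\<close>

lemma coset_extension_of_residue_hom:
  assumes G: "group G" and H: "subgroup H G" and \<psi>: "residue_hom (G\<lparr>carrier := H\<rparr>) p \<psi>"
  shows "\<exists>f. \<forall>h\<in>H. \<forall>x\<in>carrier G. f (h \<otimes>\<^bsub>G\<^esub> x) = (\<psi> h + f x) mod int p"
proof -
  interpret G: group G by (rule G)
  interpret H: subgroup H G by (rule H)
  define rep where "rep x = (SOME z. z \<in> H #>\<^bsub>G\<^esub> x)" for x
  have rep: "rep x \<in> H #>\<^bsub>G\<^esub> x" if "x \<in> carrier G" for x
    unfolding rep_def by (rule someI[of _ x]) (rule G.rcos_self[OF that H])
  have quot: "x \<otimes>\<^bsub>G\<^esub> inv\<^bsub>G\<^esub> (rep x) \<in> H" and repc: "rep x \<in> carrier G" if x: "x \<in> carrier G" for x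
  proof -
    obtain h where h: "h \<in> H" "rep x = h \<otimes>\<^bsub>G\<^esub> x" using rep[OF x] by (auto simp: r_coset_def)
    have hc: "h \<in> carrier G" using h H.subset by blast
    then show "rep x \<in> carrier G" using h x by simp
    have "x \<otimes>\<^bsub>G\<^esub> inv\<^bsub>G\<^esub> (rep x) = inv\<^bsub>G\<^esub> h"
      using h hc x by (simp add: G.inv_mult_group G.m_assoc[symmetric])
    then show "x \<otimes>\<^bsub>G\<^esub> inv\<^bsub>G\<^esub> (rep x) \<in> H" using h by simp
  qed
  show ?thesis
  proof (intro exI[of _ "\<lambda>x. \<psi> (x \<otimes>\<^bsub>G\<^esub> inv\<^bsub>G\<^esub> (rep x))"] ballI)
    fix h x assume h: "h \<in> H" and x: "x \<in> carrier G"
    have hc: "h \<in> carrier G" using h H.subset by blast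
    have "H #>\<^bsub>G\<^esub> (h \<otimes>\<^bsub>G\<^esub> x) = H #>\<^bsub>G\<^esub> x"
      using h hc x H.subset by (simp add: G.coset_mult_assoc[symmetric] G.coset_join2[OF hc H h])
    hence r: "rep (h \<otimes>\<^bsub>G\<^esub> x) = rep x" by (simp add: rep_def)
    have "\<psi> (h \<otimes>\<^bsub>G\<^esub> x \<otimes>\<^bsub>G\<^esub> inv\<^bsub>G\<^esub> (rep x)) = \<psi> (h \<otimes>\<^bsub>G\<^esub> (x \<otimes>\<^bsub>G\<^esub> inv\<^bsub>G\<^esub> (rep x)))"
      using hc x repc[OF x] by (simp add: G.m_assoc)
    also have "\<dots> = (\<psi> h + \<psi> (x \<otimes>\<^bsub>G\<^esub> inv\<^bsub>G\<^esub> (rep x))) mod int p"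
      using \<psi> h quot[OF x] unfolding residue_hom_def by simp
    finally show "\<psi> (h \<otimes>\<^bsub>G\<^esub> x \<otimes>\<^bsub>G\<^esub> inv\<^bsub>G\<^esub> (rep (h \<otimes>\<^bsub>G\<^esub> x))) = (\<psi> h + \<psi> (x \<otimes>\<^bsub>G\<^esub> inv\<^bsub>G\<^esub> (rep x))) mod int p"
      unfolding r .
  qed
qed

text \<open>The sum of \<open>\<plusminus> n i x \<cdot> [x]\<close> over the edges of a path in the Cayley graph, where the edge from
  \<open>x\<close> to \<open>x y\<^sub>i\<close> has weight \<open>n i x\<close>.\<close>

definition edge_term :: "('g, 'b) monoid_scheme \<Rightarrow> ('i \<Rightarrow> 'g) \<Rightarrow> ('i \<Rightarrow> 'g \<Rightarrow> int) \<Rightarrow> 'g \<Rightarrow> 'i \<times> bool \<Rightarrow> 'g \<Rightarrow> int" where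
  "edge_term G y n x l g = (let z = (if snd l then x \<otimes>\<^bsub>G\<^esub> inv\<^bsub>G\<^esub> (y (fst l)) else x)
     in (if snd l then - 1 else 1) * n (fst l) z * of_bool (g = z))"

fun path_sum :: "('g, 'b) monoid_scheme \<Rightarrow> ('i \<Rightarrow> 'g) \<Rightarrow> ('i \<Rightarrow> 'g \<Rightarrow> int) \<Rightarrow> 'g \<Rightarrow> ('i \<times> bool) list \<Rightarrow> 'g \<Rightarrow> int" where
  "path_sum G y n x [] g = 0"
| "path_sum G y n x (l # w) g = edge_term G y n x l g + path_sum G y n (x \<otimes>\<^bsub>G\<^esub> letter_val G y l) w g"

section \<open>Sums along paths in a Cayley graph\<close>

context group
begin

lemma path_sum_append:
  assumes "\<And>i. y i \<in> carrier G" "x \<in> carrier G"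
  shows "path_sum G y n x (u @ v) g = path_sum G y n x u g + path_sum G y n (x \<otimes> word_val G y u) v g"
  using assms(2) by (induction u arbitrary: x) (auto simp: assms(1) m_assoc)

lemma path_sum_cons_red:
  assumes y: "\<And>i. y i \<in> carrier G" and x: "x \<in> carrier G"
  shows "path_sum G y n x (cons_red a w) g = path_sum G y n x (a # w) g"
proof (cases w)
  case (Cons b w')
  show ?thesis
  proof (cases "cancels a b")
    case True
    then have "edge_term G y n x a g + edge_term G y n (x \<otimes> letter_val G y a) b g = 0"
      using x y by (auto simp: cancels_def edge_term_def letter_val_def m_assoc Let_def)
    moreover have "x \<otimes> letter_val G y a \<otimes> letter_val G y b = x"
      using True x y letter_val_cancel[of y a b] by (simp add: m_assoc)
    ultimately show ?thesis using True Cons by simp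
  qed (use Cons in simp)
qed simp

lemma path_sum_reduce:
  assumes y: "\<And>i. y i \<in> carrier G" and x: "x \<in> carrier G"
  shows "path_sum G y n x (reduce_word w) g = path_sum G y n x w g"
  using x unfolding reduce_word_def
  by (induction w arbitrary: x) (simp_all add: path_sum_cons_red y)

text \<open>Invariance of the weights under h is what turns additivity along concatenated paths into
  the rule of a derivation.\<close>

lemma path_sum_translate:
  assumes y: "\<And>i. y i \<in> carrier G" and h: "h \<in> carrier G"
    and n: "\<And>i x. x \<in> carrier G \<Longrightarrow> n i (h \<otimes> x) = n i x"
  shows "x \<in> carrier G \<Longrightarrow> g \<in> carrier G \<Longrightarrow> path_sum G y n (h \<otimes> x) w (h \<otimes> g) = path_sum G y n x w g"
proof (induction w arbitrary: x)
  case (Cons l w)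
  have "edge_term G y n (h \<otimes> x) l (h \<otimes> g) = edge_term G y n x l g"
    using Cons.prems h y n by (auto simp: edge_term_def Let_def m_assoc)
  moreover have "h \<otimes> x \<otimes> letter_val G y l = h \<otimes> (x \<otimes> letter_val G y l)" using h y Cons.prems by (simp add: m_assoc)
  ultimately show ?case using Cons y by simp
qed simp

text \<open>Modulo p the weights are the differences of f along the edges, so the total telescopes;
  an inverse letter runs through its edge backwards.\<close>

lemma path_sum_total:
  assumes y: "\<And>i. y i \<in> carrier G" and fin: "finite (carrier G)"
    and n: "\<And>i x. x \<in> carrier G \<Longrightarrow> int p dvd n i x - (f (x \<otimes> y i) - f x)"
  shows "x \<in> carrier G \<Longrightarrow> int p dvd (\<Sum>g\<in>carrier G. path_sum G y n x w g) - (f (x \<otimes> word_val G y w) - f x)"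
proof (induction w arbitrary: x)
  case (Cons l w)
  obtain i b where l: "l = (i,b)" by (cases l)
  have e: "(\<Sum>g\<in>carrier G. edge_term G y n x l g) = (if b then - n i (x \<otimes> inv (y i)) else n i x)"
    using Cons.prems y fin by (auto simp: edge_term_def Let_def l if_distrib[where f = "\<lambda>a. _ * a"] of_bool_def cong: if_cong)
  have "int p dvd (\<Sum>g\<in>carrier G. edge_term G y n x l g) - (f (x \<otimes> letter_val G y l) - f x)"
  proof (cases b)
    case True
    have "x \<otimes> inv (y i) \<otimes> y i = x" using y Cons.prems by (simp add: m_assoc)
    then have "int p dvd n i (x \<otimes> inv (y i)) - (f x - f (x \<otimes> inv (y i)))"
      using n[of "x \<otimes> inv (y i)" i] Cons.prems y by simp
    moreover have "- n i (x \<otimes> inv (y i)) - (f (x \<otimes> inv (y i)) - f x) = - (n i (x \<otimes> inv (y i)) - (f x - f (x \<otimes> inv (y i))))"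
      by simp
    ultimately have "int p dvd - n i (x \<otimes> inv (y i)) - (f (x \<otimes> inv (y i)) - f x)" by (metis dvd_minus_iff)
    then show ?thesis unfolding e using True by (simp add: l letter_val_def)
  next
    case False
    then show ?thesis unfolding e using n[OF Cons.prems, of i] by (simp add: l letter_val_def)
  qed
  moreover have "int p dvd (\<Sum>g\<in>carrier G. path_sum G y n (x \<otimes> letter_val G y l) w g)
      - (f (x \<otimes> letter_val G y l \<otimes> word_val G y w) - f (x \<otimes> letter_val G y l))"
    using Cons y by simp
  ultimately have "int p dvd ((\<Sum>g\<in>carrier G. edge_term G y n x l g) - (f (x \<otimes> letter_val G y l) - f x)) +
    ((\<Sum>g\<in>carrier G. path_sum G y n (x \<otimes> letter_val G y l) w g)
      - (f (x \<otimes> letter_val G y l \<otimes> word_val G y w) - f (x \<otimes> letter_val G y l)))" by (rule dvd_add)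
  then show ?case using Cons.prems y by (simp add: sum.distrib m_assoc algebra_simps)
qed simp

end

section \<open>Traces of powers of Gram matrices over group rings\<close>

text \<open>Elements of the integral group ring of a free group, as lists of coefficients and words, and
  rows over this ring, whose third entry is the column.\<close>

type_synonym formal = "(int \<times> (nat \<times> bool) list) list"
type_synonym formal_row = "(int \<times> (nat \<times> bool) list \<times> nat) list"

definition row_entry :: "formal_row \<Rightarrow> nat \<Rightarrow> formal" where
  "row_entry r i = map (\<lambda>(c,w,j). (c,w)) (filter (\<lambda>(c,w,j). j = i) r)"

definition formal_mult :: "formal \<Rightarrow> formal \<Rightarrow> formal" where
  "formal_mult A B = concat (map (\<lambda>(c,w). map (\<lambda>(c',w'). (c * c', w @ w')) B) A)"

definition formal_adj :: "formal \<Rightarrow> formal" where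
  "formal_adj A = map (\<lambda>(c,w). (c, word_inv w)) A"

definition gram_words :: "formal_row list \<Rightarrow> nat \<Rightarrow> nat \<Rightarrow> formal" where
  "gram_words rs i i' = concat (map (\<lambda>r. formal_mult (formal_adj (row_entry r i)) (row_entry r i')) rs)"

text \<open>It depends on the rows alone, so that one constant serves all finite quotients at
  once.\<close>

definition gram_bound :: "formal_row list \<Rightarrow> nat \<Rightarrow> int" where
  "gram_bound rs d = 1 + (\<Sum>i<d. \<Sum>i'<d. \<Sum>(c,w)\<leftarrow>gram_words rs i i'. \<bar>c\<bar>)"

lemma gram_bound_ge_1: "1 \<le> gram_bound rs d"
  unfolding gram_bound_def by (intro add_increasing2 sum_nonneg sum_list_nonneg) auto

definition shifted_gram_words :: "formal_row list \<Rightarrow> nat \<Rightarrow> nat \<Rightarrow> nat \<Rightarrow> formal" where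
  "shifted_gram_words rs d i i' = (if i = i' then [(gram_bound rs d, [])] else []) @ map (\<lambda>(c,w). (- c, w)) (gram_words rs i i')"

fun power_words :: "formal_row list \<Rightarrow> nat \<Rightarrow> nat \<Rightarrow> nat \<Rightarrow> nat \<Rightarrow> formal" where
  "power_words rs d 0 i i' = (if i = i' then [(1, [])] else [])"
| "power_words rs d (Suc k) i i' = concat (map (\<lambda>j. formal_mult (shifted_gram_words rs d i j) (power_words rs d k j i')) [0..<d])"

text \<open>The trace divided by the order of the group, read off as the coefficient of the
  identity. The group enters only through the question which words are trivial.\<close>

definition formal_trace :: "('a, 'b) monoid_scheme \<Rightarrow> (nat \<Rightarrow> 'a) \<Rightarrow> formal_row list \<Rightarrow> nat \<Rightarrow> nat \<Rightarrow> int" where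
  "formal_trace G y rs d k = (\<Sum>i<d. \<Sum>(c,w)\<leftarrow>power_words rs d k i i. c * of_bool (word_val G y w = \<one>\<^bsub>G\<^esub>))"

text \<open>The entry in row g and column g' of the matrix of left multiplication by the image of L
  in the group ring of G.\<close>

definition formal_eval :: "('a, 'b) monoid_scheme \<Rightarrow> (nat \<Rightarrow> 'a) \<Rightarrow> formal \<Rightarrow> 'a \<Rightarrow> 'a \<Rightarrow> int" where
  "formal_eval G y L g g' = (\<Sum>(c,w)\<leftarrow>L. c * of_bool (g = word_val G y w \<otimes>\<^bsub>G\<^esub> g'))"

definition row_matrix :: "('a, 'b) monoid_scheme \<Rightarrow> (nat \<Rightarrow> 'a) \<Rightarrow> formal_row list \<Rightarrow> nat \<times> 'a \<Rightarrow> nat \<times> 'a \<Rightarrow> int" where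
  "row_matrix G y rs = (\<lambda>(q,g) (i,g'). formal_eval G y (row_entry (rs ! q) i) g g')"

lemma formal_eval_simps [simp]:
  "formal_eval G y [] g g' = 0"
  "formal_eval G y (cw # L) g g' = fst cw * of_bool (g = word_val G y (snd cw) \<otimes>\<^bsub>G\<^esub> g') + formal_eval G y L g g'"
  by (auto simp: formal_eval_def split: prod.splits)

lemma formal_eval_append: "formal_eval G y (L @ L') g g' = formal_eval G y L g g' + formal_eval G y L' g g'"
  by (induction L) auto

lemma formal_eval_concat: "formal_eval G y (concat Ls) g g' = (\<Sum>L\<leftarrow>Ls. formal_eval G y L g g')"
  by (induction Ls) (auto simp: formal_eval_append)

lemma formal_eval_neg: "formal_eval G y (map (\<lambda>(c,w). (- c, w)) L) g g' = - formal_eval G y L g g'"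
  by (induction L) auto

context group
begin

lemma formal_eval_mult:
  assumes y: "\<And>i. y i \<in> carrier G" and fin: "finite (carrier G)" and g: "g' \<in> carrier G"
  shows "formal_eval G y (formal_mult A B) g g' = (\<Sum>h\<in>carrier G. formal_eval G y A g h * formal_eval G y B h g')"
proof -
  have one: "formal_eval G y (map (\<lambda>(c',w'). (c * c', w @ w')) B) g g'
     = (\<Sum>h\<in>carrier G. c * of_bool (g = word_val G y w \<otimes> h) * formal_eval G y B h g')" for c w
  proof (induction B)
    case (Cons cw B)
    obtain c' w' where cw: "cw = (c',w')" by (cases cw)
    let ?h = "word_val G y w' \<otimes> g'"
    have h: "?h \<in> carrier G" using y g by simp
    have "(\<Sum>h\<in>carrier G. c * of_bool (g = word_val G y w \<otimes> h) * (c' * of_bool (h = ?h)))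
        = (\<Sum>h\<in>carrier G. if h = ?h then c * of_bool (g = word_val G y w \<otimes> ?h) * c' else 0)"
      by (intro sum.cong refl) auto
    also have "\<dots> = c * of_bool (g = word_val G y w \<otimes> ?h) * c'" using h fin by simp
    also have "\<dots> = c * c' * of_bool (g = word_val G y (w @ w') \<otimes> g')"
      using y g by (simp add: word_val_append m_assoc)
    finally show ?case using Cons by (simp add: cw distrib_left sum.distrib)
  qed simp
  show ?thesis
  proof (induction A)
    case (Cons cw A)
    obtain c w where cw: "cw = (c,w)" by (cases cw)
    have "formal_mult (cw # A) B = map (\<lambda>(c',w'). (c * c', w @ w')) B @ formal_mult A B"
      by (simp add: formal_mult_def cw)
    then show ?case using Cons by (simp add: formal_eval_append one cw distrib_right sum.distrib)
  qed (simp add: formal_mult_def)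
qed

text \<open>Left translation by a group element is a permutation matrix, so transposing it amounts
  to inverting the element.\<close>

lemma formal_eval_adj:
  assumes y: "\<And>i. y i \<in> carrier G" and g: "g \<in> carrier G" "g' \<in> carrier G"
  shows "formal_eval G y (formal_adj A) g g' = formal_eval G y A g' g"
proof (induction A)
  case (Cons cw A)
  obtain c w where cw: "cw = (c,w)" by (cases cw)
  let ?w = "word_val G y w"
  have w: "?w \<in> carrier G" using y by simp
  have "g = inv ?w \<otimes> g' \<longleftrightarrow> g' = ?w \<otimes> g"
    using g w by (metis inv_closed inv_solve_left)
  then show ?case using Cons y by (simp add: formal_adj_def cw word_val_inv)
qed (simp add: formal_adj_def)

text \<open>For each word and each g exactly one g' is hit, so every word contributes at most the
  absolute value of its coefficient, however large the group is.\<close>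

lemma sum_abs_formal_eval:
  assumes y: "\<And>i. y i \<in> carrier G" and fin: "finite (carrier G)" and g: "g \<in> carrier G"
  shows "(\<Sum>g'\<in>carrier G. \<bar>formal_eval G y L g g'\<bar>) \<le> (\<Sum>(c,w)\<leftarrow>L. \<bar>c\<bar>)"
proof (induction L)
  case (Cons cw L)
  obtain c w where cw: "cw = (c,w)" by (cases cw)
  let ?w = "word_val G y w"
  have w: "?w \<in> carrier G" using y by simp
  have "g = ?w \<otimes> h \<longleftrightarrow> h = inv ?w \<otimes> g" if "h \<in> carrier G" for h
    using g w that by (metis inv_closed inv_solve_left)
  then have "(\<Sum>h\<in>carrier G. \<bar>c * of_bool (g = ?w \<otimes> h)\<bar>) = (\<Sum>h\<in>carrier G. if h = inv ?w \<otimes> g then \<bar>c\<bar> else 0)"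
    by (intro sum.cong refl) auto
  also have "\<dots> = \<bar>c\<bar>" using g w fin by simp
  finally have e: "(\<Sum>h\<in>carrier G. \<bar>c * of_bool (g = ?w \<otimes> h)\<bar>) = \<bar>c\<bar>" .
  have "(\<Sum>h\<in>carrier G. \<bar>formal_eval G y (cw # L) g h\<bar>) \<le> (\<Sum>h\<in>carrier G. \<bar>c * of_bool (g = ?w \<otimes> h)\<bar> + \<bar>formal_eval G y L g h\<bar>)"
    by (intro sum_mono) (simp add: cw abs_triangle_ineq)
  also have "\<dots> = \<bar>c\<bar> + (\<Sum>h\<in>carrier G. \<bar>formal_eval G y L g h\<bar>)" by (simp only: sum.distrib e)
  finally show ?case using Cons by (simp add: cw)
qed simp

lemma gram_row_matrix:
  assumes y: "\<And>i. y i \<in> carrier G" and fin: "finite (carrier G)" and g: "g \<in> carrier G" "g' \<in> carrier G"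
  shows "(\<Sum>z\<in>{..<length rs} \<times> carrier G. row_matrix G y rs z (i,g) * row_matrix G y rs z (i',g'))
     = formal_eval G y (gram_words rs i i') g g'"
proof -
  have "(\<Sum>z\<in>{..<length rs} \<times> carrier G. row_matrix G y rs z (i,g) * row_matrix G y rs z (i',g'))
     = (\<Sum>q<length rs. \<Sum>h\<in>carrier G. formal_eval G y (row_entry (rs ! q) i) h g * formal_eval G y (row_entry (rs ! q) i') h g')"
    by (simp add: sum.cartesian_product row_matrix_def case_prod_unfold)
  also have "\<dots> = (\<Sum>q<length rs. formal_eval G y (formal_mult (formal_adj (row_entry (rs ! q) i)) (row_entry (rs ! q) i')) g g')"
    by (intro sum.cong refl) (simp add: formal_eval_mult[OF y fin g(2)] formal_eval_adj[OF y g(1)])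
  also have "\<dots> = (\<Sum>r\<leftarrow>rs. formal_eval G y (formal_mult (formal_adj (row_entry r i)) (row_entry r i')) g g')"
    by (simp add: sum_list_sum_nth lessThan_atLeast0)
  finally show ?thesis by (simp add: gram_words_def formal_eval_concat o_def)
qed

lemma gram_locale:
  assumes y: "\<And>i. y i \<in> carrier G" and fin: "finite (carrier G)"
  shows "gram ({..<d} \<times> carrier G) ({..<length rs} \<times> carrier G) (row_matrix G y rs) (gram_bound rs d)"
proof
  show "1 \<le> gram_bound rs d" by (rule gram_bound_ge_1)
  fix x assume "x \<in> {..<d} \<times> carrier G"
  then obtain i g where x: "x = (i,g)" "i < d" "g \<in> carrier G" by auto
  have "(\<Sum>x'\<in>{..<d} \<times> carrier G. \<bar>\<Sum>z\<in>{..<length rs} \<times> carrier G. row_matrix G y rs z x * row_matrix G y rs z x'\<bar>)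
     = (\<Sum>i'<d. \<Sum>g'\<in>carrier G. \<bar>\<Sum>z\<in>{..<length rs} \<times> carrier G. row_matrix G y rs z (i,g) * row_matrix G y rs z (i',g')\<bar>)"
    unfolding x sum.cartesian_product by (simp only: case_prod_unfold prod.collapse)
  also have "\<dots> = (\<Sum>i'<d. \<Sum>g'\<in>carrier G. \<bar>formal_eval G y (gram_words rs i i') g g'\<bar>)"
    by (intro sum.cong refl) (simp only: gram_row_matrix[OF y fin x(3)])
  also have "\<dots> \<le> (\<Sum>i'<d. \<Sum>(c,w)\<leftarrow>gram_words rs i i'. \<bar>c\<bar>)"
    by (intro sum_mono sum_abs_formal_eval[OF y fin x(3)])
  also have "\<dots> \<le> (\<Sum>i<d. \<Sum>i'<d. \<Sum>(c,w)\<leftarrow>gram_words rs i i'. \<bar>c\<bar>)"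
    by (rule member_le_sum[of i "{..<d}" "\<lambda>i. \<Sum>i'<d. \<Sum>(c,w)\<leftarrow>gram_words rs i i'. \<bar>c\<bar>"])
       (use x in \<open>auto intro!: sum_nonneg sum_list_nonneg\<close>)
  finally show "(\<Sum>x'\<in>{..<d} \<times> carrier G. \<bar>\<Sum>z\<in>{..<length rs} \<times> carrier G. row_matrix G y rs z x * row_matrix G y rs z x'\<bar>)
     \<le> gram_bound rs d" unfolding gram_bound_def by simp
qed (use fin in auto)

text \<open>Left multiplications commute with right translations, so the diagonal entry at (i, g)
  does not depend on g.\<close>

lemma trace_power_words:
  assumes y: "\<And>i. y i \<in> carrier G" and fin: "finite (carrier G)"
  shows "(\<Sum>x\<in>{..<d} \<times> carrier G. gram.Tpow ({..<d} \<times> carrier G) ({..<length rs} \<times> carrier G) (row_matrix G y rs) (gram_bound rs d) k x x)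
     = int (card (carrier G)) * formal_trace G y rs d k"
proof -
  let ?X = "{..<d} \<times> carrier G" and ?Y = "{..<length rs} \<times> carrier G"
  interpret A: gram ?X ?Y "row_matrix G y rs" "gram_bound rs d" by (rule gram_locale[OF y fin])
  have T: "A.T (i,g) (i',g') = formal_eval G y (shifted_gram_words rs d i i') g g'"
    if "g \<in> carrier G" "g' \<in> carrier G" for i i' g g'
    unfolding A.T_def A.M_def gram_row_matrix[OF y fin that] shifted_gram_words_def
    using that by (simp add: formal_eval_append formal_eval_neg)
  have Tp: "A.Tpow k (i,g) (i',g') = formal_eval G y (power_words rs d k i i') g g'"
    if "g \<in> carrier G" "g' \<in> carrier G" for i i' g g'
    using that
  proof (induction k arbitrary: i g)
    case 0
    then show ?case by simp
  next
    case (Suc k)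
    have "A.Tpow (Suc k) (i,g) (i',g') = (\<Sum>j<d. \<Sum>h\<in>carrier G. A.T (i,g) (j,h) * A.Tpow k (j,h) (i',g'))"
      by (simp add: sum.cartesian_product case_prod_unfold)
    also have "\<dots> = (\<Sum>j<d. \<Sum>h\<in>carrier G. formal_eval G y (shifted_gram_words rs d i j) g h * formal_eval G y (power_words rs d k j i') h g')"
      by (intro sum.cong refl) (simp only: T[OF Suc.prems(1)] Suc.IH Suc.prems)
    also have "\<dots> = (\<Sum>j<d. formal_eval G y (formal_mult (shifted_gram_words rs d i j) (power_words rs d k j i')) g g')"
      by (simp only: formal_eval_mult[OF y fin Suc.prems(2)])
    finally show ?case by (simp add: formal_eval_concat o_def interv_sum_list_conv_sum_set_nat lessThan_atLeast0)
  qed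
  have diag: "formal_eval G y L g g = (\<Sum>(c,w)\<leftarrow>L. c * of_bool (word_val G y w = \<one>))" if g: "g \<in> carrier G" for L g
  proof (induction L)
    case (Cons cw L)
    have "g = word_val G y (snd cw) \<otimes> g \<longleftrightarrow> word_val G y (snd cw) = \<one>"
      using g y r_cancel_one'[of g "word_val G y (snd cw)"] by simp
    then show ?case using Cons by (simp split: prod.splits)
  qed simp
  have "(\<Sum>x\<in>?X. A.Tpow k x x) = (\<Sum>i<d. \<Sum>g\<in>carrier G. A.Tpow k (i,g) (i,g))"
    by (simp add: sum.cartesian_product case_prod_unfold)
  also have "\<dots> = (\<Sum>i<d. \<Sum>g\<in>carrier G. \<Sum>(c,w)\<leftarrow>power_words rs d k i i. c * of_bool (word_val G y w = \<one>))"
    by (intro sum.cong refl) (simp only: Tp diag)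
  finally show ?thesis by (simp add: formal_trace_def sum_distrib_left)
qed

end

section \<open>Fox calculus and derivations twisted by a character\<close>

instance fract :: ("{idom,ring_char_0}") field_char_0
proof
  show "inj (of_nat :: nat \<Rightarrow> 'a fract)"
    by (rule injI) (simp add: of_nat_fract eq_fract)
qed

lemma to_fract_power: "to_fract (x ^ n) = to_fract x ^ n"
  by (induction n) auto

lemma to_fract_of_nat: "to_fract (of_nat m) = of_nat m"
  by (induction m) auto

lemma to_fract_of_int: "to_fract (of_int n) = of_int n"
  by (cases n rule: int_diff_cases) (simp add: to_fract_of_nat)

lemma fract_common_denominator:
  fixes u :: "'v \<Rightarrow> 'r::idom fract"
  assumes "finite T"
  shows "\<exists>f h. f \<noteq> 0 \<and> (\<forall>v\<in>T. to_fract f * u v = to_fract (h v))"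
  using assms
proof (induction rule: finite_induct)
  case empty
  show ?case by (intro exI[of _ 1]) auto
next
  case (insert x T)
  then obtain f h where fh: "f \<noteq> 0" "\<forall>v\<in>T. to_fract f * u v = to_fract (h v)" by blast
  obtain a b where ab: "u x = Fract a b" "b \<noteq> 0" by (cases "u x") auto
  have x: "to_fract b * u x = to_fract a" using ab by (simp add: to_fract_def eq_fract)
  show ?case
  proof (intro exI[of _ "b * f"] exI[of _ "\<lambda>v. if v = x then f * a else b * h v"] conjI ballI)
    show "b * f \<noteq> 0" using ab fh by simp
    fix v assume "v \<in> insert x T"
    then show "to_fract (b * f) * u v = to_fract (if v = x then f * a else b * h v)"
      using x fh(2) by (auto simp: mult_ac)
  qed
qed

text \<open>The variable t. The field Q(t) is built as the fraction field of Z[t], so that clearing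
  denominators leads to integral polynomials, which can be reduced modulo p.\<close>

definition tK :: "int poly fract" where "tK = to_fract [:0, 1:]"

lemma tK_nonzero [simp]: "tK \<noteq> 0"
  by (simp add: tK_def)

lemma to_fract_monom: "to_fract (Polynomial.monom c n) = of_int c * tK ^ n"
proof -
  have "Polynomial.monom c n = of_int c * [:0, 1:] ^ n" by (simp add: monom_altdef of_int_poly)
  then show ?thesis by (simp add: tK_def to_fract_power to_fract_of_int)
qed

text \<open>A common denominator and a power of t turn the relation into one in Z[t], where the
  monomials are distinct because m is not 0.\<close>

lemma tK_powi_independent:
  fixes F :: "nat set" and r :: "nat \<Rightarrow> rat" and m :: int
  assumes F: "finite F" and m: "m \<noteq> 0" and z: "(\<Sum>j\<in>F. of_rat (r j) * tK powi (int j * m)) = 0"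
  shows "\<forall>j\<in>F. r j = 0"
proof
  fix j0 assume j0: "j0 \<in> F"
  obtain N :: int where N: "N \<noteq> 0" "\<forall>j\<in>F. \<exists>c::int. of_int N * r j = of_int c"
    using common_denominator[OF F, of r] by blast
  then obtain c :: "nat \<Rightarrow> int" where c: "\<And>j. j \<in> F \<Longrightarrow> of_int N * r j = of_int (c j)" by metis
  \<comment> \<open>Large enough to make all exponents nonnegative, whatever the sign of m.\<close>
  define B where "B = (\<Sum>j\<in>F. int j * \<bar>m\<bar>)"
  define e where "e j = nat (int j * m + B)" for j
  have Bj: "0 \<le> int j * m + B" if "j \<in> F" for j
  proof -
    have "int j * \<bar>m\<bar> \<le> B" unfolding B_def by (rule member_le_sum[OF that]) (use F in auto)
    moreover have "- (int j * m) \<le> int j * \<bar>m\<bar>" by (metis abs_ge_minus_self abs_mult abs_of_nat)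
    ultimately show ?thesis by linarith
  qed
  have inj: "e j = e j' \<longleftrightarrow> j = j'" if "j \<in> F" "j' \<in> F" for j j'
    using Bj[OF that(1)] Bj[OF that(2)] m by (auto simp: e_def eq_nat_nat_iff)
  have te: "tK ^ e j = tK powi (int j * m) * tK powi B" if "j \<in> F" for j
  proof -
    have "tK ^ e j = tK powi (int (e j))" by simp
    also have "int (e j) = int j * m + B" using Bj[OF that] by (simp add: e_def)
    finally show ?thesis by (simp add: power_int_add)
  qed
  have "to_fract (\<Sum>j\<in>F. Polynomial.monom (c j) (e j)) = (\<Sum>j\<in>F. of_int (c j) * tK ^ e j)"
    by (simp add: to_fract_sum to_fract_monom)
  also have "\<dots> = (\<Sum>j\<in>F. of_int N * tK powi B * (of_rat (r j) * tK powi (int j * m)))"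
  proof (rule sum.cong[OF refl])
    fix j assume j: "j \<in> F"
    have "(of_int (c j) :: int poly fract) = of_rat (of_int (c j))" by simp
    also have "\<dots> = of_int N * of_rat (r j)" unfolding c[OF j, symmetric] by (simp add: of_rat_mult)
    finally show "of_int (c j) * tK ^ e j = of_int N * tK powi B * (of_rat (r j) * tK powi (int j * m))"
      unfolding te[OF j] by (simp add: mult_ac)
  qed
  also have "\<dots> = 0" using z by (simp flip: sum_distrib_left)
  finally have "(\<Sum>j\<in>F. Polynomial.monom (c j) (e j)) = 0" by (simp only: to_fract_eq_0_iff)
  then have "0 = Polynomial.coeff (\<Sum>j\<in>F. Polynomial.monom (c j) (e j)) (e j0)" by simp
  also have "\<dots> = (\<Sum>j\<in>F. if j = j0 then c j0 else 0)"
    unfolding coeff_sum by (intro sum.cong refl) (use inj j0 in auto)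
  finally have "c j0 = 0" using j0 F by simp
  then show "r j0 = 0" using c[OF j0] N(1) by simp
qed

text \<open>The Fox derivatives of a word; the entry \<open>(c, u, j)\<close> stands for the summand \<open>c u\<close> of the
  derivative with respect to the generator \<open>j\<close>.\<close>

fun fox :: "('i \<times> bool) list \<Rightarrow> (int \<times> ('i \<times> bool) list \<times> 'i) list" where
  "fox [] = []"
| "fox (l # w) = (if snd l then (- 1, [l], fst l) else (1, [], fst l)) # map (\<lambda>(c,u,j). (c, l # u, j)) (fox w)"

definition word_exp :: "('i \<Rightarrow> int) \<Rightarrow> ('i \<times> bool) list \<Rightarrow> int" where
  "word_exp e w = (\<Sum>l\<leftarrow>w. if snd l then - e (fst l) else e (fst l))"

lemma word_exp_simps [simp]:
  "word_exp e [] = 0" "word_exp e (l # w) = (if snd l then - e (fst l) else e (fst l)) + word_exp e w"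
  "word_exp e (u @ w) = word_exp e u + word_exp e w"
  by (simp_all add: word_exp_def)

definition letters_below :: "nat \<Rightarrow> (nat \<times> bool) list \<Rightarrow> bool" where
  "letters_below d w \<longleftrightarrow> (\<forall>l\<in>set w. fst l < d)"

lemma letters_below_simps [simp]:
  "letters_below d []" "letters_below d (l # w) \<longleftrightarrow> fst l < d \<and> letters_below d w"
  "letters_below d (u @ w) \<longleftrightarrow> letters_below d u \<and> letters_below d w"
  "letters_below d (word_inv w) \<longleftrightarrow> letters_below d w"
  by (auto simp: letters_below_def word_inv_def)

lemma fox_letters: "letters_below d w \<Longrightarrow> (c,u,j) \<in> set (fox w) \<Longrightarrow> j < d \<and> letters_below d u"
  by (induction w arbitrary: c u j) (auto split: if_splits)

text \<open>The value on a word of the derivation into \<open>int poly fract\<close> (twisted by \<open>t\<close> to the exponent)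
  with prescribed values \<open>a\<close> on the letters.\<close>

definition fox_eval :: "('i \<Rightarrow> int) \<Rightarrow> ('i \<Rightarrow> int poly fract) \<Rightarrow> ('i \<times> bool) list \<Rightarrow> int poly fract" where
  "fox_eval e a w = (\<Sum>(c,u,j)\<leftarrow>fox w. of_int c * tK powi word_exp e u * a j)"

lemma fox_eval_Nil [simp]: "fox_eval e a [] = 0"
  by (simp add: fox_eval_def)

lemma fox_eval_Cons:
  "fox_eval e a (l # w) = (if snd l then - (tK powi (- e (fst l)) * a (fst l)) else a (fst l))
     + tK powi word_exp e [l] * fox_eval e a w"
proof -
  have "(\<Sum>(c,u,j)\<leftarrow>map (\<lambda>(c,u,j). (c, l # u, j)) r. of_int c * tK powi word_exp e u * a j)
      = tK powi word_exp e [l] * (\<Sum>(c,u,j)\<leftarrow>r. of_int c * tK powi word_exp e u * a j)" for r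
  proof (induction r)
    case (Cons t r)
    obtain c u j where t: "t = (c,u,j)" by (cases t) auto
    have "word_exp e (l # u) = word_exp e [l] + word_exp e u" by simp
    then have "tK powi word_exp e (l # u) = tK powi word_exp e [l] * tK powi word_exp e u"
      by (simp only: power_int_add[OF disjI1[OF tK_nonzero]])
    then show ?case using Cons by (simp add: t algebra_simps del: word_exp_simps)
  qed simp
  from this[of "fox w"] show ?thesis by (simp add: fox_eval_def)
qed

lemma fox_eval_append: "fox_eval e a (u @ w) = fox_eval e a u + tK powi word_exp e u * fox_eval e a w"
  by (induction u) (auto simp: fox_eval_Cons power_int_add algebra_simps)

section \<open>Derivations of a finitely generated group and its relators\<close>

lemma generators_of_fin_gen_group:
  assumes "fin_gen_group G"
  shows "\<exists>d x. (\<forall>i::nat. x i \<in> carrier G) \<and> (\<forall>g\<in>carrier G. \<exists>w. letters_below d w \<and> word_val G x w = g)"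
proof -
  interpret G: group G using assms unfolding fin_gen_group_def by blast
  obtain A where A: "finite A" "A \<subseteq> carrier G" "generate G A = carrier G"
    using assms unfolding fin_gen_group_def by blast
  obtain x0 d where x0: "A = x0 ` {..<d::nat}"
    using finite_imp_nat_seg_image_inj_on[OF A(1)] by (metis lessThan_def)
  \<comment> \<open>From d on the value is the identity, so that every index names an element of the
    group.\<close>
  define x where "x i = (if i < d then x0 i else \<one>\<^bsub>G\<^esub>)" for i
  have xc: "x i \<in> carrier G" for i using A(2) x0 by (auto simp: x_def)
  have "\<exists>w. letters_below d w \<and> word_val G x w = g" if "g \<in> generate G A" for g
    using that
  proof (induction rule: generate.induct)
    case one
    show ?case by (intro exI[of _ "[]"]) simp
  next
    case (incl h)
    then obtain i where i: "i < d" "h = x0 i" using x0 by auto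
    then have "word_val G x [(i, False)] = h" using xc[of i] by (simp add: letter_val_def x_def)
    then show ?case using i by (intro exI[of _ "[(i, False)]"]) simp
  next
    case (inv h)
    then obtain i where i: "i < d" "h = x0 i" using x0 by auto
    then have "word_val G x [(i, True)] = inv\<^bsub>G\<^esub> h" using xc[of i] by (simp add: letter_val_def x_def)
    then show ?case using i by (intro exI[of _ "[(i, True)]"]) simp
  next
    case (eng h1 h2)
    then obtain w1 w2 where "letters_below d w1" "word_val G x w1 = h1" "letters_below d w2" "word_val G x w2 = h2" by blast
    then show ?case using xc by (intro exI[of _ "w1 @ w2"]) (simp add: G.word_val_append)
  qed
  then show ?thesis using xc A(3) by blast
qed

lemma word_exp_word_val:
  assumes G: "group G" and \<phi>: "\<phi> \<in> hom G integer_group" and x: "\<And>i. x i \<in> carrier G"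
  shows "word_exp (\<lambda>i. \<phi> (x i)) w = \<phi> (word_val G x w)"
proof -
  interpret G: group G by (rule G)
  interpret \<phi>: group_hom G integer_group \<phi>
    using G \<phi> group_integer_group by (simp add: group_hom_def group_hom_axioms_def)
  have "\<phi> (letter_val G x l) = (if snd l then - \<phi> (x (fst l)) else \<phi> (x (fst l)))" for l
    using x by (simp add: letter_val_def)
  then show ?thesis using x by (induction w) simp_all
qed

definition relators :: "('a, 'b) monoid_scheme \<Rightarrow> (nat \<Rightarrow> 'a) \<Rightarrow> nat \<Rightarrow> (nat \<times> bool) list set" where
  "relators G x d = {w. letters_below d w \<and> word_val G x w = \<one>\<^bsub>G\<^esub>}"

text \<open>If w and w' represent the same element, both become relators when followed by the
  inverse of w'. Comparing the two equations shows that the value of the derivation depends only on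
  the element.\<close>

lemma derivation_of_relator_solution:
  fixes a :: "nat \<Rightarrow> int poly fract"
  assumes G: "group G" and \<phi>: "\<phi> \<in> hom G integer_group" and x: "\<And>i. x i \<in> carrier G"
    and gen: "\<forall>g\<in>carrier G. \<exists>w. letters_below d w \<and> word_val G x w = g"
    and sol: "\<And>w. w \<in> relators G x d \<Longrightarrow> fox_eval (\<lambda>i. \<phi> (x i)) a w = 0"
  shows "\<exists>\<delta>. (\<forall>g\<in>carrier G. \<forall>h\<in>carrier G. \<delta> (g \<otimes>\<^bsub>G\<^esub> h) = \<delta> g + tK powi \<phi> g * \<delta> h) \<and> (\<forall>i<d. \<delta> (x i) = a i)"
proof -
  interpret G: group G by (rule G)
  let ?D = "fox_eval (\<lambda>i. \<phi> (x i)) a"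
  have e: "word_exp (\<lambda>i. \<phi> (x i)) w = \<phi> (word_val G x w)" for w by (rule word_exp_word_val[OF G \<phi> x])
  have wd: "?D w = ?D w'" if w: "letters_below d w" "letters_below d w'" "word_val G x w = word_val G x w'" for w w'
  proof -
    have r: "w @ word_inv w' \<in> relators G x d" "w' @ word_inv w' \<in> relators G x d"
      using w x by (simp_all add: relators_def G.word_val_append G.word_val_inv)
    have "?D w + tK powi \<phi> (word_val G x w) * ?D (word_inv w') = 0"
      "?D w' + tK powi \<phi> (word_val G x w') * ?D (word_inv w') = 0"
      using sol[OF r(1)] sol[OF r(2)] by (simp_all add: fox_eval_append e)
    then show ?thesis using w(3) by (metis add_right_cancel)
  qed
  define W where "W g = (SOME w. letters_below d w \<and> word_val G x w = g)" for g
  have W: "letters_below d (W g)" "word_val G x (W g) = g" if "g \<in> carrier G" for g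
    using someI_ex[OF gen[rule_format, OF that]] unfolding W_def by auto
  define \<delta> where "\<delta> g = ?D (W g)" for g
  show ?thesis
  proof (intro exI[of _ \<delta>] conjI ballI allI impI)
    fix g h assume gh: "g \<in> carrier G" "h \<in> carrier G"
    have "\<delta> (g \<otimes>\<^bsub>G\<^esub> h) = ?D (W g @ W h)"
      unfolding \<delta>_def by (rule wd) (use W gh x in \<open>simp_all add: G.word_val_append\<close>)
    then show "\<delta> (g \<otimes>\<^bsub>G\<^esub> h) = \<delta> g + tK powi \<phi> g * \<delta> h"
      using W(2)[OF gh(1)] by (simp add: fox_eval_append e \<delta>_def)
  next
    fix i assume i: "i < d"
    have "\<delta> (x i) = ?D [(i, False)]"
      unfolding \<delta>_def by (rule wd) (use W[OF x] x i in \<open>simp_all add: letter_val_def\<close>)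
    then show "\<delta> (x i) = a i" by (simp add: fox_eval_Cons)
  qed
qed

lemma sum_fun_apply: "(\<Sum>v\<in>A. F v) x = (\<Sum>v\<in>A. F v x)"
  by (induction A rule: infinite_finite_induct) auto

text \<open>A basis of the span of S together with e is independent, so the values of a functional
  may be prescribed on it.\<close>

lemma exists_linear_functional_vanishing:
  fixes S :: "(nat \<Rightarrow> 'k::field) set" and e :: "nat \<Rightarrow> 'k"
  assumes "e \<notin> Modules.module.span (\<lambda>r v i. r * v i) S"
  shows "\<exists>f. Vector_Spaces.linear (\<lambda>r v i. r * v i) (*) f \<and> (\<forall>v\<in>S. f v = 0) \<and> f e = 1"
proof -
  interpret V: vector_space "\<lambda>(r::'k) (v::nat \<Rightarrow> 'k) i. r * v i"
    by unfold_locales (auto simp: algebra_simps fun_eq_iff)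
  interpret K: vector_space "(*) :: 'k \<Rightarrow> 'k \<Rightarrow> 'k"
    by unfold_locales (auto simp: algebra_simps)
  interpret P: vector_space_pair "\<lambda>(r::'k) (v::nat \<Rightarrow> 'k) i. r * v i" "(*) :: 'k \<Rightarrow> 'k \<Rightarrow> 'k" ..
  obtain B where B: "B \<subseteq> S" "V.independent B" "S \<subseteq> V.span B"
    using V.maximal_independent_subset[of S] by blast
  have sp: "V.span S = V.span B"
    by (intro equalityI V.span_mono B(1) V.span_minimal B(3) V.subspace_span)
  have e: "e \<notin> V.span B" using assms sp by simp
  then have ind: "V.independent (insert e B)" using B(2) V.independent_insert by auto
  obtain f where f: "Vector_Spaces.linear (\<lambda>r v i. r * v i) (*) f" "\<forall>v\<in>insert e B. f v = (if v = e then 1 else 0)"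
    using P.linear_independent_extend[OF ind, of "\<lambda>v. if v = e then 1 else 0"] by auto
  interpret f: Vector_Spaces.linear "\<lambda>(r::'k) (v::nat \<Rightarrow> 'k) i. r * v i" "(*) :: 'k \<Rightarrow> 'k \<Rightarrow> 'k" f by (rule f)
  have "e \<notin> B" using e V.span_base by blast
  then have fB: "f v = 0" if "v \<in> B" for v using f(2) that by auto
  have "f v = 0" if "v \<in> V.span B" for v
    using that
  proof (induction rule: V.span_induct_alt)
    case base
    show ?case by (rule f.zero)
  next
    case (step c x y)
    then show ?case by (simp only: f.add f.scale fB) simp
  qed
  then show ?thesis using f B(3) by (intro exI[of _ f]) auto
qed

lemma exists_prime_not_dvd_poly:
  fixes f :: "int poly"
  assumes "f \<noteq> 0"
  shows "\<exists>p::nat. Factorial_Ring.prime p \<and> \<not> [:int p:] dvd f"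
proof -
  let ?c = "Polynomial.coeff f (Polynomial.degree f)"
  obtain p :: nat where p: "Factorial_Ring.prime p" "nat \<bar>?c\<bar> < p" using bigger_prime by blast
  have "\<not> [:int p:] dvd f"
  proof
    assume "[:int p:] dvd f"
    then have "int p dvd ?c" by (simp add: const_poly_dvd_iff)
    then have "\<bar>int p\<bar> \<le> \<bar>?c\<bar>" by (intro dvd_imp_le_int) (use assms in auto)
    then show False using p(2) by linarith
  qed
  then show ?thesis using p(1) by blast
qed

lemma prime_const_poly:
  assumes "Factorial_Ring.prime (p::nat)"
  shows "prime_elem [:int p:]"
  using assms by (auto simp: prime_elem_const_poly_iff intro!: prime_imp_prime_elem)

text \<open>If the relators leave no derivation vanishing on \<open>x k\<close>, then finitely many of them span, and
  clearing denominators shows that they still do so modulo almost every prime.\<close>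

lemma fox_rows_injective_mod_prime:
  assumes G: "group G" and \<phi>: "\<phi> \<in> hom G integer_group" and x: "\<And>i. x i \<in> carrier G"
    and gen: "\<forall>g\<in>carrier G. \<exists>w. letters_below d w \<and> word_val G x w = g" and k: "k < d"
    and rigid: "\<And>\<delta>. (\<forall>g\<in>carrier G. \<forall>h\<in>carrier G. \<delta> (g \<otimes>\<^bsub>G\<^esub> h) = \<delta> g + tK powi \<phi> g * \<delta> h) \<Longrightarrow>
       \<delta> (x k) = 0 \<Longrightarrow> \<forall>g\<in>carrier G. \<delta> g = 0"
  shows "\<exists>ws (p::nat). set ws \<subseteq> relators G x d \<and> Factorial_Ring.prime p \<and>
    (\<forall>(M::nat) c. (\<forall>w\<in>set ws. \<forall>(m,u,j)\<in>set (fox w). 0 \<le> int M + word_exp (\<lambda>i. \<phi> (x i)) u) \<longrightarrow>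
      [:int p:] dvd c k \<longrightarrow>
      (\<forall>w\<in>set ws. [:int p:] dvd (\<Sum>(m,u,j)\<leftarrow>fox w. Polynomial.monom m (nat (int M + word_exp (\<lambda>i. \<phi> (x i)) u)) * c j)) \<longrightarrow>
      (\<forall>i<d. [:int p:] dvd c i))"
proof -
  let ?e = "\<lambda>i. \<phi> (x i)"
  interpret V: vector_space "\<lambda>(r::int poly fract) (v::nat \<Rightarrow> int poly fract) i. r * v i"
    by unfold_locales (auto simp: algebra_simps fun_eq_iff)
  define rowv where "rowv w = (\<lambda>j. \<Sum>(m,u,j')\<leftarrow>fox w. if j' = j then of_int m * tK powi word_exp ?e u else 0)" for w
  define unit :: "nat \<Rightarrow> nat \<Rightarrow> int poly fract" where "unit i = (\<lambda>j. of_bool (j = i))" for i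
  define S where "S = rowv ` relators G x d \<union> {unit k}"
  \<comment> \<open>A unit vector outside the span would be separated from it by a functional. The
    values of the functional on the unit vectors solve all relators and vanish at k, and so they
    define a derivation that contradicts \<open>rigid\<close>.\<close>
  have span: "unit i \<in> V.span S" if i: "i < d" for i
  proof (rule ccontr)
    assume "unit i \<notin> V.span S"
    from exists_linear_functional_vanishing[OF this] obtain f where
      f: "Vector_Spaces.linear (\<lambda>r v i. r * v i) (*) f" "\<forall>v\<in>S. f v = 0" "f (unit i) = 1" by blast
    interpret f: Vector_Spaces.linear "\<lambda>(r::int poly fract) (v::nat \<Rightarrow> int poly fract) i. r * v i" "(*)" f by (rule f(1))
    define a where "a j = f (unit j)" for j
    have fr: "f (\<lambda>j. \<Sum>(m,u,j')\<leftarrow>r. if j' = j then of_int m * tK powi word_exp ?e u else 0)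
       = (\<Sum>(m,u,j)\<leftarrow>r. of_int m * tK powi word_exp ?e u * a j)" for r
    proof (induction r)
      case Nil
      show ?case using f.zero by (simp add: zero_fun_def)
    next
      case (Cons t r)
      obtain m u j' where t: "t = (m,u,j')" by (cases t) auto
      let ?C = "of_int m * tK powi word_exp ?e u"
      let ?R = "\<lambda>j. \<Sum>(m,u,j')\<leftarrow>r. if j' = j then of_int m * tK powi word_exp ?e u else 0"
      have "(\<lambda>j. \<Sum>(m,u,j')\<leftarrow>t # r. if j' = j then of_int m * tK powi word_exp ?e u else 0)
          = (\<lambda>j. ?C * unit j' j) + ?R"
        by (auto simp: t unit_def fun_eq_iff)
      then have "f (\<lambda>j. \<Sum>(m,u,j')\<leftarrow>t # r. if j' = j then of_int m * tK powi word_exp ?e u else 0) = ?C * f (unit j') + f ?R"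
        by (simp only: f.add f.scale)
      then show ?case using Cons by (simp add: t a_def)
    qed
    have "fox_eval ?e a w = 0" if "w \<in> relators G x d" for w
      using fr[of "fox w"] f(2) that unfolding fox_eval_def S_def rowv_def by simp
    from derivation_of_relator_solution[OF G \<phi> x gen this] obtain \<delta> where
      \<delta>: "\<forall>g\<in>carrier G. \<forall>h\<in>carrier G. \<delta> (g \<otimes>\<^bsub>G\<^esub> h) = \<delta> g + tK powi \<phi> g * \<delta> h" "\<forall>i<d. \<delta> (x i) = a i" by blast
    have "\<delta> (x k) = 0" using \<delta>(2) k f(2) by (simp add: a_def S_def)
    with rigid[OF \<delta>(1)] x have "\<delta> (x i) = 0" by blast
    then show False using \<delta>(2) i f(3) by (simp add: a_def)
  qed
  have "\<forall>i\<in>{..<d}. \<exists>Tu. finite (fst Tu) \<and> fst Tu \<subseteq> S \<and> unit i = (\<Sum>v\<in>fst Tu. (\<lambda>j. snd Tu v * v j))"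
  proof
    fix i assume "i \<in> {..<d}"
    then have "unit i \<in> V.span S" using span by simp
    then obtain T u where "finite T" "T \<subseteq> S" "unit i = (\<Sum>v\<in>T. (\<lambda>j. u v * v j))"
      unfolding V.span_explicit by blast
    then show "\<exists>Tu. finite (fst Tu) \<and> fst Tu \<subseteq> S \<and> unit i = (\<Sum>v\<in>fst Tu. (\<lambda>j. snd Tu v * v j))"
      by (intro exI[of _ "(T, u)"]) simp
  qed
  from bchoice[OF this] obtain Tu where Tu: "\<forall>i\<in>{..<d}. finite (fst (Tu i)) \<and> fst (Tu i) \<subseteq> S \<and>
      unit i = (\<Sum>v\<in>fst (Tu i). (\<lambda>j. snd (Tu i) v * v j))" ..
  define T where "T i = fst (Tu i)" for i
  define u where "u i = snd (Tu i)" for i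
  have T: "finite (T i)" "T i \<subseteq> S" "unit i = (\<Sum>v\<in>T i. (\<lambda>j. u i v * v j))" if "i < d" for i
    using Tu that unfolding T_def u_def by blast+
  have "\<forall>i\<in>{..<d}. \<exists>fh. fst fh \<noteq> 0 \<and> (\<forall>v\<in>T i. to_fract (fst fh) * u i v = to_fract (snd fh v))"
  proof
    fix i assume "i \<in> {..<d}"
    then have "finite (T i)" using T(1) by simp
    from fract_common_denominator[OF this, of "u i"] obtain f h where
      "f \<noteq> 0" "\<forall>v\<in>T i. to_fract f * u i v = to_fract (h v)" by blast
    then show "\<exists>fh. fst fh \<noteq> 0 \<and> (\<forall>v\<in>T i. to_fract (fst fh) * u i v = to_fract (snd fh v))"
      by (intro exI[of _ "(f, h)"]) simp
  qed
  from bchoice[OF this] obtain fh where fh: "\<forall>i\<in>{..<d}. fst (fh i) \<noteq> 0 \<and>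
      (\<forall>v\<in>T i. to_fract (fst (fh i)) * u i v = to_fract (snd (fh i) v))" ..
  define F where "F i = fst (fh i)" for i
  define H where "H i = snd (fh i)" for i
  have FH: "F i \<noteq> 0" "v \<in> T i \<Longrightarrow> to_fract (F i) * u i v = to_fract (H i v)" if "i < d" for i v
    using fh that unfolding F_def H_def by blast+
  have "finite (\<Union>i<d. T i - {unit k})" "(\<Union>i<d. T i - {unit k}) \<subseteq> rowv ` relators G x d"
    using T(1,2) by (auto simp: S_def)
  then obtain W where W: "W \<subseteq> relators G x d" "finite W" "(\<Union>i<d. T i - {unit k}) = rowv ` W"
    by (meson finite_subset_image)
  obtain ws where ws: "set ws = W" using W(2) finite_list by blast
  have "(\<Prod>i<d. F i) \<noteq> 0" using FH(1) by auto
  \<comment> \<open>A prime that avoids the common denominators of the finitely many coefficients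
    lets the expressions of the unit vectors survive reduction.\<close>
  then obtain p :: nat where p: "Factorial_Ring.prime p" "\<not> [:int p:] dvd (\<Prod>i<d. F i)"
    using exists_prime_not_dvd_poly by blast
  have pe: "prime_elem [:int p:]" by (rule prime_const_poly[OF p(1)])
  have pF: "\<not> [:int p:] dvd F i" if "i < d" for i
    using p(2) dvd_prodI[of "{..<d}" i F] that by (meson dvd_trans finite_lessThan lessThan_iff)
  show ?thesis
  proof (intro exI[of _ ws] exI[of _ p] conjI allI impI)
    show "set ws \<subseteq> relators G x d" using ws W by simp
    show "Factorial_Ring.prime p" by (rule p(1))
  next
    fix M :: nat and c :: "nat \<Rightarrow> int poly" and i
    assume M: "\<forall>w\<in>set ws. \<forall>(m,u,j)\<in>set (fox w). 0 \<le> int M + word_exp ?e u"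
      and ck: "[:int p:] dvd c k"
      and rows: "\<forall>w\<in>set ws. [:int p:] dvd (\<Sum>(m,u,j)\<leftarrow>fox w. Polynomial.monom m (nat (int M + word_exp ?e u)) * c j)"
      and i: "i < d"
    \<comment> \<open>The value of a row on the vector with entries \<open>c j\<close>.
      Multiplication by t^M makes the values of the relator rows polynomial, since by hypothesis M
      compensates all negative exponents.\<close>
    define g where "g v = (\<Sum>j<d. v j * to_fract (c j))" for v
    have g_unit: "g (unit j) = to_fract (c j)" if "j < d" for j
    proof -
      have "g (unit j) = (\<Sum>j'<d. if j' = j then to_fract (c j) else 0)"
        unfolding g_def unit_def by (intro sum.cong refl) auto
      then show ?thesis using that by simp
    qed
    have g_row: "tK ^ M * g (rowv w) = to_fract (\<Sum>(m,u,j)\<leftarrow>fox w. Polynomial.monom m (nat (int M + word_exp ?e u)) * c j)"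
      if w: "w \<in> set ws" for w
    proof -
      have lb: "letters_below d w" using w ws W(1) by (auto simp: relators_def)
      have "tK ^ M * (\<Sum>j<d. (\<Sum>(m,u,j')\<leftarrow>r. if j' = j then of_int m * tK powi word_exp ?e u else 0) * to_fract (c j))
         = to_fract (\<Sum>(m,u,j)\<leftarrow>r. Polynomial.monom m (nat (int M + word_exp ?e u)) * c j)"
        if "set r \<subseteq> set (fox w)" for r
        using that
      proof (induction r)
        case (Cons t r)
        obtain m u j' where t: "t = (m,u,j')" by (cases t) auto
        have tw: "(m,u,j') \<in> set (fox w)" using Cons.prems t by simp
        have j': "j' < d" using fox_letters[OF lb tw] by simp
        have "0 \<le> int M + word_exp ?e u" using M w tw by blast
        then have "tK ^ nat (int M + word_exp ?e u) = tK powi (int M + word_exp ?e u)"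
          by (simp add: power_int_def)
        also have "\<dots> = tK ^ M * tK powi word_exp ?e u" by (simp add: power_int_add)
        finally have mm: "to_fract (Polynomial.monom m (nat (int M + word_exp ?e u))) = tK ^ M * (of_int m * tK powi word_exp ?e u)"
          by (simp add: to_fract_monom)
        let ?C = "of_int m * tK powi word_exp ?e u"
        let ?r = "\<lambda>j. \<Sum>(m,u,j')\<leftarrow>r. if j' = j then of_int m * tK powi word_exp ?e u else 0"
        have "(\<Sum>j<d. (\<Sum>(m,u,j')\<leftarrow>t # r. if j' = j then of_int m * tK powi word_exp ?e u else 0) * to_fract (c j))
           = (\<Sum>j<d. (if j' = j then ?C * to_fract (c j) else 0) + ?r j * to_fract (c j))"
          by (intro sum.cong refl) (simp add: t distrib_right)
        also have "\<dots> = ?C * to_fract (c j') + (\<Sum>j<d. ?r j * to_fract (c j))"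
          using j' by (simp add: sum.distrib)
        finally show ?case using Cons by (simp add: t distrib_left mm mult.assoc)
      qed simp
      then show ?thesis unfolding g_def rowv_def by blast
    qed
    have "\<exists>q. tK ^ M * g v = to_fract ([:int p:] * q)" if v: "v \<in> T i" for v
    proof (cases "v = unit k")
      case True
      have "tK ^ M * g v = to_fract (Polynomial.monom 1 M * c k)"
        using True g_unit[OF k] to_fract_monom[of 1 M] by simp
      moreover have "[:int p:] dvd Polynomial.monom 1 M * c k" using ck by simp
      moreover from calculation(2) obtain q where "Polynomial.monom 1 M * c k = [:int p:] * q" by (rule dvdE)
      ultimately show ?thesis by (intro exI[of _ q]) (simp only:)
    next
      case False
      then have "v \<in> rowv ` W" using W(3) v i by blast
      then obtain w where w: "w \<in> set ws" "v = rowv w" using ws by auto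
      have "[:int p:] dvd (\<Sum>(m,u,j)\<leftarrow>fox w. Polynomial.monom m (nat (int M + word_exp ?e u)) * c j)"
        using rows w(1) by blast
      then obtain q where q: "(\<Sum>(m,u,j)\<leftarrow>fox w. Polynomial.monom m (nat (int M + word_exp ?e u)) * c j) = [:int p:] * q"
        by (rule dvdE)
      show ?thesis unfolding w(2) g_row[OF w(1)] q by (rule exI[of _ q], rule refl)
    qed
    then have "\<forall>v\<in>T i. \<exists>q. tK ^ M * g v = to_fract ([:int p:] * q)" by blast
    from bchoice[OF this] obtain q where q: "\<And>v. v \<in> T i \<Longrightarrow> tK ^ M * g v = to_fract ([:int p:] * q v)" by blast
    have "to_fract (c i) = (\<Sum>j<d. (\<Sum>v\<in>T i. u i v * v j) * to_fract (c j))"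
      unfolding g_unit[OF i, symmetric] g_def
      by (intro sum.cong refl) (simp add: T(3)[OF i] sum_fun_apply)
    also have "\<dots> = (\<Sum>v\<in>T i. u i v * g v)"
      unfolding g_def sum_distrib_left sum_distrib_right by (subst sum.swap) (simp add: mult.assoc)
    finally have ci: "to_fract (c i) = (\<Sum>v\<in>T i. u i v * g v)" .
    have "to_fract (F i * (Polynomial.monom 1 M * c i)) = (\<Sum>v\<in>T i. (to_fract (F i) * u i v) * (tK ^ M * g v))"
      using to_fract_monom[of 1 M] by (simp add: ci sum_distrib_left mult_ac)
    also have "\<dots> = (\<Sum>v\<in>T i. to_fract (H i v * ([:int p:] * q v)))"
      by (intro sum.cong refl) (simp only: FH(2)[OF i] q to_fract_mult)
    also have "\<dots> = to_fract ([:int p:] * (\<Sum>v\<in>T i. H i v * q v))"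
      unfolding to_fract_sum[symmetric] sum_distrib_left by (simp only: mult_ac)
    finally have "F i * (Polynomial.monom 1 M * c i) = [:int p:] * (\<Sum>v\<in>T i. H i v * q v)"
      by (simp only: to_fract_eq_iff)
    then have "[:int p:] dvd F i * (Polynomial.monom 1 M * c i)" by (simp only: dvd_triv_left)
    \<comment> \<open>The constant p is prime in Z[t] and divides neither the denominator
      \<open>F i\<close> nor a power of t, so it has to divide \<open>c i\<close>.\<close>
    then have "[:int p:] dvd Polynomial.monom 1 M * c i" using pF[OF i] prime_elem_dvd_mult_iff[OF pe] by blast
    moreover have "\<not> [:int p:] dvd Polynomial.monom 1 M"
    proof
      assume "[:int p:] dvd Polynomial.monom 1 M"
      then have "int p dvd Polynomial.coeff (Polynomial.monom 1 M) M" unfolding const_poly_dvd_iff by blast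
      then show False using prime_gt_1_nat[OF p(1)] by simp
    qed
    ultimately show "[:int p:] dvd c i" using prime_elem_dvd_mult_iff[OF pe] by blast
  qed
qed

lemma sum_list_map_neutral: "(\<And>t. t \<in> set r \<Longrightarrow> F t = (0::int)) \<Longrightarrow> (\<Sum>t\<leftarrow>r. F t) = 0"
  by (induction r) auto

section \<open>Fox rows as operators over a finite group\<close>

lemma sum_cartesian_list:
  fixes f :: "nat \<times> 'g \<Rightarrow> int"
  assumes r: "\<And>c u i. (c,u,i) \<in> set r \<Longrightarrow> i < d" and G: "group G" and fin: "finite (carrier G)"
    and y: "\<And>i. y i \<in> carrier G" and g: "g \<in> carrier G"
  shows "(\<Sum>(i,g')\<in>{..<d} \<times> carrier G. formal_eval G y (row_entry r i) g g' * f (i,g'))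
     = (\<Sum>(c,u,i)\<leftarrow>r. c * f (i, inv\<^bsub>G\<^esub> (word_val G y u) \<otimes>\<^bsub>G\<^esub> g))"
  using r
proof (induction r)
  case Nil
  show ?case by (simp add: row_entry_def)
next
  case (Cons t r)
  interpret G: group G by (rule G)
  obtain c u j where t: "t = (c,u,j)" by (cases t) auto
  let ?u = "word_val G y u"
  have u: "?u \<in> carrier G" using y by simp
  have j: "j < d" by (rule Cons.prems[of c u]) (simp add: t)
  have e: "g = ?u \<otimes>\<^bsub>G\<^esub> g' \<longleftrightarrow> g' = inv\<^bsub>G\<^esub> ?u \<otimes>\<^bsub>G\<^esub> g" if "g' \<in> carrier G" for g'
    using that g u by (metis G.inv_closed G.inv_solve_left)
  have re: "row_entry (t # r) i = (if j = i then (c,u) # row_entry r i else row_entry r i)" for i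
    by (simp add: row_entry_def t)
  have "(\<Sum>(i,g')\<in>{..<d} \<times> carrier G. formal_eval G y (row_entry (t # r) i) g g' * f (i,g'))
     = (\<Sum>(i,g')\<in>{..<d} \<times> carrier G. (if (i,g') = (j, inv\<^bsub>G\<^esub> ?u \<otimes>\<^bsub>G\<^esub> g) then c * f (j, inv\<^bsub>G\<^esub> ?u \<otimes>\<^bsub>G\<^esub> g) else 0)
          + formal_eval G y (row_entry r i) g g' * f (i,g'))"
    by (intro sum.cong refl) (auto simp: re e distrib_right)
  also have "\<dots> = (\<Sum>z\<in>{..<d} \<times> carrier G. (if z = (j, inv\<^bsub>G\<^esub> ?u \<otimes>\<^bsub>G\<^esub> g) then c * f (j, inv\<^bsub>G\<^esub> ?u \<otimes>\<^bsub>G\<^esub> g) else 0))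
      + (\<Sum>(i,g')\<in>{..<d} \<times> carrier G. formal_eval G y (row_entry r i) g g' * f (i,g'))"
    unfolding sum.distrib[symmetric] by (intro sum.cong refl) auto
  also have "(\<Sum>z\<in>{..<d} \<times> carrier G. (if z = (j, inv\<^bsub>G\<^esub> ?u \<otimes>\<^bsub>G\<^esub> g) then c * f (j, inv\<^bsub>G\<^esub> ?u \<otimes>\<^bsub>G\<^esub> g) else 0))
     = c * f (j, inv\<^bsub>G\<^esub> ?u \<otimes>\<^bsub>G\<^esub> g)"
    using fin j u g by (subst sum.delta) auto
  also have "(\<Sum>(i,g')\<in>{..<d} \<times> carrier G. formal_eval G y (row_entry r i) g g' * f (i,g'))
     = (\<Sum>(c,u,i)\<leftarrow>r. c * f (i, inv\<^bsub>G\<^esub> (word_val G y u) \<otimes>\<^bsub>G\<^esub> g))"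
  proof (rule Cons.IH)
    fix c u i assume "(c,u,i) \<in> set r"
    then show "i < d" using Cons.prems[of c u i] by simp
  qed
  finally show ?case by (simp add: t)
qed

lemma row_matrix_apply:
  fixes f :: "nat \<times> 'g \<Rightarrow> int"
  assumes G: "group G" and fin: "finite (carrier G)" and y: "\<And>i. y i \<in> carrier G"
    and w: "letters_below d (ws ! q)" and q: "q < length ws" and g: "g \<in> carrier G"
  shows "(\<Sum>z\<in>{..<d} \<times> carrier G. row_matrix G y (map fox ws) (q,g) z * f z)
     = (\<Sum>(c,u,i)\<leftarrow>fox (ws ! q). c * f (i, inv\<^bsub>G\<^esub> (word_val G y u) \<otimes>\<^bsub>G\<^esub> g))"
proof -
  have "(\<Sum>z\<in>{..<d} \<times> carrier G. row_matrix G y (map fox ws) (q,g) z * f z)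
     = (\<Sum>(i,g')\<in>{..<d} \<times> carrier G. formal_eval G y (row_entry (fox (ws ! q)) i) g g' * f (i,g'))"
    by (intro sum.cong refl) (auto simp: row_matrix_def q)
  also have "\<dots> = (\<Sum>(c,u,i)\<leftarrow>fox (ws ! q). c * f (i, inv\<^bsub>G\<^esub> (word_val G y u) \<otimes>\<^bsub>G\<^esub> g))"
    by (rule sum_cartesian_list[OF _ G fin y g]) (use fox_letters[OF w] in blast)
  finally show ?thesis .
qed

text \<open>Derivations with values in functions on a group, acted on by left translation along \<open>\<rho>\<close>.\<close>

lemma fox_derivation:
  fixes D :: "'a \<Rightarrow> 'g \<Rightarrow> int"
  assumes G: "group G" and P: "group P" and \<rho>: "\<rho> \<in> hom G P" and x: "\<And>i. x i \<in> carrier G"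
    and D: "\<And>g h z. g \<in> carrier G \<Longrightarrow> h \<in> carrier G \<Longrightarrow> z \<in> carrier P \<Longrightarrow>
       D (g \<otimes>\<^bsub>G\<^esub> h) z = D g z + D h (inv\<^bsub>P\<^esub> (\<rho> g) \<otimes>\<^bsub>P\<^esub> z)"
  shows "z \<in> carrier P \<Longrightarrow> (\<Sum>(c,u,i)\<leftarrow>fox w. c * D (x i) (inv\<^bsub>P\<^esub> (word_val P (\<lambda>i. \<rho> (x i)) u) \<otimes>\<^bsub>P\<^esub> z)) = D (word_val G x w) z"
proof (induction w arbitrary: z)
  interpret G: group G by (rule G)
  interpret P: group P by (rule P)
  interpret \<rho>: group_hom G P \<rho> using G P \<rho> by (simp add: group_hom_def group_hom_axioms_def)
  have D1: "D \<one>\<^bsub>G\<^esub> z = 0" if "z \<in> carrier P" for z using D[of "\<one>\<^bsub>G\<^esub>" "\<one>\<^bsub>G\<^esub>" z] that by simp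
  {
    case Nil
    then show ?case using D1 by simp
  next
    case (Cons l w)
    let ?y = "\<lambda>i. \<rho> (x i)"
    have y: "?y i \<in> carrier P" for i using x by simp
    let ?l = "letter_val P ?y l"
    have l: "?l \<in> carrier P" using P.letter_val_closed[of ?y] y by simp
    have lG: "letter_val G x l \<in> carrier G" using x by simp
    have rl: "\<rho> (letter_val G x l) = ?l" using x by (simp add: letter_val_def)
    \<comment> \<open>Prefixing the letter l to all words shifts the argument by its inverse, which
      is the action that appears in the rule for D.\<close>
    have tail: "(\<Sum>(c,u,i)\<leftarrow>map (\<lambda>(c,u,j). (c, l # u, j)) r. c * D (x i) (inv\<^bsub>P\<^esub> (word_val P ?y u) \<otimes>\<^bsub>P\<^esub> z))
       = (\<Sum>(c,u,i)\<leftarrow>r. c * D (x i) (inv\<^bsub>P\<^esub> (word_val P ?y u) \<otimes>\<^bsub>P\<^esub> (inv\<^bsub>P\<^esub> ?l \<otimes>\<^bsub>P\<^esub> z)))" for r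
    proof (induction r)
      case (Cons t r)
      obtain c u i where t: "t = (c,u,i)" by (cases t) auto
      have "inv\<^bsub>P\<^esub> (?l \<otimes>\<^bsub>P\<^esub> word_val P ?y u) \<otimes>\<^bsub>P\<^esub> z = inv\<^bsub>P\<^esub> (word_val P ?y u) \<otimes>\<^bsub>P\<^esub> (inv\<^bsub>P\<^esub> ?l \<otimes>\<^bsub>P\<^esub> z)"
        using l y \<open>z \<in> carrier P\<close> by (simp add: P.inv_mult_group P.m_assoc)
      then show ?case using Cons by (simp add: t)
    qed simp
    have lz: "inv\<^bsub>P\<^esub> ?l \<otimes>\<^bsub>P\<^esub> z \<in> carrier P" using l Cons.prems by simp
    have step: "D (word_val G x (l # w)) z = D (letter_val G x l) z + D (word_val G x w) (inv\<^bsub>P\<^esub> ?l \<otimes>\<^bsub>P\<^esub> z)"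
      using D[OF lG _ Cons.prems, of "word_val G x w"] x by (simp add: rl)
    have head: "D (letter_val G x l) z = (if snd l then - D (x (fst l)) (?y (fst l) \<otimes>\<^bsub>P\<^esub> z) else D (x (fst l)) z)"
    proof (cases "snd l")
      case True
      have "D (inv\<^bsub>G\<^esub> (x (fst l)) \<otimes>\<^bsub>G\<^esub> x (fst l)) z = D (inv\<^bsub>G\<^esub> (x (fst l))) z + D (x (fst l)) (?y (fst l) \<otimes>\<^bsub>P\<^esub> z)"
        using D[of "inv\<^bsub>G\<^esub> (x (fst l))" "x (fst l)" z] x Cons.prems y by simp
      then show ?thesis using True D1[OF Cons.prems] x by (simp add: letter_val_def)
    qed (simp add: letter_val_def)
    have t2: "(\<Sum>(c,u,i)\<leftarrow>map (\<lambda>(c,u,j). (c, l # u, j)) (fox w). c * D (x i) (inv\<^bsub>P\<^esub> (word_val P ?y u) \<otimes>\<^bsub>P\<^esub> z))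
        = D (word_val G x w) (inv\<^bsub>P\<^esub> ?l \<otimes>\<^bsub>P\<^esub> z)"
      unfolding tail by (rule Cons.IH[OF lz])
    have "(\<Sum>(c,u,i)\<leftarrow>fox (l # w). c * D (x i) (inv\<^bsub>P\<^esub> (word_val P ?y u) \<otimes>\<^bsub>P\<^esub> z))
       = (case (if snd l then (- 1, [l], fst l) else (1, [], fst l)) of (c,u,i) \<Rightarrow> c * D (x i) (inv\<^bsub>P\<^esub> (word_val P ?y u) \<otimes>\<^bsub>P\<^esub> z))
         + D (word_val G x w) (inv\<^bsub>P\<^esub> ?l \<otimes>\<^bsub>P\<^esub> z)"
      unfolding fox.simps list.map sum_list.Cons t2 ..
    also have "\<dots> = (if snd l then - D (x (fst l)) (?y (fst l) \<otimes>\<^bsub>P\<^esub> z) else D (x (fst l)) z) + D (word_val G x w) (inv\<^bsub>P\<^esub> ?l \<otimes>\<^bsub>P\<^esub> z)"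
      using Cons.prems y by (simp add: letter_val_def)
    finally have "(\<Sum>(c,u,i)\<leftarrow>fox (l # w). c * D (x i) (inv\<^bsub>P\<^esub> (word_val P ?y u) \<otimes>\<^bsub>P\<^esub> z))
       = (if snd l then - D (x (fst l)) (?y (fst l) \<otimes>\<^bsub>P\<^esub> z) else D (x (fst l)) z) + D (word_val G x w) (inv\<^bsub>P\<^esub> ?l \<otimes>\<^bsub>P\<^esub> z)" .
    then show ?case unfolding step head .
  }
qed

lemma group_prod_mod: "group P \<Longrightarrow> group (P \<times>\<times> integer_mod_group s)"
  by (intro DirProd_group) auto

text \<open>Vectors supported in a window of \<open>P \<times> \<int>/s\<close> on which no wrap-around occurs.\<close>

lemma window_injective:
  fixes f :: "nat \<times> 'g \<times> int \<Rightarrow> int" and s :: nat and M :: nat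
  assumes P: "group P" and p: "Factorial_Ring.prime p" and ord: "Coset.order P = p ^ n"
    and y: "\<And>i. y i \<in> carrier P"
    and ws: "\<And>w. w \<in> set ws \<Longrightarrow> letters_below d w"
    and M: "\<And>w m u j. w \<in> set ws \<Longrightarrow> (m,u,j) \<in> set (fox w) \<Longrightarrow> \<bar>word_exp e u\<bar> \<le> int M"
    and s: "2 * M < s"
    and inj: "\<And>c. [:int p:] dvd c k \<Longrightarrow>
      (\<And>w. w \<in> set ws \<Longrightarrow> [:int p:] dvd (\<Sum>(m,u,j)\<leftarrow>fox w. Polynomial.monom m (nat (int M + word_exp e u)) * c j)) \<Longrightarrow>
      \<forall>i<d. [:int p:] dvd c i"
    and supp: "\<And>i g m. \<not> (i < d \<and> i \<noteq> k \<and> g \<in> carrier P \<and> int M \<le> m \<and> m < int s - int M) \<Longrightarrow> f (i,(g,m)) = 0"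
    and ker: "\<And>w g m. w \<in> set ws \<Longrightarrow> g \<in> carrier P \<Longrightarrow> m \<in> {0..<int s} \<Longrightarrow>
      (\<Sum>(c,u,i)\<leftarrow>fox w. c * f (i, (inv\<^bsub>P\<^esub> (word_val P y u) \<otimes>\<^bsub>P\<^esub> g, (m - word_exp e u) mod int s))) = 0"
  shows "f z = 0"
proof -
  interpret P: group P by (rule P)
  \<comment> \<open>Since s need not be a power of p, the coordinate in Z/s is moved to the index
    set, and only P acts as a p-group. Column k and the margins are left out.\<close>
  define J where "J = {i. i < d \<and> i \<noteq> k} \<times> {int M..<int s - int M}"
  have J: "finite J" by (auto simp: J_def)
  have p1: "1 < int p" using prime_gt_1_nat[OF p] by simp
  define F where "F = (\<lambda>(g,(i,m)). f (i,(g,m)))"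
  define row where "row w m = map (\<lambda>(c,u,i). (c, word_val P y u, (i, m - word_exp e u))) (fox w)" for w m
  define R where "R = (\<lambda>(w,m). row w m) ` (set ws \<times> {0..<int s})"
  \<comment> \<open>If the shifted position leaves the range from 0 to s - 1, then both it and its
    residue lie outside the window, where f is 0.\<close>
  have wrap: "f (i, (g, (m - a) mod int s)) = f (i, (g, m - a))" if m: "m \<in> {0..<int s}" and a: "\<bar>a\<bar> \<le> int M" for i g m a
  proof (cases "0 \<le> m - a \<and> m - a < int s")
    case True
    then show ?thesis by simp
  next
    case False
    have z: "f (i, (g, m - a)) = 0" by (rule supp) (use False in auto)
    have "\<not> (int M \<le> (m - a) mod int s \<and> (m - a) mod int s < int s - int M)"
    proof (cases "m - a < 0")
      case True
      have "(m - a) mod int s = (m - a + int s) mod int s" by simp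
      also have "\<dots> = m - a + int s" using True m a s by (intro mod_pos_pos_trivial) auto
      finally show ?thesis using m a by auto
    next
      case F2: False
      have "(m - a) mod int s = (m - a - int s) mod int s" by simp
      also have "\<dots> = m - a - int s" using False F2 m a s by (intro mod_pos_pos_trivial) auto
      finally show ?thesis using m a by auto
    qed
    then have "f (i, (g, (m - a) mod int s)) = 0" by (intro supp) auto
    with z show ?thesis by simp
  qed
  have FZ: "F z = 0" for z
  proof (rule p_group_system_injective[OF P p ord J, where R = R])
    fix r m x j assume "r \<in> R" "(m,x,j) \<in> set r"
    then show "x \<in> carrier P" using y by (auto simp: R_def row_def)
  next
    fix z assume "z \<notin> carrier P \<times> J"
    then show "F z = 0" unfolding F_def J_def by (auto split: prod.splits intro!: supp)
  next
    fix r g assume r: "r \<in> R" and g: "g \<in> carrier P"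
    obtain w m where w: "w \<in> set ws" "m \<in> {0..<int s}" "r = row w m" using r by (auto simp: R_def)
    have "row_app P r F g = (\<Sum>(c,u,i)\<leftarrow>fox w. c * f (i, (inv\<^bsub>P\<^esub> (word_val P y u) \<otimes>\<^bsub>P\<^esub> g, (m - word_exp e u) mod int s)))"
      unfolding row_app_def w(3) row_def map_map
    proof (intro arg_cong[of _ _ sum_list] map_cong refl)
      fix t assume t: "t \<in> set (fox w)"
      obtain c u i where tt: "t = (c,u,i)" by (cases t) auto
      show "((\<lambda>(m, x, j). m * F (inv\<^bsub>P\<^esub> x \<otimes>\<^bsub>P\<^esub> g, j)) \<circ> (\<lambda>(c, u, i). (c, word_val P y u, i, m - word_exp e u))) t
         = (case t of (c, u, i) \<Rightarrow> c * f (i, inv\<^bsub>P\<^esub> (word_val P y u) \<otimes>\<^bsub>P\<^esub> g, (m - word_exp e u) mod int s))"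
        using wrap[OF w(2) M[OF w(1)], of c u i i] t tt by (simp add: F_def)
    qed
    then show "row_app P r F g = 0" using ker[OF w(1) g w(2)] by simp
  next
    fix c :: "nat \<times> int \<Rightarrow> int"
    assume c0: "\<And>j. j \<notin> J \<Longrightarrow> c j = 0" and cr: "\<And>r. r \<in> R \<Longrightarrow> int p dvd (\<Sum>(m,x,j)\<leftarrow>r. m * c j)"
    \<comment> \<open>The unknowns of the augmented system become the coefficients of polynomials,
      one for each column. The augmented equations then are the coefficients of the Fox rows applied
      to these polynomials, up to a shift by M.\<close>
    define C where "C i = (\<Sum>m\<in>{0..<s}. Polynomial.monom (c (i, int m)) m)" for i
    have coefC: "Polynomial.coeff (C i) N = c (i, int N)" for i N
    proof -
      have "Polynomial.coeff (C i) N = (\<Sum>m\<in>{0..<s}. if m = N then c (i, int m) else 0)"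
        unfolding C_def Polynomial.coeff_sum by (intro sum.cong refl) auto
      also have "\<dots> = c (i, int N)" using c0[of "(i, int N)"] by (auto simp: J_def)
      finally show ?thesis .
    qed
    \<comment> \<open>If a exceeds N, the position on the right is negative, where c
      vanishes.\<close>
    have mono: "Polynomial.coeff (Polynomial.monom m a * C i) N = m * c (i, int N - int a)" for m a i N
      using c0[of "(i, int N - int a)"]
      by (cases "a \<le> N") (auto simp: Polynomial.coeff_monom_mult coefC J_def of_nat_diff)
    have "[:int p:] dvd C k" unfolding const_poly_dvd_iff coefC using c0 by (auto simp: J_def)
    moreover have "[:int p:] dvd (\<Sum>(m,u,j)\<leftarrow>fox w. Polynomial.monom m (nat (int M + word_exp e u)) * C j)" if w: "w \<in> set ws" for w
      unfolding const_poly_dvd_iff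
    proof
      fix N
      have "Polynomial.coeff (\<Sum>(m,u,j)\<leftarrow>r. Polynomial.monom m (nat (int M + word_exp e u)) * C j) N
         = (\<Sum>(m,u,i)\<leftarrow>r. m * c (i, (int N - int M) - word_exp e u))" if "set r \<subseteq> set (fox w)" for r
        using that
      proof (induction r)
        case (Cons t r)
        obtain m u j where t: "t = (m,u,j)" by (cases t) auto
        have "\<bar>word_exp e u\<bar> \<le> int M" using M[OF w, of m u j] Cons.prems t by simp
        then have "int (nat (int M + word_exp e u)) = int M + word_exp e u" by simp
        then have "Polynomial.coeff (Polynomial.monom m (nat (int M + word_exp e u)) * C j) N = m * c (j, (int N - int M) - word_exp e u)"
          unfolding mono by (simp add: algebra_simps)
        then show ?case using Cons by (simp add: t)
      qed simp
      then have co: "Polynomial.coeff (\<Sum>(m,u,j)\<leftarrow>fox w. Polynomial.monom m (nat (int M + word_exp e u)) * C j) N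
         = (\<Sum>(m,u,i)\<leftarrow>fox w. m * c (i, (int N - int M) - word_exp e u))" by blast
      show "int p dvd Polynomial.coeff (\<Sum>(m,u,j)\<leftarrow>fox w. Polynomial.monom m (nat (int M + word_exp e u)) * C j) N"
      proof (cases "int N - int M \<in> {0..<int s}")
        case True
        then have "row w (int N - int M) \<in> R" using w by (auto simp: R_def)
        from cr[OF this] show ?thesis unfolding co row_def by (simp add: o_def case_prod_unfold)
      next
        \<comment> \<open>There is no equation for a position outside 0, ..., s - 1, but everything
          within distance M of such a position lies outside the window.\<close>
        case False
        have "c (i, (int N - int M) - word_exp e u) = 0" if "(m,u,i) \<in> set (fox w)" for m u i
          by (rule c0) (use M[OF w that] False in \<open>auto simp: J_def\<close>)
        then have "(\<Sum>(m,u,i)\<leftarrow>fox w. m * c (i, (int N - int M) - word_exp e u)) = 0"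
          by (intro sum_list_map_neutral) auto
        then show ?thesis unfolding co by simp
      qed
    qed
    ultimately have "\<forall>i<d. [:int p:] dvd C i" by (rule inj)
    then have "int p dvd c (i, m)" if "(i, m) \<in> J" for i m
    proof -
      have i: "i < d" "m = int (nat m)" using that by (auto simp: J_def)
      have "int p dvd Polynomial.coeff (C i) (nat m)" using \<open>\<forall>i<d. [:int p:] dvd C i\<close> i(1) unfolding const_poly_dvd_iff by blast
      then show ?thesis using i(2) by (simp add: coefC)
    qed
    then show "\<forall>j\<in>J. int p dvd c j" by auto
  qed
  obtain i g m where z: "z = (i,(g,m))" by (cases z) auto
  show ?thesis using FZ[of "(g,(i,m))"] by (simp add: z F_def)
qed

section \<open>Derivations of limit groups\<close>

text \<open>The weights are differences of a function f with f(h x) = \<psi>(h) + f(x) modulo p,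
  hence invariant under H. A path from the identity to h in H has total f(h) - f(1), which is
  \<psi>(h) modulo p.\<close>

lemma lifted_path_sum:
  assumes P: "group P" and p: "0 < p" and fin: "finite (carrier P)" and y: "\<And>i::'i. y i \<in> carrier P"
    and H: "subgroup H P" and \<psi>: "residue_hom (P\<lparr>carrier := H\<rparr>) p \<psi>"
  shows "\<exists>n :: 'i \<Rightarrow> _. (\<forall>i. \<forall>h\<in>H. \<forall>x\<in>carrier P. n i (h \<otimes>\<^bsub>P\<^esub> x) = n i x) \<and>
    (\<forall>w. word_val P y w \<in> H \<longrightarrow> int p dvd (\<Sum>g\<in>carrier P. path_sum P y n \<one>\<^bsub>P\<^esub> w g) - \<psi> (word_val P y w))"
proof -
  interpret P: group P by (rule P)
  interpret H: subgroup H P by (rule H)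
  obtain f where f: "\<forall>h\<in>H. \<forall>x\<in>carrier P. f (h \<otimes>\<^bsub>P\<^esub> x) = (\<psi> h + f x) mod int p"
    using coset_extension_of_residue_hom[OF P H \<psi>] by blast
  define n where "n i x = (f (x \<otimes>\<^bsub>P\<^esub> y i) - f x) mod int p" for i x
  have inv: "n i (h \<otimes>\<^bsub>P\<^esub> x) = n i x" if h: "h \<in> H" and x: "x \<in> carrier P" for i h x
  proof -
    have hc: "h \<in> carrier P" using h H.subset by blast
    have "f (h \<otimes>\<^bsub>P\<^esub> x \<otimes>\<^bsub>P\<^esub> y i) = (\<psi> h + f (x \<otimes>\<^bsub>P\<^esub> y i)) mod int p"
      using f h x y hc by (simp add: P.m_assoc)
    moreover have "f (h \<otimes>\<^bsub>P\<^esub> x) = (\<psi> h + f x) mod int p" using f h x by blast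
    ultimately have "n i (h \<otimes>\<^bsub>P\<^esub> x) = ((\<psi> h + f (x \<otimes>\<^bsub>P\<^esub> y i)) mod int p - (\<psi> h + f x) mod int p) mod int p"
      unfolding n_def by (simp only:)
    also have "\<dots> = ((\<psi> h + f (x \<otimes>\<^bsub>P\<^esub> y i)) - (\<psi> h + f x)) mod int p" by (rule mod_diff_eq)
    finally show ?thesis by (simp add: n_def)
  qed
  have tot: "int p dvd (\<Sum>g\<in>carrier P. path_sum P y n \<one>\<^bsub>P\<^esub> w g) - \<psi> (word_val P y w)" if w: "word_val P y w \<in> H" for w
  proof -
    let ?v = "word_val P y w"
    have d: "int p dvd n i x - (f (x \<otimes>\<^bsub>P\<^esub> y i) - f x)" for i x
      unfolding n_def by (metis dvd_diff_commute dvd_minus_mod)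
    have "int p dvd (\<Sum>g\<in>carrier P. path_sum P y n \<one>\<^bsub>P\<^esub> w g) - (f (\<one>\<^bsub>P\<^esub> \<otimes>\<^bsub>P\<^esub> ?v) - f \<one>\<^bsub>P\<^esub>)"
      by (rule P.path_sum_total[where f = f and n = n and y = y, OF y fin d P.one_closed])
    moreover have "f (?v \<otimes>\<^bsub>P\<^esub> \<one>\<^bsub>P\<^esub>) = (\<psi> ?v + f \<one>\<^bsub>P\<^esub>) mod int p" using f w P.one_closed by blast
    then have "f ?v = (\<psi> ?v + f \<one>\<^bsub>P\<^esub>) mod int p" using y by simp
    then have "int p dvd f ?v - (\<psi> ?v + f \<one>\<^bsub>P\<^esub>)" by (metis dvd_diff_commute dvd_minus_mod)
    ultimately have "int p dvd ((\<Sum>g\<in>carrier P. path_sum P y n \<one>\<^bsub>P\<^esub> w g) - (f (\<one>\<^bsub>P\<^esub> \<otimes>\<^bsub>P\<^esub> ?v) - f \<one>\<^bsub>P\<^esub>)) + (f ?v - (\<psi> ?v + f \<one>\<^bsub>P\<^esub>))"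
      by (intro dvd_add)
    then show ?thesis using y by simp
  qed
  show ?thesis by (rule exI[of _ n]) (use inv tot in blast)
qed

text \<open>The map h assigns to each element a word, multiplicatively up to reduction, and path
  sums ignore reduction; so weights on the edges of the Cayley graph of P that are invariant under
  the image define integral derivations of G. Modulo p their totals are two independent
  homomorphisms, and Nakayama's lemma lifts this independence to the group ring.\<close>

lemma two_independent_derivations:
  fixes h :: "'a \<Rightarrow> (nat \<times> bool) list" and P :: "('c, 'e) monoid_scheme"
  assumes G: "group G" and P: "group P" and p: "Factorial_Ring.prime p" and ord: "Coset.order P = p ^ n"
    and y: "\<And>i. y i \<in> carrier P"
    and h: "\<And>a b. a \<in> carrier G \<Longrightarrow> b \<in> carrier G \<Longrightarrow> h (a \<otimes>\<^bsub>G\<^esub> b) = reduce_word (h a @ h b)"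
    and \<rho>: "\<And>a. \<rho> a = word_val P y (h a)"
    and uv: "u \<in> carrier G" "v \<in> carrier G" "\<rho> u \<otimes>\<^bsub>P\<^esub> \<rho> v \<noteq> \<rho> v \<otimes>\<^bsub>P\<^esub> \<rho> u"
  shows "\<exists>D :: nat \<Rightarrow> 'a \<Rightarrow> _ \<Rightarrow> int.
    (\<forall>j<2. \<forall>a\<in>carrier G. \<forall>b\<in>carrier G. \<forall>z\<in>carrier P. D j (a \<otimes>\<^bsub>G\<^esub> b) z = D j a z + D j b (inv\<^bsub>P\<^esub> (\<rho> a) \<otimes>\<^bsub>P\<^esub> z)) \<and>
    (\<forall>f. (\<forall>a\<in>carrier G. \<forall>z\<in>carrier P. (\<Sum>(j,g)\<in>{..<2} \<times> carrier P. D j a (z \<otimes>\<^bsub>P\<^esub> inv\<^bsub>P\<^esub> g) * f (j,g)) = 0) \<longrightarrow>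
       (\<forall>z\<in>{..<2} \<times> carrier P. f z = 0))"
proof -
  interpret G: group G by (rule G)
  interpret P: group P by (rule P)
  have p0: "0 < p" using prime_gt_0_nat[OF p] .
  have finP: "finite (carrier P)" using ord p0 by (metis P.order_gt_0_iff_finite zero_less_power)
  have \<rho>c: "\<rho> a \<in> carrier P" for a unfolding \<rho> using y by simp
  have \<rho>hom: "\<rho> (a \<otimes>\<^bsub>G\<^esub> b) = \<rho> a \<otimes>\<^bsub>P\<^esub> \<rho> b" if "a \<in> carrier G" "b \<in> carrier G" for a b
    unfolding \<rho> h[OF that] using y by (simp add: P.word_val_reduce P.word_val_append)
  define H where "H = \<rho> ` carrier G"
  have "group_hom G P \<rho>"
    using G P \<rho>c \<rho>hom by (simp add: group_hom_def group_hom_axioms_def hom_def)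
  then have H: "subgroup H P" unfolding H_def by (rule group_hom.img_is_subgroup)
  let ?H = "P\<lparr>carrier := H\<rparr>"
  have gH: "group ?H" using H by (rule P.subgroup_imp_group)
  have "card H dvd p ^ n"
    using P.lagrange[OF H] ord unfolding Coset.order_def by (metis dvd_triv_right)
  then obtain n' where "card H = p ^ n'" using divides_primepow_nat[OF p] by blast
  then have n': "Coset.order ?H = p ^ n'" by (simp add: Coset.order_def)
  have uH: "\<rho> u \<in> carrier ?H" "\<rho> v \<in> carrier ?H" "\<rho> u \<otimes>\<^bsub>?H\<^esub> \<rho> v \<noteq> \<rho> v \<otimes>\<^bsub>?H\<^esub> \<rho> u" using uv by (simp_all add: H_def)
  obtain f1 f2 g1 g2 where fg: "residue_hom ?H p f1" "residue_hom ?H p f2" "g1 \<in> carrier ?H" "g2 \<in> carrier ?H"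
    "\<not> int p dvd f1 g1" "f2 g1 = 0" "\<not> int p dvd f2 g2"
    using nonabelian_p_group_homs[OF gH p n' uH] by blast
  obtain n1 where n1: "\<forall>i. \<forall>h\<in>H. \<forall>x\<in>carrier P. n1 i (h \<otimes>\<^bsub>P\<^esub> x) = n1 i x"
    "\<forall>w. word_val P y w \<in> H \<longrightarrow> int p dvd (\<Sum>g\<in>carrier P. path_sum P y n1 \<one>\<^bsub>P\<^esub> w g) - f1 (word_val P y w)"
    using lifted_path_sum[where y = y, OF P p0 finP y H fg(1)] by (elim exE conjE) (rule that)
  obtain n2 where n2: "\<forall>i. \<forall>h\<in>H. \<forall>x\<in>carrier P. n2 i (h \<otimes>\<^bsub>P\<^esub> x) = n2 i x"
    "\<forall>w. word_val P y w \<in> H \<longrightarrow> int p dvd (\<Sum>g\<in>carrier P. path_sum P y n2 \<one>\<^bsub>P\<^esub> w g) - f2 (word_val P y w)"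
    using lifted_path_sum[where y = y, OF P p0 finP y H fg(2)] by (elim exE conjE) (rule that)
  define N where "N j = (if j = 0 then n1 else n2)" for j :: nat
  define D where "D j a z = path_sum P y (N j) \<one>\<^bsub>P\<^esub> (h a) z" for j a z
  have Ninv: "N j i (h \<otimes>\<^bsub>P\<^esub> x) = N j i x" if "h \<in> H" "x \<in> carrier P" for j i h x
    using n1(1) n2(1) that by (simp add: N_def)
  have law: "D j (a \<otimes>\<^bsub>G\<^esub> b) z = D j a z + D j b (inv\<^bsub>P\<^esub> (\<rho> a) \<otimes>\<^bsub>P\<^esub> z)"
    if ab: "a \<in> carrier G" "b \<in> carrier G" and z: "z \<in> carrier P" for j a b z
  proof -
    have aH: "\<rho> a \<in> H" using ab by (simp add: H_def)
    have "D j (a \<otimes>\<^bsub>G\<^esub> b) z = path_sum P y (N j) \<one>\<^bsub>P\<^esub> (h a) z + path_sum P y (N j) (\<rho> a) (h b) z"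
      unfolding D_def h[OF ab] P.path_sum_reduce[OF y P.one_closed] P.path_sum_append[OF y P.one_closed]
      using \<rho>c by (simp add: \<rho>)
    \<comment> \<open>The starting point is moved back to the identity, which is possible because
      the weights are invariant under the image of a.\<close>
    also have "path_sum P y (N j) (\<rho> a) (h b) z = path_sum P y (N j) (\<rho> a \<otimes>\<^bsub>P\<^esub> \<one>\<^bsub>P\<^esub>) (h b) (\<rho> a \<otimes>\<^bsub>P\<^esub> (inv\<^bsub>P\<^esub> (\<rho> a) \<otimes>\<^bsub>P\<^esub> z))"
      using \<rho>c z by (simp add: P.m_assoc[symmetric])
    also have "\<dots> = path_sum P y (N j) \<one>\<^bsub>P\<^esub> (h b) (inv\<^bsub>P\<^esub> (\<rho> a) \<otimes>\<^bsub>P\<^esub> z)"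
      by (rule P.path_sum_translate[where y = y and n = "N j" and h = "\<rho> a", OF y \<rho>c Ninv[OF aH]]) (use \<rho>c z in auto)
    finally show ?thesis by (simp add: D_def)
  qed
  obtain xs where xs: "set xs = carrier P" "distinct xs" using finite_distinct_list[OF finP] by blast
  \<comment> \<open>The values of both derivations at a, listed as a row over the group ring.
    Substituting g' for x^-1 g turns the action of this row into the convolution with f.\<close>
  define row where "row a = map (\<lambda>x. (D 0 a x, x, 0::nat)) xs @ map (\<lambda>x. (D 1 a x, x, 1)) xs" for a
  have inj: "f z = 0" if f: "\<And>a z. a \<in> carrier G \<Longrightarrow> z \<in> carrier P \<Longrightarrow> (\<Sum>(j,g)\<in>{..<2} \<times> carrier P. D j a (z \<otimes>\<^bsub>P\<^esub> inv\<^bsub>P\<^esub> g) * f (j,g)) = 0"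
    and z: "z \<in> {..<2} \<times> carrier P" for f z
  proof -
    define F where "F = (\<lambda>(g,j). if g \<in> carrier P \<and> j < 2 then f (j,g) else 0)"
    have R1: "x \<in> carrier P" if r: "r \<in> row ` carrier G" "(m,x,j) \<in> set r" for r m x j
    proof -
      obtain a where "r = row a" using r(1) unfolding image_iff by blast
      then have "x \<in> set xs" using r(2) by (auto simp: row_def)
      then show ?thesis by (simp only: xs(1))
    qed
    have supp1: "F z = 0" if "z \<notin> carrier P \<times> {..<2}" for z
    proof (cases z)
      case (Pair g j)
      with that have "\<not> (g \<in> carrier P \<and> j < 2)" by simp
      then show ?thesis unfolding Pair F_def prod.case by (rule if_not_P)
    qed
    have sol1: "row_app P r F g = 0" if r: "r \<in> row ` carrier G" and g: "g \<in> carrier P" for r g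
    proof -
      obtain a where a: "a \<in> carrier G" "r = row a" using r unfolding image_iff by blast
      have re: "(\<Sum>x\<in>carrier P. D j a x * f (j, inv\<^bsub>P\<^esub> x \<otimes>\<^bsub>P\<^esub> g)) = (\<Sum>g'\<in>carrier P. D j a (g \<otimes>\<^bsub>P\<^esub> inv\<^bsub>P\<^esub> g') * f (j,g'))" for j
      proof (rule sum.reindex_bij_witness[where i = "\<lambda>g'. g \<otimes>\<^bsub>P\<^esub> inv\<^bsub>P\<^esub> g'" and j = "\<lambda>x. inv\<^bsub>P\<^esub> x \<otimes>\<^bsub>P\<^esub> g"])
        fix x assume x: "x \<in> carrier P"
        show e: "g \<otimes>\<^bsub>P\<^esub> inv\<^bsub>P\<^esub> (inv\<^bsub>P\<^esub> x \<otimes>\<^bsub>P\<^esub> g) = x" using x g by (simp add: P.inv_mult_group P.m_assoc[symmetric])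
        show "inv\<^bsub>P\<^esub> x \<otimes>\<^bsub>P\<^esub> g \<in> carrier P" using x g by simp
        show "D j a (g \<otimes>\<^bsub>P\<^esub> inv\<^bsub>P\<^esub> (inv\<^bsub>P\<^esub> x \<otimes>\<^bsub>P\<^esub> g)) * f (j, inv\<^bsub>P\<^esub> x \<otimes>\<^bsub>P\<^esub> g) = D j a x * f (j, inv\<^bsub>P\<^esub> x \<otimes>\<^bsub>P\<^esub> g)"
          unfolding e ..
      next
        fix x assume x: "x \<in> carrier P"
        show "inv\<^bsub>P\<^esub> (g \<otimes>\<^bsub>P\<^esub> inv\<^bsub>P\<^esub> x) \<otimes>\<^bsub>P\<^esub> g = x" using x g by (simp add: P.inv_mult_group P.m_assoc)
        show "g \<otimes>\<^bsub>P\<^esub> inv\<^bsub>P\<^esub> x \<in> carrier P" using x g by simp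
      qed
      have li: "(\<Sum>x\<leftarrow>xs. D j a x * F (inv\<^bsub>P\<^esub> x \<otimes>\<^bsub>P\<^esub> g, j)) = (\<Sum>x\<in>carrier P. D j a x * f (j, inv\<^bsub>P\<^esub> x \<otimes>\<^bsub>P\<^esub> g))" if "j < 2" for j
        unfolding sum_list_distinct_conv_sum_set[OF xs(2)] xs(1)
        by (intro sum.cong refl) (use that g in \<open>simp add: F_def\<close>)
      have two: "{..<2::nat} = {0, 1}" by auto
      have "row_app P r F g = (\<Sum>x\<leftarrow>xs. D 0 a x * F (inv\<^bsub>P\<^esub> x \<otimes>\<^bsub>P\<^esub> g, 0)) + (\<Sum>x\<leftarrow>xs. D 1 a x * F (inv\<^bsub>P\<^esub> x \<otimes>\<^bsub>P\<^esub> g, 1))"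
        unfolding a(2) row_app_def row_def by (simp add: o_def)
      also have "\<dots> = (\<Sum>j<2. \<Sum>g'\<in>carrier P. D j a (g \<otimes>\<^bsub>P\<^esub> inv\<^bsub>P\<^esub> g') * f (j,g'))"
        unfolding two using li[of 0] li[of 1] re[of 0] re[of 1] by simp
      also have "\<dots> = 0" using f[OF a(1) g] by (simp add: sum.cartesian_product)
      finally show ?thesis .
    qed
    have aug1: "\<forall>j\<in>{..<2}. int p dvd c j" if c: "\<And>r. r \<in> row ` carrier G \<Longrightarrow> int p dvd (\<Sum>(m,x,j)\<leftarrow>r. m * c j)" for c :: "nat \<Rightarrow> int"
    proof -
      have t: "int p dvd (\<Sum>x\<in>carrier P. D 0 a x) * c 0 + (\<Sum>x\<in>carrier P. D 1 a x) * c 1" if "a \<in> carrier G" for a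
      proof -
        have "(\<Sum>(m,x,j)\<leftarrow>row a. m * c j) = (\<Sum>x\<leftarrow>xs. D 0 a x) * c 0 + (\<Sum>x\<leftarrow>xs. D 1 a x) * c 1"
          unfolding row_def by (simp add: o_def sum_list_mult_const)
        then show ?thesis using c[of "row a"] that unfolding sum_list_distinct_conv_sum_set[OF xs(2)] xs(1) by simp
      qed
      have tot: "int p dvd (\<Sum>x\<in>carrier P. D 0 a x) - f1 (\<rho> a)" "int p dvd (\<Sum>x\<in>carrier P. D 1 a x) - f2 (\<rho> a)" if "a \<in> carrier G" for a
      proof -
        have "word_val P y (h a) \<in> H" using that by (auto simp: H_def \<rho>[symmetric])
        then show "int p dvd (\<Sum>x\<in>carrier P. D 0 a x) - f1 (\<rho> a)" "int p dvd (\<Sum>x\<in>carrier P. D 1 a x) - f2 (\<rho> a)"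
          using n1(2) n2(2) unfolding D_def N_def \<rho> by simp_all
      qed
      have key: "int p dvd f1 (\<rho> a) * c 0 + f2 (\<rho> a) * c 1" if a: "a \<in> carrier G" for a
      proof -
        have "int p dvd ((\<Sum>x\<in>carrier P. D 0 a x) * c 0 + (\<Sum>x\<in>carrier P. D 1 a x) * c 1)
          - (((\<Sum>x\<in>carrier P. D 0 a x) - f1 (\<rho> a)) * c 0 + ((\<Sum>x\<in>carrier P. D 1 a x) - f2 (\<rho> a)) * c 1)"
          by (intro dvd_diff t[OF a] dvd_add dvd_mult2 tot[OF a])
        then show ?thesis by (simp add: algebra_simps)
      qed
      obtain a1 a2 where a: "a1 \<in> carrier G" "g1 = \<rho> a1" "a2 \<in> carrier G" "g2 = \<rho> a2" using fg(3,4) by (auto simp: H_def)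
      have pi: "Factorial_Ring.prime (int p)" using p by simp
      \<comment> \<open>f2 vanishes at g1, so evaluation at g1 isolates \<open>c 0\<close>;
        evaluation at g2 then yields \<open>c 1\<close>.\<close>
      have "int p dvd f1 g1 * c 0" using key[OF a(1)] fg(6) a(2) by simp
      then have c0: "int p dvd c 0" using fg(5) pi prime_dvd_mult_iff by blast
      have "int p dvd (f1 g2 * c 0 + f2 g2 * c 1) - f1 g2 * c 0"
        by (rule dvd_diff) (use key[OF a(3)] a(4) c0 in auto)
      then have "int p dvd f2 g2 * c 1" by simp
      then have c1: "int p dvd c 1" using fg(7) pi prime_dvd_mult_iff by blast
      show "\<forall>j\<in>{..<2}. int p dvd c j"
      proof
        fix j :: nat assume "j \<in> {..<2}"
        then have "j = 0 \<or> j = 1" by auto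
        then show "int p dvd c j" using c0 c1 by auto
      qed
    qed
    have "F (snd z, fst z) = 0"
      by (rule p_group_system_injective[where G = P and p = p and k = n and J = "{..<2}" and R = "row ` carrier G", OF P p ord _ R1 aug1 supp1 sol1]) auto
    then show ?thesis using z by (auto simp: F_def)
  qed
  show ?thesis
  proof (rule exI[of _ D], intro conjI allI impI ballI)
    fix j :: nat and a b z
    assume "a \<in> carrier G" "b \<in> carrier G" "z \<in> carrier P"
    then show "D j (a \<otimes>\<^bsub>G\<^esub> b) z = D j a z + D j b (inv\<^bsub>P\<^esub> (\<rho> a) \<otimes>\<^bsub>P\<^esub> z)" by (rule law)
  next
    fix f :: "nat \<times> 'c \<Rightarrow> int" and z :: "nat \<times> 'c"
    assume f: "\<forall>a\<in>carrier G. \<forall>z\<in>carrier P. (\<Sum>(j,g)\<in>{..<2} \<times> carrier P. D j a (z \<otimes>\<^bsub>P\<^esub> inv\<^bsub>P\<^esub> g) * f (j,g)) = 0"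
      and z: "z \<in> {..<2} \<times> carrier P"
    show "f z = 0" by (rule inj[OF _ z]) (use f in blast)
  qed
qed

text \<open>The values of a derivation on the generators solve the Fox rows of all relators. Two
  derivations with all their right translates give twice the order of P many solutions, and
  \<open>inj\<close> makes them independent.\<close>

lemma trace_ge_of_derivations:
  fixes D :: "nat \<Rightarrow> 'a \<Rightarrow> 'g \<Rightarrow> int"
  assumes G: "group G" and P: "group P" and fin: "finite (carrier P)" and \<rho>: "\<rho> \<in> hom G P"
    and x: "\<And>i. x i \<in> carrier G"
    and gen: "\<forall>g\<in>carrier G. \<exists>w. letters_below d w \<and> word_val G x w = g"
    and ws: "set ws \<subseteq> relators G x d"
    and D: "\<And>j a b z. j < 2 \<Longrightarrow> a \<in> carrier G \<Longrightarrow> b \<in> carrier G \<Longrightarrow> z \<in> carrier P \<Longrightarrow>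
       D j (a \<otimes>\<^bsub>G\<^esub> b) z = D j a z + D j b (inv\<^bsub>P\<^esub> (\<rho> a) \<otimes>\<^bsub>P\<^esub> z)"
    and inj: "\<And>f. (\<forall>a\<in>carrier G. \<forall>z\<in>carrier P. (\<Sum>(j,g)\<in>{..<2} \<times> carrier P. D j a (z \<otimes>\<^bsub>P\<^esub> inv\<^bsub>P\<^esub> g) * f (j,g)) = 0) \<Longrightarrow>
       \<forall>z\<in>{..<2} \<times> carrier P. f z = 0"
  shows "2 * gram_bound (map fox ws) d ^ k \<le> formal_trace P (\<lambda>i. \<rho> (x i)) (map fox ws) d k"
proof -
  interpret G: group G by (rule G)
  interpret P: group P by (rule P)
  interpret \<rho>: group_hom G P \<rho> using G P \<rho> by (simp add: group_hom_def group_hom_axioms_def)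
  let ?y = "\<lambda>i. \<rho> (x i)"
  let ?C = "gram_bound (map fox ws) d"
  have y: "?y i \<in> carrier P" for i using x by simp
  interpret A: gram "{..<d} \<times> carrier P" "{..<length (map fox ws)} \<times> carrier P" "row_matrix P ?y (map fox ws)" ?C
    by (rule P.gram_locale[OF y fin])
  \<comment> \<open>The column (j, g') consists of the values on the generators of the j-th
    derivation, translated on the right by g'.\<close>
  define b where "b = (\<lambda>(i,g) (j,g'). D j (x i) (g \<otimes>\<^bsub>P\<^esub> inv\<^bsub>P\<^esub> g'))"
  have ker: "(\<Sum>v\<in>{..<d} \<times> carrier P. row_matrix P ?y (map fox ws) qg v * b v z) = 0"
    if qg: "qg \<in> {..<length (map fox ws)} \<times> carrier P" and z: "z \<in> {..<2} \<times> carrier P" for qg z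
  proof -
    obtain q g where q: "qg = (q,g)" "q < length ws" "g \<in> carrier P" using qg by auto
    obtain j g' where j: "z = (j,g')" "j < 2" "g' \<in> carrier P" using z by auto
    have w: "letters_below d (ws ! q)" "word_val G x (ws ! q) = \<one>\<^bsub>G\<^esub>"
      using ws nth_mem[OF q(2)] by (auto simp: relators_def)
    have gz: "g \<otimes>\<^bsub>P\<^esub> inv\<^bsub>P\<^esub> g' \<in> carrier P" using q j by simp
    have D1: "D j \<one>\<^bsub>G\<^esub> v = 0" if "v \<in> carrier P" for v
      using D[OF j(2) G.one_closed G.one_closed that] that by simp
    have "(\<Sum>v\<in>{..<d} \<times> carrier P. row_matrix P ?y (map fox ws) (q,g) v * b v (j,g'))
       = (\<Sum>(c,u,i)\<leftarrow>fox (ws ! q). c * b (i, inv\<^bsub>P\<^esub> (word_val P ?y u) \<otimes>\<^bsub>P\<^esub> g) (j,g'))"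
      by (rule row_matrix_apply[OF P fin y w(1) q(2,3)])
    also have "\<dots> = (\<Sum>(c,u,i)\<leftarrow>fox (ws ! q). c * D j (x i) (inv\<^bsub>P\<^esub> (word_val P ?y u) \<otimes>\<^bsub>P\<^esub> (g \<otimes>\<^bsub>P\<^esub> inv\<^bsub>P\<^esub> g')))"
      using q j y by (simp add: b_def P.m_assoc)
    also have "\<dots> = D j (word_val G x (ws ! q)) (g \<otimes>\<^bsub>P\<^esub> inv\<^bsub>P\<^esub> g')"
      by (rule fox_derivation[OF G P \<rho> x D[OF j(2)] gz])
    also have "\<dots> = 0" unfolding w(2) by (rule D1[OF gz])
    finally show ?thesis unfolding q(1) j(1) .
  qed
  have inj': "\<forall>z\<in>{..<2} \<times> carrier P. f z = 0"
    if f: "\<And>v. v \<in> {..<d} \<times> carrier P \<Longrightarrow> (\<Sum>z\<in>{..<2} \<times> carrier P. b v z * f z) = 0" for f :: "nat \<times> 'g \<Rightarrow> int"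
  proof (rule inj, intro ballI)
    fix a z assume a: "a \<in> carrier G" and z: "z \<in> carrier P"
    \<comment> \<open>A combination of translates is again a derivation. It vanishes on the
      generators, hence on every word by the Fox formula.\<close>
    define S where "S a v = (\<Sum>(j,g)\<in>{..<2} \<times> carrier P. D j a (v \<otimes>\<^bsub>P\<^esub> inv\<^bsub>P\<^esub> g) * f (j,g))" for a v
    have S: "S (a \<otimes>\<^bsub>G\<^esub> a') v = S a v + S a' (inv\<^bsub>P\<^esub> (\<rho> a) \<otimes>\<^bsub>P\<^esub> v)"
      if "a \<in> carrier G" "a' \<in> carrier G" "v \<in> carrier P" for a a' v
      unfolding S_def sum.distrib[symmetric]
      by (intro sum.cong refl) (use that in \<open>auto simp: D P.m_assoc distrib_right\<close>)
    have S0: "S (x i) v = 0" if "i < d" "v \<in> carrier P" for i v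
      using f[of "(i,v)"] that by (simp add: S_def b_def case_prod_unfold)
    obtain w where w: "letters_below d w" "word_val G x w = a" using gen a by blast
    have "S a z = (\<Sum>(c,u,i)\<leftarrow>fox w. c * S (x i) (inv\<^bsub>P\<^esub> (word_val P ?y u) \<otimes>\<^bsub>P\<^esub> z))"
      using fox_derivation[where w = w, OF G P \<rho> x S z] w(2) by simp
    also have "\<dots> = 0"
    proof (rule sum_list_map_neutral)
      fix t assume t: "t \<in> set (fox w)"
      obtain c u i where tt: "t = (c,u,i)" by (cases t) auto
      have "i < d" using fox_letters[OF w(1)] t tt by blast
      then show "(case t of (c,u,i) \<Rightarrow> c * S (x i) (inv\<^bsub>P\<^esub> (word_val P ?y u) \<otimes>\<^bsub>P\<^esub> z)) = 0"
        using z y by (simp add: tt S0)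
    qed
    finally show "(\<Sum>(j,g)\<in>{..<2} \<times> carrier P. D j a (z \<otimes>\<^bsub>P\<^esub> inv\<^bsub>P\<^esub> g) * f (j,g)) = 0" unfolding S_def .
  qed
  have finZ: "finite ({..<2::nat} \<times> carrier P)" using fin by simp
  have "real (card ({..<2::nat} \<times> carrier P)) * of_int ?C ^ k \<le> of_int (\<Sum>v\<in>{..<d} \<times> carrier P. A.Tpow k v v)"
    by (rule A.trace_lower_bound[OF finZ ker inj'])
  then have "real_of_int (int (2 * card (carrier P)) * ?C ^ k) \<le> of_int (int (card (carrier P)) * formal_trace P ?y (map fox ws) d k)"
    unfolding P.trace_power_words[OF y fin] by (simp add: card_cartesian_product)
  then have "int (card (carrier P)) * (2 * ?C ^ k) \<le> int (card (carrier P)) * formal_trace P ?y (map fox ws) d k"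
    unfolding of_int_le_iff by (simp add: mult_ac)
  moreover have "0 < int (card (carrier P))" using fin P.one_closed card_gt_0_iff by (metis empty_iff of_nat_0_less_iff)
  ultimately show ?thesis by (simp only: mult_le_cancel_left_pos)
qed

section \<open>The trace over P x Z/s\<close>

lemma word_val_prod_mod:
  assumes P: "group P" and y: "\<And>i. y i \<in> carrier P" and s: "0 < s"
  shows "word_val (P \<times>\<times> integer_mod_group s) (\<lambda>i. (y i, e i mod int s)) w = (word_val P y w, word_exp e w mod int s)"
proof (induction w)
  case (Cons l w)
  interpret P: group P by (rule P)
  have c: "e i mod int s \<in> carrier (integer_mod_group s)" for i
    using s by (simp add: carrier_integer_mod_group)
  have "letter_val (P \<times>\<times> integer_mod_group s) (\<lambda>i. (y i, e i mod int s)) l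
      = (letter_val P y l, (if snd l then - e (fst l) else e (fst l)) mod int s)"
    using y c by (simp add: letter_val_def inv_DirProd[OF P group_integer_mod_group] mod_minus_eq)
  then show ?case using Cons by (simp add: mod_add_eq)
qed simp

text \<open>No nonzero solution is supported in the window W, so the nullity is at most the number
  of points outside W: one full column, and margins of width M at both ends of the others. The two
  remaining terms of the trace estimate are small by \<open>e1\<close> and
  \<open>e2\<close>.\<close>

lemma trace_le_of_window:
  fixes P :: "('g, 'b) monoid_scheme" and \<epsilon> :: real
  assumes P: "group P" and p: "Factorial_Ring.prime p" and ord: "Coset.order P = p ^ n"
    and y: "\<And>i. y i \<in> carrier P"
    and ws: "\<And>w. w \<in> set ws \<Longrightarrow> letters_below d w"
    and M: "\<And>w m u j. w \<in> set ws \<Longrightarrow> (m,u,j) \<in> set (fox w) \<Longrightarrow> \<bar>word_exp e u\<bar> \<le> int M"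
    and inj: "\<And>c. [:int p:] dvd c k \<Longrightarrow>
      (\<And>w. w \<in> set ws \<Longrightarrow> [:int p:] dvd (\<Sum>(m,u,j)\<leftarrow>fox w. Polynomial.monom m (nat (int M + word_exp e u)) * c j)) \<Longrightarrow>
      \<forall>i<d. [:int p:] dvd c i"
    and k: "k < d" and s: "s = 8 * d * M + 1"
    and C: "C = gram_bound (map fox ws) d" and \<epsilon>: "0 < \<epsilon>" "\<epsilon> < 1"
    and e1: "d * (ln C / ln (1 / \<epsilon>)) \<le> 1 / 4" and e2: "d * (1 - \<epsilon> / C) ^ kk \<le> 1 / 4"
  shows "formal_trace (P \<times>\<times> integer_mod_group s) (\<lambda>i. (y i, e i mod int s)) (map fox ws) d kk \<le> C ^ kk * (7 / 4)"
proof -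
  interpret P: group P by (rule P)
  let ?Q = "P \<times>\<times> integer_mod_group s" and ?y = "\<lambda>i. (y i, e i mod int s)"
  have s0: "0 < s" using s by simp
  have p0: "0 < p" using prime_gt_0_nat[OF p] .
  have finP: "finite (carrier P)" using ord p0 by (metis P.order_gt_0_iff_finite zero_less_power)
  have Q: "group ?Q" by (rule group_prod_mod[OF P])
  interpret Q: group ?Q by (rule Q)
  have cQ: "carrier ?Q = carrier P \<times> {0..<int s}" using s0 by (simp add: carrier_integer_mod_group)
  have fin: "finite (carrier ?Q)" unfolding cQ using finP by simp
  have yQ: "?y i \<in> carrier ?Q" for i unfolding cQ using y s0 by simp
  interpret A: gram "{..<d} \<times> carrier ?Q" "{..<length (map fox ws)} \<times> carrier ?Q" "row_matrix ?Q ?y (map fox ws)" C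
    unfolding C by (rule Q.gram_locale[OF yQ fin])
  \<comment> \<open>Column k is left out because the Fox rows are injective modulo p only on vectors
    whose k-th entry vanishes there. Margins of width M keep shifts by exponents from wrapping
    around.\<close>
  define W where "W = ({..<d} - {k}) \<times> (carrier P \<times> {int M..<int s - int M})"
  have WX: "W \<subseteq> {..<d} \<times> carrier ?Q" unfolding W_def cQ using s by auto
  have d0: "1 \<le> d" using k by simp
  have Ms: "2 * M < s"
  proof -
    have "1 * M \<le> d * M" using d0 by (rule mult_le_mono1)
    moreover have "s = 8 * (d * M) + 1" unfolding s by simp
    ultimately show ?thesis by linarith
  qed
  have M': "(\<And>w m u j. w \<in> set ws \<Longrightarrow> (m,u,j) \<in> set (fox w) \<Longrightarrow> \<bar>word_exp e u\<bar> \<le> int M)" by (rule M)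
  have injW: "\<forall>z\<in>W. f z = 0"
    if f0: "\<And>z. z \<notin> W \<Longrightarrow> f z = 0" and fz: "\<And>v. v \<in> {..<length (map fox ws)} \<times> carrier ?Q \<Longrightarrow>
      (\<Sum>z\<in>{..<d} \<times> carrier ?Q. row_matrix ?Q ?y (map fox ws) v z * f z) = 0" for f
  proof
    fix z
    show "f z = 0"
    proof (rule window_injective[where f = f and z = z and e = e and M = M and k = k and s = s, OF P p ord y ws M Ms inj])
      fix i :: nat and g and m :: int
      assume "\<not> (i < d \<and> i \<noteq> k \<and> g \<in> carrier P \<and> int M \<le> m \<and> m < int s - int M)"
      then show "f (i,(g,m)) = 0" by (intro f0) (auto simp: W_def)
    next
      fix w and g and m :: int
      assume w: "w \<in> set ws" and g: "g \<in> carrier P" and m: "m \<in> {0..<int s}"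
      obtain q where q: "q < length ws" "ws ! q = w" using w by (auto simp: in_set_conv_nth)
      have gm: "(g, m) \<in> carrier ?Q" unfolding cQ using g m by simp
      have "(\<Sum>z\<in>{..<d} \<times> carrier ?Q. row_matrix ?Q ?y (map fox ws) (q,(g,m)) z * f z)
         = (\<Sum>(c,u,i)\<leftarrow>fox (ws ! q). c * f (i, inv\<^bsub>?Q\<^esub> (word_val ?Q ?y u) \<otimes>\<^bsub>?Q\<^esub> (g,m)))"
        by (rule row_matrix_apply[OF Q fin yQ _ q(1) gm]) (use ws w q in simp)
      moreover have "inv\<^bsub>?Q\<^esub> (word_val ?Q ?y u) \<otimes>\<^bsub>?Q\<^esub> (g,m) = (inv\<^bsub>P\<^esub> (word_val P y u) \<otimes>\<^bsub>P\<^esub> g, (m - word_exp e u) mod int s)" for u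
      proof -
        have c: "word_exp e u mod int s \<in> carrier (integer_mod_group s)"
          using s0 by (simp add: carrier_integer_mod_group)
        have "((- (word_exp e u mod int s)) mod int s + m) mod int s = (m - word_exp e u) mod int s"
          by (simp add: mod_add_left_eq mod_diff_right_eq)
        then show ?thesis
          using y c by (simp add: word_val_prod_mod[OF P y s0] inv_DirProd[OF P group_integer_mod_group])
      qed
      ultimately show "(\<Sum>(c,u,i)\<leftarrow>fox w. c * f (i, (inv\<^bsub>P\<^esub> (word_val P y u) \<otimes>\<^bsub>P\<^esub> g, (m - word_exp e u) mod int s))) = 0"
        using fz[of "(q,(g,m))"] q gm by simp
    qed
  qed
  let ?n = "card (carrier P)"
  have cardX: "card ({..<d} \<times> carrier ?Q) = d * (?n * s)"
    unfolding cQ by (simp add: card_cartesian_product)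
  have cardW: "card W = (d - 1) * (?n * (s - 2 * M))"
  proof -
    have "nat (int s - int M - int M) = s - 2 * M" by arith
    then have "card {int M..<int s - int M} = s - 2 * M" by (simp only: card_atLeastLessThan_int)
    then show ?thesis unfolding W_def card_cartesian_product using k by simp
  qed
  have n0: "0 < ?n" using finP P.one_closed card_gt_0_iff by blast
  \<comment> \<open>In units of the order of P times s, the omitted column counts 1 and the margins
    at most 2 d M / s, which is at most 1/4 by the choice of s.\<close>
  have cW: "real (card ({..<d} \<times> carrier ?Q - W)) \<le> ?n * s * (5 / 4)"
  proof -
    have fW: "finite W" using WX fin by (meson finite_SigmaI finite_lessThan finite_subset)
    have "real (card ({..<d} \<times> carrier ?Q - W)) = real (card ({..<d} \<times> carrier ?Q)) - real (card W)"
      using card_Diff_subset[OF fW WX] card_mono[OF _ WX] fin by (simp add: of_nat_diff)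
    also have "\<dots> = real d * (?n * s) - (real d - 1) * (?n * (real s - 2 * real M))"
      unfolding cardX cardW using d0 Ms by (simp add: of_nat_diff)
    also have "\<dots> = ?n * (s + (real d - 1) * (2 * real M))" by (simp add: algebra_simps)
    also have "\<dots> \<le> ?n * (s * (5/4))"
    proof (rule mult_left_mono)
      have "(real d - 1) * (2 * real M) \<le> real d * (2 * real M)" by (rule mult_right_mono) auto
      then show "s + (real d - 1) * (2 * real M) \<le> s * (5/4)" by (simp add: s algebra_simps)
    qed simp
    finally show ?thesis by (simp add: mult_ac)
  qed
  let ?C = "real_of_int C"
  have C1: "1 \<le> ?C" using A.C1 by simp
  have "real_of_int (int (card (carrier ?Q)) * formal_trace ?Q ?y (map fox ws) d kk)
     \<le> ?C ^ kk * (real (card ({..<d} \<times> carrier ?Q - W)) + card ({..<d} \<times> carrier ?Q) * (ln ?C / ln (1 / \<epsilon>))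
         + card ({..<d} \<times> carrier ?Q) * (1 - \<epsilon> / ?C) ^ kk)"
    using A.trace_upper_bound[OF WX \<epsilon> injW, of kk] unfolding C Q.trace_power_words[OF yQ fin] .
  also have "\<dots> \<le> ?C ^ kk * (?n * s * (5/4) + ?n * s * (1/4) + ?n * s * (1/4))"
  proof (rule mult_left_mono, intro add_mono cW)
    have "card ({..<d} \<times> carrier ?Q) * (ln ?C / ln (1 / \<epsilon>)) = ?n * s * (d * (ln ?C / ln (1 / \<epsilon>)))"
      unfolding cardX by simp
    also have "\<dots> \<le> ?n * s * (1/4)" by (rule mult_left_mono[OF e1]) simp
    finally show "card ({..<d} \<times> carrier ?Q) * (ln ?C / ln (1 / \<epsilon>)) \<le> ?n * s * (1/4)" .
    have "card ({..<d} \<times> carrier ?Q) * (1 - \<epsilon> / ?C) ^ kk = ?n * s * (d * (1 - \<epsilon> / ?C) ^ kk)"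
      unfolding cardX by simp
    also have "\<dots> \<le> ?n * s * (1/4)" by (rule mult_left_mono[OF e2]) simp
    finally show "card ({..<d} \<times> carrier ?Q) * (1 - \<epsilon> / ?C) ^ kk \<le> ?n * s * (1/4)" .
  qed (use C1 in simp)
  also have "\<dots> = (?n * s) * (?C ^ kk * (7/4))" by (simp add: algebra_simps)
  finally have "real (?n * s) * formal_trace ?Q ?y (map fox ws) d kk \<le> real (?n * s) * (?C ^ kk * (7/4))"
    unfolding cQ by (simp add: card_cartesian_product)
  moreover have "0 < real (?n * s)" using n0 s0 by simp
  ultimately show ?thesis by (simp only: mult_le_cancel_left_pos)
qed

lemma formal_trace_eq:
  assumes "\<And>i w c. i < d \<Longrightarrow> (c,w) \<in> set (power_words rs d k i i) \<Longrightarrow> (word_val G y w = \<one>\<^bsub>G\<^esub>) = (word_val H z w = \<one>\<^bsub>H\<^esub>)"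
  shows "formal_trace G y rs d k = formal_trace H z rs d k"
  unfolding formal_trace_def
  by (intro sum.cong refl arg_cong[of _ _ sum_list] map_cong) (use assms in auto)

text \<open>A map to a free group that is injective on T and the identity is composed with a finite
  p-quotient that detects the images. The map to words is returned as well, because path sums are
  taken along the words and not only at their values in P.\<close>

lemma limit_group_residually_p:
  assumes L: "limit_group \<Gamma>" and p: "Factorial_Ring.prime p" and T: "finite T" "T \<subseteq> carrier \<Gamma>"
  shows "\<exists>h (P :: (int \<times> int \<times> int \<times> int) monoid) (y :: nat \<Rightarrow> _) n. group P \<and> Coset.order P = p ^ n \<and> (\<forall>i. y i \<in> carrier P) \<and>
    (\<forall>a\<in>carrier \<Gamma>. \<forall>b\<in>carrier \<Gamma>. h (a \<otimes>\<^bsub>\<Gamma>\<^esub> b) = reduce_word (h a @ h b)) \<and>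
    (\<forall>t\<in>T. word_val P y (h t) = \<one>\<^bsub>P\<^esub> \<longrightarrow> t = \<one>\<^bsub>\<Gamma>\<^esub>)"
proof -
  interpret G: group \<Gamma> using L by (simp add: limit_group_def fin_gen_group_def)
  have "finite (insert \<one>\<^bsub>\<Gamma>\<^esub> T) \<and> insert \<one>\<^bsub>\<Gamma>\<^esub> T \<subseteq> carrier \<Gamma>" using T by simp
  then obtain S :: "nat set" and h where h: "h \<in> hom \<Gamma> (free_group_on S)" "inj_on h (insert \<one>\<^bsub>\<Gamma>\<^esub> T)"
    using L unfolding limit_group_def by blast
  have hm: "h (a \<otimes>\<^bsub>\<Gamma>\<^esub> b) = reduce_word (h a @ h b)" if "a \<in> carrier \<Gamma>" "b \<in> carrier \<Gamma>" for a b
    using hom_mult[OF h(1) that] by (simp add: free_group_on_def)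
  have red: "reduced_word (h a)" if "a \<in> carrier \<Gamma>" for a
    using hom_in_carrier[OF h(1) that] by (simp add: free_group_on_def)
  \<comment> \<open>The image of the identity is idempotent under reduced concatenation. If it were
    nonempty, some p-group would give it a nontrivial value, but an idempotent of a group is
    trivial.\<close>
  have h1: "h \<one>\<^bsub>\<Gamma>\<^esub> = []"
  proof (rule ccontr)
    assume ne: "h \<one>\<^bsub>\<Gamma>\<^esub> \<noteq> []"
    obtain P :: "(int \<times> int \<times> int \<times> int) monoid" and y n where P: "group P" "Coset.order P = p ^ n" "\<And>i. y i \<in> carrier P"
      "\<And>w. w \<in> {h \<one>\<^bsub>\<Gamma>\<^esub>} \<Longrightarrow> word_val P y w \<noteq> \<one>\<^bsub>P\<^esub>"
      by (rule free_group_residually_p[OF p, of "{h \<one>\<^bsub>\<Gamma>\<^esub>}"]) (use ne red[OF G.one_closed] in auto)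
    interpret P: group P by (rule P(1))
    let ?v = "word_val P y (h \<one>\<^bsub>\<Gamma>\<^esub>)"
    have vc: "?v \<in> carrier P" using P(3) by simp
    have "word_val P y (h (\<one>\<^bsub>\<Gamma>\<^esub> \<otimes>\<^bsub>\<Gamma>\<^esub> \<one>\<^bsub>\<Gamma>\<^esub>)) = ?v \<otimes>\<^bsub>P\<^esub> ?v"
      unfolding hm[OF G.one_closed G.one_closed] P.word_val_reduce[OF P(3)] P.word_val_append[OF P(3)] ..
    then have "?v \<otimes>\<^bsub>P\<^esub> ?v = ?v" by simp
    then have "?v = \<one>\<^bsub>P\<^esub>" using P.r_cancel_one[OF vc vc] by simp
    then show False using P(4) by simp
  qed
  let ?E = "h ` (T - {\<one>\<^bsub>\<Gamma>\<^esub>})"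
  have E: "finite ?E" using T by simp
  have E2: "reduced_word w \<and> w \<noteq> []" if w: "w \<in> ?E" for w
  proof -
    obtain t where t: "t \<in> T" "t \<noteq> \<one>\<^bsub>\<Gamma>\<^esub>" "w = h t" using w by blast
    have "h t \<noteq> h \<one>\<^bsub>\<Gamma>\<^esub>" using inj_onD[OF h(2), of t "\<one>\<^bsub>\<Gamma>\<^esub>"] t by auto
    then show ?thesis using red T t h1 by auto
  qed
  obtain P :: "(int \<times> int \<times> int \<times> int) monoid" and y n where P: "group P" "Coset.order P = p ^ n" "\<And>i. y i \<in> carrier P"
    "\<And>w. w \<in> ?E \<Longrightarrow> word_val P y w \<noteq> \<one>\<^bsub>P\<^esub>"
    by (rule free_group_residually_p[OF p E E2]) (assumption | rule that | blast)+
  show ?thesis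
  proof (rule exI[of _ h], rule exI[of _ P], rule exI[of _ y], rule exI[of _ n], intro conjI)
    show "\<forall>a\<in>carrier \<Gamma>. \<forall>b\<in>carrier \<Gamma>. h (a \<otimes>\<^bsub>\<Gamma>\<^esub> b) = reduce_word (h a @ h b)" using hm by blast
    show "\<forall>t\<in>T. word_val P y (h t) = \<one>\<^bsub>P\<^esub> \<longrightarrow> t = \<one>\<^bsub>\<Gamma>\<^esub>" using P(4) by blast
    show "group P" by (rule P(1))
    show "Coset.order P = p ^ n" by (rule P(2))
    show "\<forall>i. y i \<in> carrier P" using P(3) by blast
  qed
qed

section \<open>Homology classes of tori\<close>

fun char_prod :: "(('a \<Rightarrow> 'k) \<times> ('a \<Rightarrow> 'k)) list \<Rightarrow> 'a \<Rightarrow> 'k::field" where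
  "char_prod [] g = 1"
| "char_prod (cd # ds) g = fst cd g * char_prod ds g"

text \<open>Each derivation is paired with the character that twists it.\<close>

fun cup :: "(('a \<Rightarrow> 'k) \<times> ('a \<Rightarrow> 'k)) list \<Rightarrow> 'a list \<Rightarrow> 'k::field" where
  "cup (cd # ds) (g # gs) = snd cd g * char_prod ds g * cup ds gs"
| "cup [] [] = 1"
| "cup _ _ = 0"

definition twisted_derivation :: "('a, 'b) monoid_scheme \<Rightarrow> ('a \<Rightarrow> 'k::field) \<Rightarrow> ('a \<Rightarrow> 'k) \<Rightarrow> bool" where
  "twisted_derivation G \<chi> d \<longleftrightarrow> (\<forall>g\<in>carrier G. \<forall>h\<in>carrier G.
     \<chi> (g \<otimes>\<^bsub>G\<^esub> h) = \<chi> g * \<chi> h \<and> d (g \<otimes>\<^bsub>G\<^esub> h) = d g + \<chi> g * d h)"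

lemma char_prod_mult:
  assumes "\<forall>(\<chi>,d)\<in>set ds. twisted_derivation G \<chi> d" "g \<in> carrier G" "h \<in> carrier G"
  shows "char_prod ds (g \<otimes>\<^bsub>G\<^esub> h) = char_prod ds g * char_prod ds h"
  using assms by (induction ds) (auto simp: twisted_derivation_def)

lemma bar_face_Cons:
  assumes "1 \<le> i" "i \<le> length gs"
  shows "bar_face G (Suc i) (g # gs) = g # bar_face G i gs"
proof -
  obtain i' where i: "i = Suc i'" using assms by (cases i) auto
  have "gs \<noteq> []" using assms by auto
  then show ?thesis using assms unfolding i by (auto simp: bar_face_def)
qed

text \<open>This is the cocycle equation in the bar complex, with g acting on the coefficients
  through the product of the characters. In the induction the derivation rule expands the face that
  merges the first two entries, and the later faces are faces of the tail.\<close>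

lemma cup_cocycle:
  assumes "\<forall>(\<chi>,d)\<in>set ds. twisted_derivation G \<chi> d" "length gs = length ds" "set (g # gs) \<subseteq> carrier G"
  shows "char_prod ds g * cup ds gs + (\<Sum>i=1..length (g # gs). (-1) ^ i * cup ds (bar_face G i (g # gs))) = 0"
  using assms
proof (induction ds arbitrary: g gs)
  case Nil
  then show ?case by (simp add: bar_face_def)
next
  case (Cons cd ds)
  obtain h hs where gs: "gs = h # hs" using Cons.prems(2) by (cases gs) auto
  let ?\<chi> = "fst cd" and ?d = "snd cd"
  have td: "twisted_derivation G ?\<chi> ?d" and tds: "\<forall>(\<chi>,d)\<in>set ds. twisted_derivation G \<chi> d"
    using Cons.prems(1) by (auto split: prod.splits)
  have gh: "g \<in> carrier G" "h \<in> carrier G" using Cons.prems(3) gs by auto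
  have IH: "char_prod ds h * cup ds hs + (\<Sum>i=1..length (h # hs). (-1) ^ i * cup ds (bar_face G i (h # hs))) = 0"
    using Cons.IH[OF tds, of hs h] Cons.prems gs by simp
  have "(\<Sum>i=1..length (g # gs). (-1) ^ i * cup (cd # ds) (bar_face G i (g # gs)))
      = - cup (cd # ds) (bar_face G 1 (g # gs)) + (\<Sum>i=Suc 1..Suc (length (h # hs)). (-1) ^ i * cup (cd # ds) (bar_face G i (g # gs)))"
    by (subst sum.atLeast_Suc_atMost) (simp_all add: gs)
  also have "(\<Sum>i=Suc 1..Suc (length (h # hs)). (-1) ^ i * cup (cd # ds) (bar_face G i (g # gs)))
      = (\<Sum>i=1..length (h # hs). (-1) ^ Suc i * cup (cd # ds) (bar_face G (Suc i) (g # h # hs)))"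
    unfolding gs by (rule sum.shift_bounds_cl_Suc_ivl)
  also have "\<dots> = (\<Sum>i=1..length (h # hs). - (?d g * char_prod ds g) * ((-1) ^ i * cup ds (bar_face G i (h # hs))))"
    by (intro sum.cong refl) (simp add: bar_face_Cons)
  also have "\<dots> = - (?d g * char_prod ds g) * (\<Sum>i=1..length (h # hs). (-1) ^ i * cup ds (bar_face G i (h # hs)))"
    by (rule sum_distrib_left[symmetric])
  also have "(\<Sum>i=1..length (h # hs). (-1) ^ i * cup ds (bar_face G i (h # hs))) = - (char_prod ds h * cup ds hs)"
    using IH by (simp add: add_eq_0_iff)
  finally have s: "(\<Sum>i=1..length (g # gs). (-1) ^ i * cup (cd # ds) (bar_face G i (g # gs)))
      = - cup (cd # ds) (bar_face G 1 (g # gs)) + ?d g * char_prod ds g * (char_prod ds h * cup ds hs)" by simp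
  have f1: "bar_face G 1 (g # gs) = (g \<otimes>\<^bsub>G\<^esub> h) # hs" by (simp add: bar_face_def gs)
  have "cup (cd # ds) (bar_face G 1 (g # gs)) = (?d g + ?\<chi> g * ?d h) * (char_prod ds g * char_prod ds h) * cup ds hs"
    unfolding f1 using td gh char_prod_mult[OF tds gh] by (simp add: twisted_derivation_def)
  then show ?case unfolding s by (simp add: gs algebra_simps)
qed

text \<open>Where the product of all characters is 1, the twist in front of the first face
  disappears, although the single characters may be nontrivial.\<close>

lemma cup_boundary:
  assumes ds: "\<forall>(\<chi>,d)\<in>set ds. twisted_derivation G \<chi> d" and triv: "\<And>g. g \<in> carrier G \<Longrightarrow> char_prod ds g = 1"
    and gs: "length gs = Suc (length ds)" "set gs \<subseteq> carrier G"
  shows "(\<Sum>i\<in>{0..length gs}. (-1) ^ i * cup ds (bar_face G i gs)) = 0"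
proof -
  obtain g hs where e: "gs = g # hs" using gs by (cases gs) auto
  have "(\<Sum>i\<in>{0..length gs}. (-1) ^ i * cup ds (bar_face G i gs)) = cup ds hs + (\<Sum>i=1..length gs. (-1) ^ i * cup ds (bar_face G i gs))"
    by (subst sum.atLeast_Suc_atMost) (simp_all add: e bar_face_def)
  moreover have "char_prod ds g * cup ds hs + (\<Sum>i=1..length gs. (-1) ^ i * cup ds (bar_face G i gs)) = 0"
    unfolding e by (rule cup_cocycle[OF ds]) (use gs e in auto)
  moreover have "char_prod ds g = 1" using gs e triv by auto
  ultimately show ?thesis by simp
qed

section \<open>Pairing rational chains with cocycles\<close>

definition pairing :: "('x \<Rightarrow> rat) \<Rightarrow> ('x \<Rightarrow> 'k::field_char_0) \<Rightarrow> 'k" where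
  "pairing c f = (\<Sum>x\<in>{x. c x \<noteq> 0}. of_rat (c x) * f x)"

lemma pairing_superset:
  assumes "finite S" "{x. c x \<noteq> 0} \<subseteq> S"
  shows "pairing c f = (\<Sum>x\<in>S. of_rat (c x) * f x)"
  unfolding pairing_def by (rule sum.mono_neutral_left) (use assms in auto)

lemma pairing_add:
  assumes "finite {x. c x \<noteq> 0}" "finite {x. c' x \<noteq> 0}"
  shows "pairing (\<lambda>x. c x + c' x) f = pairing c f + pairing c' f"
proof -
  let ?S = "{x. c x \<noteq> 0} \<union> {x. c' x \<noteq> 0}"
  have S: "finite ?S" using assms by simp
  have "pairing (\<lambda>x. c x + c' x) f = (\<Sum>x\<in>?S. of_rat (c x + c' x) * f x)" by (rule pairing_superset[OF S]) auto
  also have "\<dots> = (\<Sum>x\<in>?S. of_rat (c x) * f x) + (\<Sum>x\<in>?S. of_rat (c' x) * f x)"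
    by (simp add: of_rat_add distrib_right sum.distrib)
  also have "\<dots> = pairing c f + pairing c' f"
    using pairing_superset[OF S, of c f] pairing_superset[OF S, of c' f] by auto
  finally show ?thesis .
qed

lemma pairing_combination:
  assumes F: "finite F" and fin: "\<And>s. s \<in> F \<Longrightarrow> finite {x. s x \<noteq> 0}"
  shows "pairing (\<lambda>x. \<Sum>s\<in>F. a s * s x) f = (\<Sum>s\<in>F. of_rat (a s) * pairing s f)"
proof -
  let ?S = "\<Union>s\<in>F. {x. s x \<noteq> 0}"
  have S: "finite ?S" using F fin by simp
  have "{x. (\<Sum>s\<in>F. a s * s x) \<noteq> 0} \<subseteq> ?S"
  proof
    fix x assume "x \<in> {x. (\<Sum>s\<in>F. a s * s x) \<noteq> 0}"
    then obtain s where "s \<in> F" "a s * s x \<noteq> 0" by (metis (mono_tags, lifting) mem_Collect_eq sum.neutral)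
    then show "x \<in> ?S" by auto
  qed
  then have "pairing (\<lambda>x. \<Sum>s\<in>F. a s * s x) f = (\<Sum>x\<in>?S. of_rat (\<Sum>s\<in>F. a s * s x) * f x)" by (rule pairing_superset[OF S])
  also have "\<dots> = (\<Sum>x\<in>?S. \<Sum>s\<in>F. of_rat (a s) * (of_rat (s x) * f x))"
    by (simp add: of_rat_sum of_rat_mult sum_distrib_right mult.assoc)
  also have "\<dots> = (\<Sum>s\<in>F. of_rat (a s) * (\<Sum>x\<in>?S. of_rat (s x) * f x))"
    by (subst sum.swap) (simp add: sum_distrib_left)
  also have "\<dots> = (\<Sum>s\<in>F. of_rat (a s) * pairing s f)"
  proof (rule sum.cong[OF refl])
    fix s assume s: "s \<in> F"
    then have "{x. s x \<noteq> 0} \<subseteq> ?S" by blast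
    then show "of_rat (a s) * (\<Sum>x\<in>?S. of_rat (s x) * f x) = of_rat (a s) * pairing s f"
      using pairing_superset[OF S, of s f] by simp
  qed
  finally show ?thesis .
qed

text \<open>Interchanging the sums moves the boundary operator over to f, where it gives 0 by
  assumption.\<close>

lemma pairing_boundary:
  assumes c: "c \<in> bar_chains G (Suc k)"
    and f: "\<And>gs. length gs = Suc k \<Longrightarrow> set gs \<subseteq> carrier G \<Longrightarrow>
       (\<Sum>i\<in>{0..length gs}. (-1) ^ i * f (bar_face G i gs)) = 0"
  shows "finite {ys. bar_boundary G c ys \<noteq> 0}" "pairing (bar_boundary G c) f = (0 :: 'k :: field_char_0)"
proof -
  let ?C = "{gs. c gs \<noteq> 0 \<and> gs \<noteq> []}"
  have fin: "finite ?C" using c unfolding bar_chains_def by (auto intro: finite_subset[of _ "{gs. c gs \<noteq> 0}"])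
  have len: "length gs = Suc k" "set gs \<subseteq> carrier G" if "gs \<in> ?C" for gs using c that unfolding bar_chains_def by blast+
  let ?S = "\<Union>gs\<in>?C. (\<lambda>i. bar_face G i gs) ` {0..length gs}"
  have S: "finite ?S" using fin by simp
  have sub: "{ys. bar_boundary G c ys \<noteq> 0} \<subseteq> ?S"
  proof (rule subsetI, rule ccontr)
    fix ys assume ys: "ys \<in> {ys. bar_boundary G c ys \<noteq> 0}" "ys \<notin> ?S"
    have "bar_boundary G c ys = 0" unfolding bar_boundary_def
    proof (rule sum.neutral, rule ballI)
      fix gs assume gs: "gs \<in> ?C"
      have "(if bar_face G i gs = ys then (-1) ^ i else 0) = (0::rat)" if "i \<in> {0..length gs}" for i
        using ys(2) gs that by auto
      then show "c gs * (\<Sum>i\<in>{0..length gs}. (if bar_face G i gs = ys then (-1) ^ i else 0)) = 0" by simp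
    qed
    then show False using ys(1) by simp
  qed
  then show "finite {ys. bar_boundary G c ys \<noteq> 0}" using S by (rule finite_subset)
  have "pairing (bar_boundary G c) f = (\<Sum>ys\<in>?S. of_rat (bar_boundary G c ys) * f ys)"
    by (rule pairing_superset[OF S sub])
  also have "\<dots> = (\<Sum>ys\<in>?S. \<Sum>gs\<in>?C. of_rat (c gs) * (\<Sum>i\<in>{0..length gs}. (if bar_face G i gs = ys then (-1) ^ i else 0) * f ys))"
  proof (rule sum.cong[OF refl])
    fix ys
    have "of_rat (\<Sum>i\<in>{0..length gs}. (if bar_face G i gs = ys then (-1) ^ i else 0)) * f ys
       = (\<Sum>i\<in>{0..length gs}. (if bar_face G i gs = ys then (-1) ^ i else 0) * f ys)" for gs
      unfolding of_rat_sum sum_distrib_right by (intro sum.cong refl) (auto simp: of_rat_power of_rat_minus)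
    then show "of_rat (bar_boundary G c ys) * f ys = (\<Sum>gs\<in>?C. of_rat (c gs) * (\<Sum>i\<in>{0..length gs}. (if bar_face G i gs = ys then (-1) ^ i else 0) * f ys))"
      unfolding bar_boundary_def by (simp add: of_rat_sum of_rat_mult sum_distrib_right mult.assoc)
  qed
  also have "\<dots> = (\<Sum>gs\<in>?C. of_rat (c gs) * (\<Sum>i\<in>{0..length gs}. \<Sum>ys\<in>?S. (if bar_face G i gs = ys then (-1) ^ i else 0) * f ys))"
    by (subst sum.swap, intro sum.cong refl, subst sum_distrib_left[symmetric], subst sum.swap) (rule refl)
  also have "\<dots> = (\<Sum>gs\<in>?C. of_rat (c gs) * (\<Sum>i\<in>{0..length gs}. (-1) ^ i * f (bar_face G i gs)))"
  proof (intro sum.cong refl arg_cong2[where f = "(*)"])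
    fix gs i assume "gs \<in> ?C" "i \<in> {0..length gs}"
    then have m: "bar_face G i gs \<in> ?S" by blast
    have "(\<Sum>ys\<in>?S. (if bar_face G i gs = ys then (-1) ^ i else 0) * f ys) = (\<Sum>ys\<in>?S. if bar_face G i gs = ys then (-1) ^ i * f ys else 0)"
      by (intro sum.cong refl) auto
    also have "\<dots> = (-1) ^ i * f (bar_face G i gs)" using m S by (subst sum.delta'[OF S]) simp
    finally show "(\<Sum>ys\<in>?S. (if bar_face G i gs = ys then (-1) ^ i else 0) * f ys) = (-1) ^ i * f (bar_face G i gs)" .
  qed
  also have "\<dots> = 0" using f len by (intro sum.neutral) auto
  finally show "pairing (bar_boundary G c) f = 0" .
qed

text \<open>Pairing with f is Q-linear on cycles and kills boundaries. Finitely many classes that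
  span the homology would confine the values \<open>pairing (z j) f\<close> to a finite-dimensional
  subspace over Q.\<close>

lemma homology_infinite_dim:
  fixes f :: "'a list \<Rightarrow> 'k::field_char_0" and z :: "nat \<Rightarrow> 'a list \<Rightarrow> rat"
  assumes f: "\<And>gs. length gs = Suc k \<Longrightarrow> set gs \<subseteq> carrier G \<Longrightarrow>
       (\<Sum>i\<in>{0..length gs}. (-1) ^ i * f (bar_face G i gs)) = 0"
    and z: "\<And>j. z j \<in> bar_cycles G k"
    and indep: "\<And>F r. finite F \<Longrightarrow> (\<Sum>j\<in>F. of_rat (r j) * pairing (z j) f) = 0 \<Longrightarrow> \<forall>j\<in>F. r j = 0"
  shows "\<not> homology_finite_dim G k"
proof
  assume "homology_finite_dim G k"
  then obtain S where S: "finite S" "S \<subseteq> bar_cycles G k"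
    "bar_cycles G k \<subseteq> {(\<lambda>x. s x + b x) | s b. s \<in> rat_span S \<and> b \<in> bar_boundaries G k}"
    unfolding homology_finite_dim_def by blast
  interpret V: vector_space "\<lambda>(r::rat) (v::'k). of_rat r * v"
    by unfold_locales (auto simp: algebra_simps of_rat_add of_rat_mult)
  let ?P = "\<lambda>c. pairing c f"
  have fin: "finite {x. s x \<noteq> 0}" if "s \<in> bar_cycles G k" for s
    using that unfolding bar_cycles_def bar_chains_def by blast
  have span: "?P (z j) \<in> V.span (?P ` S)" for j
  proof -
    obtain s b where sb: "z j = (\<lambda>x. s x + b x)" "s \<in> rat_span S" "b \<in> bar_boundaries G k" using z[of j] S(3) by blast
    obtain F a where F: "finite F" "F \<subseteq> S" "s = (\<lambda>x. \<Sum>t\<in>F. a t * t x)" using sb(2) unfolding rat_span_def by blast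
    obtain c where c: "c \<in> bar_chains G (Suc k)" "b = bar_boundary G c" using sb(3) unfolding bar_boundaries_def by blast
    have fb: "finite {x. b x \<noteq> 0}" and Pb: "?P b = 0" using pairing_boundary[OF c(1) f] c(2) by auto
    have finF: "finite {x. t x \<noteq> 0}" if "t \<in> F" for t using that F(2) S(2) fin by blast
    have "{x. s x \<noteq> 0} \<subseteq> (\<Union>t\<in>F. {x. t x \<noteq> 0})"
    proof
      fix x assume "x \<in> {x. s x \<noteq> 0}"
      then have "(\<Sum>t\<in>F. a t * t x) \<noteq> 0" unfolding F(3) by simp
      then obtain t where "t \<in> F" "a t * t x \<noteq> 0" by (meson sum.neutral)
      then show "x \<in> (\<Union>t\<in>F. {x. t x \<noteq> 0})" by auto
    qed
    then have fs: "finite {x. s x \<noteq> 0}" using finF F(1) by (meson finite_UN_I finite_subset)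
    have "?P (z j) = ?P s" unfolding sb(1) using pairing_add[OF fs fb, of f] Pb by simp
    also have "\<dots> = (\<Sum>t\<in>F. of_rat (a t) * ?P t)" unfolding F(3) by (rule pairing_combination[OF F(1) finF])
    also have "\<dots> \<in> V.span (?P ` S)"
      by (rule V.span_sum, rule V.span_scale, rule V.span_base) (use F(2) in blast)
    finally show ?thesis .
  qed
  \<comment> \<open>Independence is assumed for the indexed family; injectivity turns it into
    independence of the set of values.\<close>
  have inj: "inj (\<lambda>j. ?P (z j))"
  proof (rule injI, rule ccontr)
    fix i j assume ij: "?P (z i) = ?P (z j)" "i \<noteq> j"
    define r :: "nat \<Rightarrow> rat" where "r = (\<lambda>_. 0)(i := 1, j := - 1)"
    have "(\<Sum>l\<in>{i,j}. of_rat (r l) * ?P (z l)) = 0" using ij by (simp add: r_def of_rat_minus)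
    then have "\<forall>l\<in>{i,j}. r l = 0" by (rule indep[rotated]) (rule finite.insertI finite.emptyI)+
    then have "r i = 0" by blast
    then show False using ij(2) by (simp add: r_def)
  qed
  have "\<not> V.dependent (range (\<lambda>j. ?P (z j)))"
  proof
    assume "V.dependent (range (\<lambda>j. ?P (z j)))"
    then obtain T u where T: "finite T" "T \<subseteq> range (\<lambda>j. ?P (z j))" "(\<Sum>v\<in>T. of_rat (u v) * v) = 0" "\<exists>v\<in>T. u v \<noteq> 0"
      unfolding V.dependent_explicit by blast
    obtain F where F: "finite F" "T = (\<lambda>j. ?P (z j)) ` F" using T(1,2) by (metis finite_subset_image)
    have "(\<Sum>j\<in>F. of_rat (u (?P (z j))) * ?P (z j)) = (\<Sum>v\<in>T. of_rat (u v) * v)"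
      unfolding F(2) by (rule sum.reindex_cong[symmetric, of "\<lambda>j. ?P (z j)" F]) (use inj in \<open>auto intro: inj_on_subset\<close>)
    then have "(\<Sum>j\<in>F. of_rat (u (?P (z j))) * ?P (z j)) = 0" using T(3) by (rule trans)
    then have "\<forall>j\<in>F. u (?P (z j)) = 0" by (rule indep[OF F(1)])
    then show False using T(4) F(2) by auto
  qed
  then have "finite (range (\<lambda>j. ?P (z j)))"
    using V.independent_span_bound[of "?P ` S" "range (\<lambda>j. ?P (z j))"] S(1) span by blast
  then show False using inj finite_imageD by blast
qed

text \<open>For commuting elements this is the image of the fundamental class of a k-torus. Lists
  that arise from several permutations are counted with the sum of the signs.\<close>

definition torus :: "(nat \<Rightarrow> 'a) \<Rightarrow> nat \<Rightarrow> 'a list \<Rightarrow> rat" where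
  "torus l k ys = (\<Sum>\<sigma>\<in>{\<sigma>. \<sigma> permutes {..<k}}. of_int (sign \<sigma>) * of_bool (map (\<lambda>i. l (\<sigma> i)) [0..<k] = ys))"

lemma torus_support:
  "{ys. torus l k ys \<noteq> 0} \<subseteq> (\<lambda>\<sigma>. map (\<lambda>i. l (\<sigma> i)) [0..<k]) ` {\<sigma>. \<sigma> permutes {..<k}}"
proof (rule subsetI, rule ccontr)
  fix ys assume ys: "ys \<in> {ys. torus l k ys \<noteq> 0}" "ys \<notin> (\<lambda>\<sigma>. map (\<lambda>i. l (\<sigma> i)) [0..<k]) ` {\<sigma>. \<sigma> permutes {..<k}}"
  have "torus l k ys = 0" unfolding torus_def by (rule sum.neutral) (use ys(2) in auto)
  then show False using ys(1) by simp
qed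

lemma sum_torus:
  fixes B :: "'a list \<Rightarrow> 'k::field_char_0"
  assumes S: "finite S" "{ys. torus l k ys \<noteq> 0} \<subseteq> S" "S \<subseteq> (\<lambda>\<sigma>. map (\<lambda>i. l (\<sigma> i)) [0..<k]) ` {\<sigma>. \<sigma> permutes {..<k}}"
  shows "(\<Sum>ys\<in>S. of_rat (torus l k ys) * B ys) = (\<Sum>\<sigma>\<in>{\<sigma>. \<sigma> permutes {..<k}}. of_int (sign \<sigma>) * B (map (\<lambda>i. l (\<sigma> i)) [0..<k]))"
proof -
  let ?L = "\<lambda>\<sigma>. map (\<lambda>i. l (\<sigma> i)) [0..<k]" and ?P = "{\<sigma>. \<sigma> permutes {..<k}}"
  let ?I = "?L ` ?P"
  have P: "finite ?P" by (simp add: finite_permutations)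
  have "(\<Sum>ys\<in>S. of_rat (torus l k ys) * B ys) = (\<Sum>ys\<in>?I. of_rat (torus l k ys) * B ys)"
    by (rule sum.mono_neutral_left) (use P S in auto)
  also have "\<dots> = (\<Sum>ys\<in>?I. \<Sum>\<sigma>\<in>?P. of_int (sign \<sigma>) * (of_bool (?L \<sigma> = ys) * B ys))"
    unfolding torus_def of_rat_sum sum_distrib_right
    by (intro sum.cong refl) (simp add: of_rat_mult)
  also have "\<dots> = (\<Sum>\<sigma>\<in>?P. of_int (sign \<sigma>) * (\<Sum>ys\<in>?I. of_bool (?L \<sigma> = ys) * B ys))"
    by (subst sum.swap) (simp add: sum_distrib_left)
  also have "\<dots> = (\<Sum>\<sigma>\<in>?P. of_int (sign \<sigma>) * B (?L \<sigma>))"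
  proof (intro sum.cong refl arg_cong2[where f = "(*)"])
    fix \<sigma> assume s: "\<sigma> \<in> ?P"
    have "(\<Sum>ys\<in>?I. of_bool (?L \<sigma> = ys) * B ys) = (\<Sum>ys\<in>?I. if ?L \<sigma> = ys then B ys else 0)"
      by (intro sum.cong refl) auto
    also have "\<dots> = B (?L \<sigma>)" using s P by (subst sum.delta') auto
    finally show "(\<Sum>ys\<in>?I. of_bool (?L \<sigma> = ys) * B ys) = B (?L \<sigma>)" .
  qed
  finally show ?thesis .
qed

text \<open>Rearranging a list along this shift rotates it, so that dropping the first entry
  afterwards has the effect of dropping the last entry before.\<close>

definition cyc :: "nat \<Rightarrow> nat \<Rightarrow> nat" where
  "cyc m j = (if j < m then (if j = 0 then m - 1 else j - 1) else j)"

lemma cyc: "cyc (Suc m) permutes {..<Suc m} \<and> sign (cyc (Suc m)) = (-1) ^ m"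
proof (induction m)
  case 0
  have e: "cyc (Suc 0) = id" by (auto simp: cyc_def)
  show ?case unfolding e power_0 by (intro conjI permutes_id sign_id)
next
  case (Suc m)
  let ?t = "transpose m (Suc m)"
  have e: "cyc (Suc (Suc m)) = ?t \<circ> cyc (Suc m)"
    by (auto simp: fun_eq_iff cyc_def transpose_def)
  have p: "cyc (Suc m) permutes {..<Suc (Suc m)}"
    by (rule permutes_subset[OF conjunct1[OF Suc]]) auto
  have t: "?t permutes {..<Suc (Suc m)}" by (rule permutes_swap_id) auto
  have "sign (?t \<circ> cyc (Suc m)) = sign ?t * sign (cyc (Suc m))"
    by (rule sign_compose; rule permutes_imp_permutation[OF finite_lessThan], rule t p)
  also have "\<dots> = (-1) ^ Suc m" using Suc by (simp add: sign_swap_id)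
  finally show ?case unfolding e by (intro conjI permutes_compose[OF p t])
qed

text \<open>The faces cancel. For an inner face, permutations that differ by the transposition of i
  - 1 and i give the same list by commutativity, with opposite signs. The two outer faces correspond
  to each other under the cyclic shift, and its sign (-1)^(k-1) meets the factor (-1)^k.\<close>

lemma torus_bar_cycle:
  assumes k: "0 < k" and l: "\<And>i. i < k \<Longrightarrow> l i \<in> carrier G"
    and comm: "\<And>i j. i < k \<Longrightarrow> j < k \<Longrightarrow> l i \<otimes>\<^bsub>G\<^esub> l j = l j \<otimes>\<^bsub>G\<^esub> l i"
  shows "torus l k \<in> bar_cycles G k"
proof -
  let ?L = "\<lambda>\<sigma>. map (\<lambda>i. l (\<sigma> i)) [0..<k]" and ?P = "{\<sigma>. \<sigma> permutes {..<k}}"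
  have P: "finite ?P" by (simp add: finite_permutations)
  have pk: "\<sigma> i < k" if "\<sigma> \<in> ?P" "i < k" for \<sigma> i using permutes_in_image[of \<sigma> "{..<k}" i] that by simp
  have fin: "finite {ys. torus l k ys \<noteq> 0}" using P torus_support[of l k] by (meson finite_imageI finite_subset)
  have chain: "torus l k \<in> bar_chains G k"
    unfolding bar_chains_def
  proof (intro CollectI conjI allI impI fin)
    fix gs assume "torus l k gs \<noteq> 0"
    then obtain \<sigma> where s: "\<sigma> \<in> ?P" "gs = ?L \<sigma>" using torus_support[of l k] by blast
    show "length gs = k" using s by simp
    show "set gs \<subseteq> carrier G" using s pk l by auto
  qed
  define T :: "nat \<Rightarrow> _ \<Rightarrow> rat"
    where "T i ys = (\<Sum>\<sigma>\<in>?P. of_int (sign \<sigma>) * of_bool (bar_face G i (?L \<sigma>) = ys))" for i ys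
  have T0: "T i ys = 0" if i: "0 < i" "i < k" for i ys
  proof -
    let ?t = "transpose (i - 1) i"
    have t: "?t permutes {..<k}" using i by (intro permutes_swap_id) auto
    have ts: "sign (\<sigma> \<circ> ?t) = - sign \<sigma>" if "\<sigma> \<in> ?P" for \<sigma>
    proof -
      have "sign (\<sigma> \<circ> ?t) = sign \<sigma> * sign ?t"
        using that t by (intro sign_compose permutes_imp_permutation[OF finite_lessThan]) simp_all
      then show ?thesis using i by (simp add: sign_swap_id)
    qed
    have face: "bar_face G i (?L (\<sigma> \<circ> ?t)) = bar_face G i (?L \<sigma>)" if s: "\<sigma> \<in> ?P" for \<sigma>
    proof -
      have F: "bar_face G i (map f [0..<k]) = map f [0..<i - 1] @ [f (i - 1) \<otimes>\<^bsub>G\<^esub> f i] @ map f [i + 1..<k]" for f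
        using i by (simp add: bar_face_def take_map drop_map)
      have a: "map (\<lambda>j. l ((\<sigma> \<circ> ?t) j)) [0..<i - 1] = map (\<lambda>j. l (\<sigma> j)) [0..<i - 1]"
        "map (\<lambda>j. l ((\<sigma> \<circ> ?t) j)) [i + 1..<k] = map (\<lambda>j. l (\<sigma> j)) [i + 1..<k]"
        by (auto simp: transpose_def)
      have b: "l ((\<sigma> \<circ> ?t) (i - 1)) \<otimes>\<^bsub>G\<^esub> l ((\<sigma> \<circ> ?t) i) = l (\<sigma> (i - 1)) \<otimes>\<^bsub>G\<^esub> l (\<sigma> i)"
        using comm[OF pk[OF s] pk[OF s], of i "i - 1"] i by simp
      show ?thesis unfolding F a b ..
    qed
    have "T i ys = (\<Sum>\<sigma>\<in>?P. of_int (sign (\<sigma> \<circ> ?t)) * of_bool (bar_face G i (?L (\<sigma> \<circ> ?t)) = ys))"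
      unfolding T_def by (rule sum_permutations_compose_right[OF t])
    also have "\<dots> = - T i ys"
      unfolding T_def sum_negf[symmetric]
    proof (rule sum.cong[OF refl])
      fix \<sigma> assume s: "\<sigma> \<in> ?P"
      show "of_int (sign (\<sigma> \<circ> ?t)) * of_bool (bar_face G i (?L (\<sigma> \<circ> ?t)) = ys) = - (of_int (sign \<sigma>) * of_bool (bar_face G i (?L \<sigma>) = ys) :: rat)"
        unfolding ts[OF s] face[OF s] by simp
    qed
    finally show ?thesis by simp
  qed
  have Tk: "T 0 ys + (-1) ^ k * T k ys = 0" for ys
  proof -
    obtain m where m: "k = Suc m" using k by (cases k) auto
    have c: "cyc k permutes {..<k}" "sign (cyc k) = (-1) ^ m" using cyc[of m] m by auto
    have cs: "sign (\<sigma> \<circ> cyc k) = sign \<sigma> * (-1) ^ m" if "\<sigma> \<in> ?P" for \<sigma>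
      unfolding c(2)[symmetric] using that c by (intro sign_compose permutes_imp_permutation[OF finite_lessThan]) simp_all
    have face: "bar_face G 0 (?L (\<sigma> \<circ> cyc k)) = bar_face G k (?L \<sigma>)" for \<sigma>
    proof -
      have "tl (?L (\<sigma> \<circ> cyc k)) = butlast (?L \<sigma>)"
        by (rule nth_equalityI) (auto simp: nth_tl nth_butlast cyc_def)
      then show ?thesis using k by (simp add: bar_face_def)
    qed
    have "T 0 ys = (\<Sum>\<sigma>\<in>?P. of_int (sign (\<sigma> \<circ> cyc k)) * of_bool (bar_face G 0 (?L (\<sigma> \<circ> cyc k)) = ys))"
      unfolding T_def by (rule sum_permutations_compose_right[OF c(1)])
    also have "\<dots> = (\<Sum>\<sigma>\<in>?P. (-1) ^ m * (of_int (sign \<sigma>) * of_bool (bar_face G k (?L \<sigma>) = ys)))"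
      by (intro sum.cong refl) (simp add: cs face mult_ac del: o_apply)
    also have "\<dots> = (-1) ^ m * T k ys" unfolding T_def sum_distrib_left ..
    finally show ?thesis by (simp add: m)
  qed
  have "bar_boundary G (torus l k) ys = 0" for ys
  proof -
    let ?B = "\<lambda>gs. \<Sum>i\<in>{0..length gs}. (if bar_face G i gs = ys then (-1) ^ i else 0 :: rat)"
    have ne: "{gs. torus l k gs \<noteq> 0 \<and> gs \<noteq> []} = {gs. torus l k gs \<noteq> 0}"
    proof -
      have "gs \<noteq> []" if "torus l k gs \<noteq> 0" for gs using that chain k unfolding bar_chains_def by fastforce
      then show ?thesis by blast
    qed
    have "bar_boundary G (torus l k) ys = (\<Sum>gs\<in>{gs. torus l k gs \<noteq> 0}. of_rat (torus l k gs) * ?B gs)"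
      unfolding bar_boundary_def ne by simp
    also have "\<dots> = (\<Sum>\<sigma>\<in>?P. of_int (sign \<sigma>) * ?B (?L \<sigma>))"
      by (rule sum_torus[OF fin]) (use torus_support in auto)
    also have "\<dots> = (\<Sum>\<sigma>\<in>?P. \<Sum>i\<in>{0..k}. (-1) ^ i * (of_int (sign \<sigma>) * of_bool (bar_face G i (?L \<sigma>) = ys)))"
      unfolding sum_distrib_left by (intro sum.cong) auto
    also have "\<dots> = (\<Sum>i\<in>{0..k}. (-1) ^ i * T i ys)"
      unfolding T_def sum_distrib_left by (rule sum.swap)
    also have "\<dots> = (\<Sum>i\<in>{0,k}. (-1) ^ i * T i ys)"
      by (rule sum.mono_neutral_right) (use T0 in auto)
    also have "\<dots> = 0" using Tk[of ys] k by simp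
    finally show ?thesis .
  qed
  then show ?thesis using chain unfolding bar_cycles_def by auto
qed

lemma cup_eq_prod:
  assumes "length gs = length ds" "\<And>cd g. cd \<in> set ds \<Longrightarrow> g \<in> set gs \<Longrightarrow> fst cd g = 1"
  shows "cup ds gs = (\<Prod>q<length ds. snd (ds ! q) (gs ! q))"
  using assms
proof (induction ds arbitrary: gs)
  case (Cons cd ds)
  obtain g hs where gs: "gs = g # hs" using Cons.prems(1) by (cases gs) auto
  have "char_prod ds' g = 1" if "set ds' \<subseteq> set ds" for ds'
    using that Cons.prems(2) gs by (induction ds') auto
  then have "char_prod ds g = 1" by simp
  moreover have "cup ds hs = (\<Prod>q<length ds. snd (ds ! q) (hs ! q))"
    by (rule Cons.IH) (use Cons.prems gs in auto)
  ultimately show ?case unfolding gs by (simp add: prod.lessThan_Suc_shift del: prod.lessThan_Suc)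
qed auto

text \<open>As all characters are 1 on the elements, the cocycle becomes a product of values of the
  derivations. A permutation other than the identity pairs some derivation with an element on which
  it vanishes, so only the identity contributes.\<close>

lemma pairing_torus:
  fixes ds :: "(('a \<Rightarrow> 'k) \<times> ('a \<Rightarrow> 'k::field_char_0)) list"
  assumes k: "length ds = k"
    and \<chi>: "\<And>q j. q < k \<Longrightarrow> j < k \<Longrightarrow> fst (ds ! q) (l j) = 1"
    and d: "\<And>q j. q < k \<Longrightarrow> j < k \<Longrightarrow> q \<noteq> j \<Longrightarrow> snd (ds ! q) (l j) = 0"
  shows "pairing (torus l k) (cup ds) = (\<Prod>q<k. snd (ds ! q) (l q))"
proof -
  let ?L = "\<lambda>\<sigma>. map (\<lambda>i. l (\<sigma> i)) [0..<k]" and ?P = "{\<sigma>. \<sigma> permutes {..<k}}"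
  have P: "finite ?P" by (simp add: finite_permutations)
  have pk: "\<sigma> i < k" if "\<sigma> \<in> ?P" "i < k" for \<sigma> i using permutes_in_image[of \<sigma> "{..<k}" i] that by simp
  have fin: "finite {ys. torus l k ys \<noteq> 0}" using P torus_support[of l k] by (meson finite_imageI finite_subset)
  have c: "cup ds (?L \<sigma>) = (\<Prod>q<k. snd (ds ! q) (l (\<sigma> q)))" if s: "\<sigma> \<in> ?P" for \<sigma>
  proof -
    have "cup ds (?L \<sigma>) = (\<Prod>q<length ds. snd (ds ! q) (?L \<sigma> ! q))"
    proof (rule cup_eq_prod)
      fix cd g assume "cd \<in> set ds" "g \<in> set (?L \<sigma>)"
      then obtain q j where "q < k" "cd = ds ! q" "j < k" "g = l (\<sigma> j)" by (auto simp: in_set_conv_nth k)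
      then show "fst cd g = 1" using \<chi> pk[OF s] by simp
    qed (simp add: k)
    then show ?thesis using k by simp
  qed
  have "pairing (torus l k) (cup ds) = (\<Sum>\<sigma>\<in>?P. of_int (sign \<sigma>) * cup ds (?L \<sigma>))"
    unfolding pairing_def by (rule sum_torus[OF fin]) (use torus_support in auto)
  also have "\<dots> = (\<Sum>\<sigma>\<in>{id}. of_int (sign \<sigma>) * cup ds (?L \<sigma>))"
  proof (rule sum.mono_neutral_right[OF P])
    show "{id} \<subseteq> ?P" by (simp add: permutes_id)
    show "\<forall>\<sigma>\<in>?P - {id}. of_int (sign \<sigma>) * cup ds (?L \<sigma>) = 0"
    proof
      fix \<sigma> assume s: "\<sigma> \<in> ?P - {id}"
      then obtain q where "\<sigma> q \<noteq> q" by (auto simp: fun_eq_iff)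
      then have q: "q < k" "\<sigma> q \<noteq> q" using s permutes_not_in[of \<sigma> "{..<k}" q] by auto
      then have "snd (ds ! q) (l (\<sigma> q)) = 0" using d pk[of \<sigma> q] s by auto
      then have "cup ds (?L \<sigma>) = 0" using c s q by (auto simp: prod_zero_iff)
      then show "of_int (sign \<sigma>) * cup ds (?L \<sigma>) = 0" by simp
    qed
  qed
  also have "\<dots> = (\<Prod>q<k. snd (ds ! q) (l q))" using c[of id] by (simp add: permutes_id)
  finally show ?thesis .
qed

lemma torus_homology_infinite_dim:
  fixes ds :: "(('a \<Rightarrow> 'k) \<times> ('a \<Rightarrow> 'k::field_char_0)) list" and l :: "nat \<Rightarrow> nat \<Rightarrow> 'a"
  assumes k: "length ds = k" "0 < k"
    and ds: "\<forall>(\<chi>,d)\<in>set ds. twisted_derivation G \<chi> d" and triv: "\<And>g. g \<in> carrier G \<Longrightarrow> char_prod ds g = 1"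
    and l: "\<And>m i. i < k \<Longrightarrow> l m i \<in> carrier G"
    and comm: "\<And>m i j. i < k \<Longrightarrow> j < k \<Longrightarrow> l m i \<otimes>\<^bsub>G\<^esub> l m j = l m j \<otimes>\<^bsub>G\<^esub> l m i"
    and \<chi>: "\<And>m q j. q < k \<Longrightarrow> j < k \<Longrightarrow> fst (ds ! q) (l m j) = 1"
    and d: "\<And>m q j. q < k \<Longrightarrow> j < k \<Longrightarrow> q \<noteq> j \<Longrightarrow> snd (ds ! q) (l m j) = 0"
    and indep: "\<And>F r. finite F \<Longrightarrow> (\<Sum>m\<in>F. of_rat (r m) * (\<Prod>q<k. snd (ds ! q) (l m q))) = 0 \<Longrightarrow> \<forall>m\<in>F. r m = 0"
  shows "\<not> homology_finite_dim G k"
proof (rule homology_infinite_dim[where f = "cup ds" and z = "\<lambda>m. torus (l m) k"])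
  show "(\<Sum>i\<in>{0..length gs}. (-1) ^ i * cup ds (bar_face G i gs)) = 0" if "length gs = Suc k" "set gs \<subseteq> carrier G" for gs
    by (rule cup_boundary[OF ds triv]) (use that k in auto)
  show "torus (l m) k \<in> bar_cycles G k" for m by (rule torus_bar_cycle[OF k(2) l comm])
  have e: "pairing (torus (l m) k) (cup ds) = (\<Prod>q<k. snd (ds ! q) (l m q))" for m
    by (rule pairing_torus[OF k(1) \<chi> d])
  show "\<forall>j\<in>F. r j = 0" if "finite F" "(\<Sum>j\<in>F. of_rat (r j) * pairing (torus (l j) k) (cup ds)) = 0" for F r
    using indep[OF that(1), of r] that(2) unfolding e by blast
qed

section \<open>The kernel of a map to the integers\<close>

text \<open>The choices are made in the order relators, prime, M, s, \<epsilon>, power, and P last.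
  Everything before P is determined by words, so the finite set of elements that P has to detect is
  known when P is chosen.\<close>

lemma limit_group_not_rigid:
  fixes \<Gamma> :: "('a, 'b) monoid_scheme"
  assumes L: "limit_group \<Gamma>" and na: "non_abelian \<Gamma>"
    and \<phi>: "\<phi> \<in> hom \<Gamma> integer_group" and x: "\<And>i. x i \<in> carrier \<Gamma>"
    and gen: "\<forall>g\<in>carrier \<Gamma>. \<exists>w. letters_below d w \<and> word_val \<Gamma> x w = g" and k: "k < d"
  shows "\<exists>\<delta>. (\<forall>g\<in>carrier \<Gamma>. \<forall>h\<in>carrier \<Gamma>. \<delta> (g \<otimes>\<^bsub>\<Gamma>\<^esub> h) = \<delta> g + tK powi \<phi> g * \<delta> h) \<and>
       \<delta> (x k) = 0 \<and> (\<exists>g\<in>carrier \<Gamma>. \<delta> g \<noteq> 0)"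
proof (rule ccontr)
  assume neg: "\<nexists>\<delta>. (\<forall>g\<in>carrier \<Gamma>. \<forall>h\<in>carrier \<Gamma>. \<delta> (g \<otimes>\<^bsub>\<Gamma>\<^esub> h) = \<delta> g + tK powi \<phi> g * \<delta> h) \<and>
       \<delta> (x k) = 0 \<and> (\<exists>g\<in>carrier \<Gamma>. \<delta> g \<noteq> 0)"
  have G: "group \<Gamma>" using L by (simp add: limit_group_def fin_gen_group_def)
  interpret G: group \<Gamma> by (rule G)
  let ?e = "\<lambda>i. \<phi> (x i)"
  have rigid: "\<forall>g\<in>carrier \<Gamma>. \<delta> g = 0"
    if \<delta>: "\<forall>g\<in>carrier \<Gamma>. \<forall>h\<in>carrier \<Gamma>. \<delta> (g \<otimes>\<^bsub>\<Gamma>\<^esub> h) = \<delta> g + tK powi \<phi> g * \<delta> h" "\<delta> (x k) = 0" for \<delta>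
  proof (rule ccontr)
    assume "\<not> (\<forall>g\<in>carrier \<Gamma>. \<delta> g = 0)"
    then have "\<exists>g\<in>carrier \<Gamma>. \<delta> g \<noteq> 0" by simp
    then show False using neg[unfolded not_ex, THEN spec, of \<delta>] \<delta> by (elim notE) (intro conjI)
  qed
  obtain ws and p :: nat where ws: "set ws \<subseteq> relators \<Gamma> x d" and p: "Factorial_Ring.prime p"
    and inj: "\<forall>(M::nat) c. (\<forall>w\<in>set ws. \<forall>(m,u,j)\<in>set (fox w). 0 \<le> int M + word_exp ?e u) \<longrightarrow>
      [:int p:] dvd c k \<longrightarrow>
      (\<forall>w\<in>set ws. [:int p:] dvd (\<Sum>(m,u,j)\<leftarrow>fox w. Polynomial.monom m (nat (int M + word_exp ?e u)) * c j)) \<longrightarrow>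
      (\<forall>i<d. [:int p:] dvd c i)"
  proof (rule exE[OF fox_rows_injective_mod_prime[where x = x, OF G \<phi> x gen k]], goal_cases)
    case (1 \<delta>)
    show ?case by (rule rigid[OF 1(2,3)])
  next
    case (2 ws)
    from 2(2) show ?case by (elim exE conjE) (rule 2(1))
  qed
  define rs where "rs = map fox ws"
  define C where "C = gram_bound rs d"
  have C1: "1 \<le> C" unfolding C_def by (rule gram_bound_ge_1)
  have "finite (\<Union>w\<in>set ws. (\<lambda>(m,u,j). nat \<bar>word_exp ?e u\<bar>) ` set (fox w))" by simp
  then obtain M where "\<forall>a\<in>(\<Union>w\<in>set ws. (\<lambda>(m,u,j). nat \<bar>word_exp ?e u\<bar>) ` set (fox w)). a \<le> M"
    unfolding finite_nat_set_iff_bounded_le by blast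
  then have M: "\<bar>word_exp ?e u\<bar> \<le> int M" if "w \<in> set ws" "(m,u,j) \<in> set (fox w)" for w m u j
    using that by fastforce
  have d1: "1 \<le> d" using k by simp
  \<comment> \<open>Margins of width M at both ends of at most d columns then amount to at most a
    quarter of a column: 2 d M <= s / 4.\<close>
  define s where "s = 8 * d * M + 1"
  \<comment> \<open>With ln (1 / \<epsilon>) = 4 d ln C + 1 the estimate \<open>e1\<close> holds;
    the summand 1 keeps \<epsilon> below 1 also when C = 1.\<close>
  define \<epsilon> where "\<epsilon> = exp (- (4 * d * ln C + 1))"
  have lnC: "0 \<le> ln (real_of_int C)" using C1 by simp
  have ex: "0 < 4 * d * ln C + 1" using lnC by (intro add_nonneg_pos mult_nonneg_nonneg) auto
  have \<epsilon>: "0 < \<epsilon>" "\<epsilon> < 1" using ex by (simp_all add: \<epsilon>_def)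
  have e1: "d * (ln C / ln (1 / \<epsilon>)) \<le> 1 / 4"
  proof -
    have "ln (1 / \<epsilon>) = 4 * d * ln C + 1" by (simp add: \<epsilon>_def ln_div)
    moreover have "d * (ln C / (4 * d * ln C + 1)) \<le> 1 / 4" using ex by (simp add: field_simps)
    ultimately show ?thesis by simp
  qed
  \<comment> \<open>The power is so high that the eigenvalues above \<epsilon> contribute at most a
    quarter to the normalised trace.\<close>
  have "\<exists>kk. (1 - \<epsilon> / C) ^ kk < 1 / (4 * d)"
    by (rule real_arch_pow_inv) (use \<epsilon> C1 d1 in auto)
  then obtain kk where "(1 - \<epsilon> / C) ^ kk < 1 / (4 * d)" ..
  then have e2: "d * (1 - \<epsilon> / C) ^ kk \<le> 1 / 4" using d1 by (simp add: field_simps)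
  obtain u v where uv: "u \<in> carrier \<Gamma>" "v \<in> carrier \<Gamma>" "u \<otimes>\<^bsub>\<Gamma>\<^esub> v \<noteq> v \<otimes>\<^bsub>\<Gamma>\<^esub> u" using na unfolding non_abelian_def by blast
  let ?c = "u \<otimes>\<^bsub>\<Gamma>\<^esub> v \<otimes>\<^bsub>\<Gamma>\<^esub> inv\<^bsub>\<Gamma>\<^esub> (v \<otimes>\<^bsub>\<Gamma>\<^esub> u)"
  define E where "E = (\<Union>i<d. snd ` set (power_words rs d kk i i))"
  \<comment> \<open>The words that occur in the trace may become trivial in P only if they are
    trivial in \<Gamma>, and the commutator of u and v must survive to keep the image
    nonabelian.\<close>
  define T where "T = insert ?c (word_val \<Gamma> x ` E)"
  have T: "finite T" "T \<subseteq> carrier \<Gamma>" using uv x by (auto simp: T_def E_def)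
  obtain h P y n where P: "group (P :: (int \<times> int \<times> int \<times> int) monoid)" "Coset.order P = p ^ n" "\<forall>i::nat. y i \<in> carrier P"
    and h: "\<forall>a\<in>carrier \<Gamma>. \<forall>b\<in>carrier \<Gamma>. h (a \<otimes>\<^bsub>\<Gamma>\<^esub> b) = reduce_word (h a @ h b)"
    and det: "\<forall>t\<in>T. word_val P y (h t) = \<one>\<^bsub>P\<^esub> \<longrightarrow> t = \<one>\<^bsub>\<Gamma>\<^esub>"
    using limit_group_residually_p[OF L p T] by (elim exE conjE) (rule that)
  interpret P: group P by (rule P)
  have yc: "y i \<in> carrier P" for i using P(3) by blast
  have hm: "h (a \<otimes>\<^bsub>\<Gamma>\<^esub> b) = reduce_word (h a @ h b)" if "a \<in> carrier \<Gamma>" "b \<in> carrier \<Gamma>" for a b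
    using h that by blast
  define \<rho> where "\<rho> a = word_val P y (h a)" for a
  have \<rho>c: "\<rho> a \<in> carrier P" for a unfolding \<rho>_def using yc by simp
  have \<rho>hom: "\<rho> \<in> hom \<Gamma> P"
  proof (rule homI)
    fix a b assume ab: "a \<in> carrier \<Gamma>" "b \<in> carrier \<Gamma>"
    show "\<rho> (a \<otimes>\<^bsub>\<Gamma>\<^esub> b) = \<rho> a \<otimes>\<^bsub>P\<^esub> \<rho> b"
      unfolding \<rho>_def hm[OF ab] P.word_val_reduce[OF yc] P.word_val_append[OF yc] by (rule refl)
  qed (rule \<rho>c)
  interpret \<rho>: group_hom \<Gamma> P \<rho> using G P \<rho>hom by (simp add: group_hom_def group_hom_axioms_def)
  have \<rho>uv: "\<rho> u \<otimes>\<^bsub>P\<^esub> \<rho> v \<noteq> \<rho> v \<otimes>\<^bsub>P\<^esub> \<rho> u"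
  proof
    assume e: "\<rho> u \<otimes>\<^bsub>P\<^esub> \<rho> v = \<rho> v \<otimes>\<^bsub>P\<^esub> \<rho> u"
    have "\<rho> ?c = (\<rho> u \<otimes>\<^bsub>P\<^esub> \<rho> v) \<otimes>\<^bsub>P\<^esub> inv\<^bsub>P\<^esub> (\<rho> v \<otimes>\<^bsub>P\<^esub> \<rho> u)" using uv by simp
    also have "\<dots> = \<one>\<^bsub>P\<^esub>" unfolding e using \<rho>c by (intro P.r_inv) simp
    finally have "?c = \<one>\<^bsub>\<Gamma>\<^esub>" using det by (simp add: T_def \<rho>_def)
    then have "inv\<^bsub>\<Gamma>\<^esub> (inv\<^bsub>\<Gamma>\<^esub> (v \<otimes>\<^bsub>\<Gamma>\<^esub> u)) = u \<otimes>\<^bsub>\<Gamma>\<^esub> v" using uv by (intro G.inv_equality) auto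
    then show False using uv by simp
  qed
  have wv: "word_val P (\<lambda>i. \<rho> (x i)) w = \<rho> (word_val \<Gamma> x w)" for w
    using G.word_val_hom[where y = x, OF P(1) \<rho>hom x] by simp
  have lower: "2 * C ^ kk \<le> formal_trace P (\<lambda>i. \<rho> (x i)) rs d kk"
  proof -
    have finP: "finite (carrier P)"
      using P(2) prime_gt_0_nat[OF p] by (metis P.order_gt_0_iff_finite zero_less_power)
    obtain D :: "nat \<Rightarrow> 'a \<Rightarrow> int \<times> int \<times> int \<times> int \<Rightarrow> int" where D:
      "\<forall>j<2. \<forall>a\<in>carrier \<Gamma>. \<forall>b\<in>carrier \<Gamma>. \<forall>z\<in>carrier P. D j (a \<otimes>\<^bsub>\<Gamma>\<^esub> b) z = D j a z + D j b (inv\<^bsub>P\<^esub> (\<rho> a) \<otimes>\<^bsub>P\<^esub> z)"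
      and Di: "\<forall>f. (\<forall>a\<in>carrier \<Gamma>. \<forall>z\<in>carrier P. (\<Sum>(j,g)\<in>{..<2} \<times> carrier P. D j a (z \<otimes>\<^bsub>P\<^esub> inv\<^bsub>P\<^esub> g) * f (j,g)) = 0) \<longrightarrow>
         (\<forall>z\<in>{..<2} \<times> carrier P. f z = 0)"
    proof (rule exE[OF two_independent_derivations[where \<rho> = \<rho> and h = h and y = y, OF G P(1) p P(2) yc _ \<rho>_def uv(1,2) \<rho>uv]], goal_cases)
      case (1 a b)
      show ?case by (rule hm[OF 1(2,3)])
    next
      case (2 D)
      from 2(2) show ?case by (elim conjE) (rule 2(1))
    qed
    show ?thesis unfolding C_def rs_def
    proof (rule trace_ge_of_derivations[where D = D, OF G P(1) finP \<rho>hom x gen ws])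
      fix j :: nat and a b z assume "j < 2" "a \<in> carrier \<Gamma>" "b \<in> carrier \<Gamma>" "z \<in> carrier P"
      then show "D j (a \<otimes>\<^bsub>\<Gamma>\<^esub> b) z = D j a z + D j b (inv\<^bsub>P\<^esub> (\<rho> a) \<otimes>\<^bsub>P\<^esub> z)" by (rule D[rule_format])
    next
      fix f :: "nat \<times> int \<times> int \<times> int \<times> int \<Rightarrow> int"
      assume "\<forall>a\<in>carrier \<Gamma>. \<forall>z\<in>carrier P. (\<Sum>(j,g)\<in>{..<2} \<times> carrier P. D j a (z \<otimes>\<^bsub>P\<^esub> inv\<^bsub>P\<^esub> g) * f (j,g)) = 0"
      then show "\<forall>z\<in>{..<2} \<times> carrier P. f z = 0" by (rule Di[THEN spec, THEN mp])
    qed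
  qed
  have upper: "formal_trace (P \<times>\<times> integer_mod_group s) (\<lambda>i. (\<rho> (x i), ?e i mod int s)) rs d kk \<le> real_of_int C ^ kk * (7 / 4)"
    unfolding rs_def
  proof (rule trace_le_of_window[where e = ?e and y = "\<lambda>i. \<rho> (x i)", OF P(1) p P(2) \<rho>c _ M _ k s_def C_def[unfolded rs_def] \<epsilon> e1 e2])
    show "letters_below d w" if "w \<in> set ws" for w using ws that by (auto simp: relators_def)
  next
    fix c :: "nat \<Rightarrow> int poly"
    assume c: "[:int p:] dvd c k"
      "\<And>w. w \<in> set ws \<Longrightarrow> [:int p:] dvd (\<Sum>(m,u,j)\<leftarrow>fox w. Polynomial.monom m (nat (int M + word_exp ?e u)) * c j)"
    show "\<forall>i<d. [:int p:] dvd c i"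
    proof (rule inj[THEN spec[of _ M], THEN spec[of _ c], THEN mp, THEN mp, THEN mp, OF _ c(1)])
      have "0 \<le> int M + word_exp ?e u" if "w \<in> set ws" "(m,u,j) \<in> set (fox w)" for w m u j
        using M[OF that] by linarith
      then show "\<forall>w\<in>set ws. \<forall>(m,u,j)\<in>set (fox w). 0 \<le> int M + word_exp ?e u" by blast
      show "\<forall>w\<in>set ws. [:int p:] dvd (\<Sum>(m,u,j)\<leftarrow>fox w. Polynomial.monom m (nat (int M + word_exp ?e u)) * c j)"
        using c(2) by (intro ballI)
    qed
  qed
  \<comment> \<open>A word trivial in P is trivial in \<Gamma> by the choice of T, so its exponent
    is 0 and it is trivial in the product as well.\<close>
  have eq: "formal_trace (P \<times>\<times> integer_mod_group s) (\<lambda>i. (\<rho> (x i), ?e i mod int s)) rs d kk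
     = formal_trace P (\<lambda>i. \<rho> (x i)) rs d kk"
  proof (rule formal_trace_eq)
    fix i c and w :: "(nat \<times> bool) list" assume i: "i < d" "(c, w) \<in> set (power_words rs d kk i i)"
    have s0: "0 < s" by (simp add: s_def)
    have "word_val \<Gamma> x w \<in> T" using i unfolding T_def E_def by force
    then have "word_exp ?e w = 0" if "\<rho> (word_val \<Gamma> x w) = \<one>\<^bsub>P\<^esub>"
      using that det word_exp_word_val[where x = x, OF G \<phi> x, of w] hom_one[OF \<phi> G group_integer_group]
      by (simp add: \<rho>_def)
    then show "(word_val (P \<times>\<times> integer_mod_group s) (\<lambda>i. (\<rho> (x i), ?e i mod int s)) w = \<one>\<^bsub>P \<times>\<times> integer_mod_group s\<^esub>)
      = (word_val P (\<lambda>i. \<rho> (x i)) w = \<one>\<^bsub>P\<^esub>)"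
      unfolding word_val_prod_mod[where y = "\<lambda>i. \<rho> (x i)", OF P(1) \<rho>c s0] wv by auto
  qed
  have "real_of_int (2 * C ^ kk) \<le> real_of_int (formal_trace P (\<lambda>i. \<rho> (x i)) rs d kk)"
    unfolding of_int_le_iff by (rule lower)
  also have "\<dots> \<le> real_of_int C ^ kk * (7 / 4)" using upper unfolding eq .
  finally have "2 * real_of_int C ^ kk \<le> real_of_int C ^ kk * (7 / 4)" by simp
  moreover have "0 < real_of_int C ^ kk" using C1 by simp
  ultimately show False by simp
qed

lemma tK_powi_neq_1:
  assumes "m \<noteq> 0"
  shows "tK powi m \<noteq> 1"
proof
  assume t: "tK powi m = 1"
  have "\<forall>j\<in>{0, 1}. (if j = (0::nat) then - 1 else 1 :: rat) = 0"
    by (rule tK_powi_independent[OF _ assms]) (simp_all add: t)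
  then show False by simp
qed

text \<open>Let \<tau> be a generator with nonzero image, \<delta> a nonzero derivation with
  \<delta> \<tau> = 0, and \<gamma> an element with \<delta> \<gamma> nonzero. The commutator l of
  \<gamma> and \<tau> lies in the kernel of \<phi>, and \<delta> l is (1 - t^(\<phi> \<tau>)) times
  \<delta> \<gamma>.\<close>

lemma limit_group_derivation:
  fixes \<Gamma> :: "('a, 'b) monoid_scheme"
  assumes L: "limit_group \<Gamma>" and na: "non_abelian \<Gamma>"
    and \<phi>: "\<phi> \<in> hom \<Gamma> integer_group" and nz: "\<exists>g\<in>carrier \<Gamma>. \<phi> g \<noteq> 0"
  shows "\<exists>\<delta> \<tau> l. twisted_derivation \<Gamma> (\<lambda>g. tK powi \<phi> g) \<delta> \<and> \<tau> \<in> carrier \<Gamma> \<and> l \<in> carrier \<Gamma> \<and>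
    \<phi> \<tau> \<noteq> 0 \<and> \<phi> l = 0 \<and> \<delta> l \<noteq> 0"
proof -
  have G: "group \<Gamma>" and fg: "fin_gen_group \<Gamma>" using L by (simp_all add: limit_group_def fin_gen_group_def)
  interpret G: group \<Gamma> by (rule G)
  interpret \<phi>: group_hom \<Gamma> integer_group \<phi>
    using G \<phi> group_integer_group by (simp add: group_hom_def group_hom_axioms_def)
  obtain d x where x: "\<forall>i::nat. x i \<in> carrier \<Gamma>" and gen: "\<forall>g\<in>carrier \<Gamma>. \<exists>w. letters_below d w \<and> word_val \<Gamma> x w = g"
    using generators_of_fin_gen_group[OF fg] by blast
  have xc: "x i \<in> carrier \<Gamma>" for i using x by blast
  have "\<exists>k<d. \<phi> (x k) \<noteq> 0"
  proof (rule ccontr)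
    assume n: "\<not> (\<exists>k<d. \<phi> (x k) \<noteq> 0)"
    have "word_exp (\<lambda>i. \<phi> (x i)) w = 0" if "letters_below d w" for w
      using that n by (induction w) auto
    then have "\<phi> g = 0" if "g \<in> carrier \<Gamma>" for g
      using gen that word_exp_word_val[where x = x, OF G \<phi> xc] by metis
    then show False using nz by blast
  qed
  then obtain k where k: "k < d" "\<phi> (x k) \<noteq> 0" by blast
  obtain \<delta> \<gamma> where \<delta>: "\<forall>g\<in>carrier \<Gamma>. \<forall>h\<in>carrier \<Gamma>. \<delta> (g \<otimes>\<^bsub>\<Gamma>\<^esub> h) = \<delta> g + tK powi \<phi> g * \<delta> h"
    "\<delta> (x k) = 0" and \<gamma>: "\<gamma> \<in> carrier \<Gamma>" "\<delta> \<gamma> \<noteq> 0"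
    using limit_group_not_rigid[where x = x, OF L na \<phi> xc gen k(1)] by blast
  let ?\<tau> = "x k"
  define l where "l = \<gamma> \<otimes>\<^bsub>\<Gamma>\<^esub> ?\<tau> \<otimes>\<^bsub>\<Gamma>\<^esub> inv\<^bsub>\<Gamma>\<^esub> (?\<tau> \<otimes>\<^bsub>\<Gamma>\<^esub> \<gamma>)"
  have lc: "l \<in> carrier \<Gamma>" using \<gamma> xc by (simp add: l_def)
  have \<phi>l: "\<phi> l = 0" using \<gamma> xc by (simp add: l_def)
  have "l \<otimes>\<^bsub>\<Gamma>\<^esub> (?\<tau> \<otimes>\<^bsub>\<Gamma>\<^esub> \<gamma>) = \<gamma> \<otimes>\<^bsub>\<Gamma>\<^esub> ?\<tau>" using \<gamma>(1) xc[of k] unfolding l_def by (simp add: G.m_assoc del: G.inv_mult_group)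
  moreover have "\<delta> (l \<otimes>\<^bsub>\<Gamma>\<^esub> (?\<tau> \<otimes>\<^bsub>\<Gamma>\<^esub> \<gamma>)) = \<delta> l + tK powi \<phi> ?\<tau> * \<delta> \<gamma>"
    using \<delta> \<gamma> xc lc \<phi>l by simp
  moreover have "\<delta> (\<gamma> \<otimes>\<^bsub>\<Gamma>\<^esub> ?\<tau>) = \<delta> \<gamma>" using \<delta> \<gamma> xc by simp
  ultimately have "\<delta> l = (1 - tK powi \<phi> ?\<tau>) * \<delta> \<gamma>" by (simp add: algebra_simps)
  then have "\<delta> l \<noteq> 0" using \<gamma>(2) tK_powi_neq_1[OF k(2)] by simp
  moreover have "twisted_derivation \<Gamma> (\<lambda>g. tK powi \<phi> g) \<delta>"
    unfolding twisted_derivation_def using \<delta>(1) by (simp add: power_int_add)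
  ultimately show ?thesis using lc xc k(2) \<phi>l by blast
qed

lemma twisted_derivation_one:
  assumes "group G" "twisted_derivation G \<chi> \<delta>" "\<chi> \<one>\<^bsub>G\<^esub> = 1"
  shows "\<delta> \<one>\<^bsub>G\<^esub> = 0"
proof -
  interpret group G by (rule assms)
  have "\<delta> (\<one>\<^bsub>G\<^esub> \<otimes>\<^bsub>G\<^esub> \<one>\<^bsub>G\<^esub>) = \<delta> \<one>\<^bsub>G\<^esub> + \<chi> \<one>\<^bsub>G\<^esub> * \<delta> \<one>\<^bsub>G\<^esub>"
    using assms(2) unfolding twisted_derivation_def by blast
  then have "\<delta> \<one>\<^bsub>G\<^esub> = \<delta> \<one>\<^bsub>G\<^esub> + \<delta> \<one>\<^bsub>G\<^esub>"
    by (simp only: l_one one_closed assms(3) mult_1_left)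
  then show ?thesis by (metis add_cancel_right_right)
qed

text \<open>Expand \<delta> on both sides of c g = g a, where c is the conjugate. The factor \<chi>
  g is the source of the powers of t in the final pairings.\<close>

lemma twisted_derivation_conj:
  assumes G: "group G" and d: "twisted_derivation G \<chi> \<delta>" and g: "g \<in> carrier G" "a \<in> carrier G"
    and \<chi>: "\<chi> a = 1" "\<chi> g \<noteq> 0"
  shows "\<delta> (g \<otimes>\<^bsub>G\<^esub> a \<otimes>\<^bsub>G\<^esub> inv\<^bsub>G\<^esub> g) = \<chi> g * \<delta> a"
proof -
  interpret group G by (rule G)
  let ?c = "g \<otimes>\<^bsub>G\<^esub> a \<otimes>\<^bsub>G\<^esub> inv\<^bsub>G\<^esub> g"
  have c: "?c \<in> carrier G" using g by simp
  have e: "?c \<otimes>\<^bsub>G\<^esub> g = g \<otimes>\<^bsub>G\<^esub> a" using g by (simp add: m_assoc)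
  have t: "\<chi> (u \<otimes>\<^bsub>G\<^esub> v) = \<chi> u * \<chi> v" "\<delta> (u \<otimes>\<^bsub>G\<^esub> v) = \<delta> u + \<chi> u * \<delta> v"
    if "u \<in> carrier G" "v \<in> carrier G" for u v
    using d that unfolding twisted_derivation_def by blast+
  have "\<chi> ?c * \<chi> g = \<chi> g" using t(1)[OF c g(1)] t(1)[OF g] e \<chi>(1) by simp
  then have "\<chi> ?c = 1" using \<chi>(2) by simp
  then show ?thesis using t(2)[OF c g(1)] t(2)[OF g] e by simp
qed

lemma char_prod_powi:
  "char_prod (map (\<lambda>i. (\<lambda>g. tK powi f i (g i), d i)) js) g = tK powi (\<Sum>i\<leftarrow>js. f i (g i))"
  by (induction js) (simp_all add: power_int_add)

lemma tK_powi_nonzero: "tK powi m \<noteq> 0"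
  by simp

section \<open>Homomorphisms from a direct product to the integers\<close>

definition factor_embedding :: "nat \<Rightarrow> (nat \<Rightarrow> ('a, 'b) monoid_scheme) \<Rightarrow> nat \<Rightarrow> 'a \<Rightarrow> nat \<Rightarrow> 'a" where
  "factor_embedding n \<Gamma> i a = (\<lambda>j\<in>{..<n}. if j = i then a else \<one>\<^bsub>\<Gamma> j\<^esub>)"

lemma factor_embedding_hom:
  assumes "\<And>i. i < n \<Longrightarrow> group (\<Gamma> i)" "i < n"
  shows "factor_embedding n \<Gamma> i \<in> hom (\<Gamma> i) (product_group {..<n} \<Gamma>)"
proof -
  have one: "\<one>\<^bsub>\<Gamma> j\<^esub> \<in> carrier (\<Gamma> j)" "\<one>\<^bsub>\<Gamma> j\<^esub> \<otimes>\<^bsub>\<Gamma> j\<^esub> \<one>\<^bsub>\<Gamma> j\<^esub> = \<one>\<^bsub>\<Gamma> j\<^esub>" if "j < n" for j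
  proof -
    interpret group "\<Gamma> j" by (rule assms(1)[OF that])
    show "\<one>\<^bsub>\<Gamma> j\<^esub> \<in> carrier (\<Gamma> j)" "\<one>\<^bsub>\<Gamma> j\<^esub> \<otimes>\<^bsub>\<Gamma> j\<^esub> \<one>\<^bsub>\<Gamma> j\<^esub> = \<one>\<^bsub>\<Gamma> j\<^esub>" by simp_all
  qed
  show ?thesis by (rule homI) (use one in \<open>auto simp: factor_embedding_def fun_eq_iff\<close>)
qed

text \<open>Build g up one coordinate at a time: consecutive truncations of g differ by one embedded
  factor.\<close>

lemma hom_product_group_sum:
  assumes G: "\<And>i. i < n \<Longrightarrow> group (\<Gamma> i)" and \<phi>: "\<phi> \<in> hom (product_group {..<n} \<Gamma>) integer_group"
    and g: "g \<in> carrier (product_group {..<n} \<Gamma>)"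
  shows "\<phi> g = (\<Sum>i<n. \<phi> (factor_embedding n \<Gamma> i (g i)))"
proof -
  have P: "group (product_group {..<n} \<Gamma>)" by (rule product_group) (simp add: G)
  have gc: "g j \<in> carrier (\<Gamma> j)" if "j < n" for j using g that by auto
  define trunc where "trunc m = (\<lambda>j\<in>{..<n}. if j < m then g j else \<one>\<^bsub>\<Gamma> j\<^esub>)" for m
  have one: "\<one>\<^bsub>\<Gamma> j\<^esub> \<in> carrier (\<Gamma> j)" "a \<in> carrier (\<Gamma> j) \<Longrightarrow> a \<otimes>\<^bsub>\<Gamma> j\<^esub> \<one>\<^bsub>\<Gamma> j\<^esub> = a \<and> \<one>\<^bsub>\<Gamma> j\<^esub> \<otimes>\<^bsub>\<Gamma> j\<^esub> a = a"
    if "j < n" for j a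
  proof -
    interpret group "\<Gamma> j" by (rule G[OF that])
    show "\<one>\<^bsub>\<Gamma> j\<^esub> \<in> carrier (\<Gamma> j)" by simp
    show "a \<in> carrier (\<Gamma> j) \<Longrightarrow> a \<otimes>\<^bsub>\<Gamma> j\<^esub> \<one>\<^bsub>\<Gamma> j\<^esub> = a \<and> \<one>\<^bsub>\<Gamma> j\<^esub> \<otimes>\<^bsub>\<Gamma> j\<^esub> a = a" by simp
  qed
  have tc: "trunc m \<in> carrier (product_group {..<n} \<Gamma>)" for m
    using one gc by (auto simp: trunc_def)
  have "m \<le> n \<Longrightarrow> \<phi> (trunc m) = (\<Sum>i<m. \<phi> (factor_embedding n \<Gamma> i (g i)))" for m
  proof (induction m)
    case 0
    have "trunc 0 = \<one>\<^bsub>product_group {..<n} \<Gamma>\<^esub>" by (simp add: trunc_def)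
    then have "\<phi> (trunc 0) = 0" using hom_one[OF \<phi> P group_integer_group] by (simp only: one_integer_group)
    then show ?case by simp
  next
    case (Suc m)
    then have m: "m < n" by simp
    have "trunc (Suc m) = trunc m \<otimes>\<^bsub>product_group {..<n} \<Gamma>\<^esub> factor_embedding n \<Gamma> m (g m)"
    proof
      fix j
      show "trunc (Suc m) j = (trunc m \<otimes>\<^bsub>product_group {..<n} \<Gamma>\<^esub> factor_embedding n \<Gamma> m (g m)) j"
        using one gc by (auto simp: trunc_def factor_embedding_def less_Suc_eq)
    qed
    moreover have "factor_embedding n \<Gamma> m (g m) \<in> carrier (product_group {..<n} \<Gamma>)"
      by (rule hom_in_carrier[OF factor_embedding_hom[where \<Gamma> = \<Gamma>, OF G m] gc[OF m]])
    ultimately have "\<phi> (trunc (Suc m)) = \<phi> (trunc m) + \<phi> (factor_embedding n \<Gamma> m (g m))"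
      using hom_mult[OF \<phi> tc[of m]] by (simp only: mult_integer_group)
    then show ?case using Suc.IH m by simp
  qed
  moreover have "trunc n = g"
  proof
    fix j
    show "trunc n j = g j" using g by (auto simp: trunc_def PiE_def extensional_def)
  qed
  ultimately show ?thesis by (metis order_refl)
qed

hide_const (open) Matrix_Kernel.kernel

theorem theorem4p4:
  fixes \<Gamma> :: "nat \<Rightarrow> ('a, 'b) monoid_scheme" and n :: nat
    and \<phi> :: "(nat \<Rightarrow> 'a) \<Rightarrow> int"
  assumes lim: "\<forall>i<n. limit_group (\<Gamma> i) \<and> non_abelian (\<Gamma> i)"
    and hom: "\<phi> \<in> hom (product_group {..<n} \<Gamma>) integer_group"
    and epi: "\<phi> ` carrier (product_group {..<n} \<Gamma>) = carrier integer_group"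
  shows "\<exists>N0. subgroup N0 ((product_group {..<n} \<Gamma>)
                 \<lparr>carrier := kernel (product_group {..<n} \<Gamma>) integer_group \<phi>\<rparr>)
          \<and> finite (rcosets\<^bsub>(product_group {..<n} \<Gamma>)
                 \<lparr>carrier := kernel (product_group {..<n} \<Gamma>) integer_group \<phi>\<rparr>\<^esub> N0)
          \<and> (\<exists>k\<le>n. \<not> homology_finite_dim ((product_group {..<n} \<Gamma>)\<lparr>carrier := N0\<rparr>) k)"
proof -
  let ?P = "product_group {..<n} \<Gamma>"
  let ?N = "kernel ?P integer_group \<phi>"
  let ?G = "?P\<lparr>carrier := ?N\<rparr>"
  let ?em = "factor_embedding n \<Gamma>"
  have grp: "group (\<Gamma> i)" if "i < n" for i using lim that by (simp add: limit_group_def fin_gen_group_def)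
  have P: "group ?P" by (rule product_group) (simp add: grp)
  interpret P: group ?P by (rule P)
  interpret \<phi>: group_hom ?P integer_group \<phi> using P hom by (simp add: group_hom_def group_hom_axioms_def)
  have G: "group ?G" by (rule P.subgroup_imp_group[OF \<phi>.subgroup_kernel])
  interpret G: group ?G by (rule G)
  have NP: "g \<in> carrier ?P" "\<phi> g = 0" if "g \<in> ?N" for g using that by (auto simp: Coset.kernel_def)
  define \<psi> where "\<psi> i a = \<phi> (?em i a)" for i a
  have \<psi>: "\<psi> i \<in> hom (\<Gamma> i) integer_group" if "i < n" for i
    using hom_compose[OF factor_embedding_hom[where \<Gamma> = \<Gamma>, OF grp that] hom] by (simp add: \<psi>_def[abs_def] o_def)
  have \<psi>1: "\<psi> i \<one>\<^bsub>\<Gamma> i\<^esub> = 0" if "i < n" for i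
    using hom_one[OF \<psi>[OF that] grp[OF that] group_integer_group] by simp
  have \<psi>sum: "\<phi> g = (\<Sum>i<n. \<psi> i (g i))" if "g \<in> carrier ?P" for g
    unfolding \<psi>_def by (rule hom_product_group_sum[OF grp hom that])
  \<comment> \<open>The factors on which \<phi> is nontrivial. Their coordinates alone determine
    \<phi>, and their number is the degree in which the homology will be
    infinite-dimensional.\<close>
  define I where "I = {i. i < n \<and> (\<exists>a\<in>carrier (\<Gamma> i). \<psi> i a \<noteq> 0)}"
  have finI: "finite I" unfolding I_def by simp
  have In: "i < n" if "i \<in> I" for i using that by (simp add: I_def)
  have Isum: "\<phi> g = (\<Sum>i\<in>I. \<psi> i (g i))" if g: "g \<in> carrier ?P" for g
    unfolding \<psi>sum[OF g] by (rule sum.mono_neutral_right) (use g in \<open>auto simp: I_def\<close>)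
  have "1 \<in> \<phi> ` carrier ?P" unfolding epi by simp
  then obtain g0 where g0: "g0 \<in> carrier ?P" "\<phi> g0 = 1" by (metis imageE)
  have Ine: "I \<noteq> {}" using Isum[OF g0(1)] g0(2) by auto
  have "\<forall>i\<in>I. \<exists>z. twisted_derivation (\<Gamma> i) (\<lambda>g. tK powi \<psi> i g) (fst z) \<and> fst (snd z) \<in> carrier (\<Gamma> i) \<and>
      snd (snd z) \<in> carrier (\<Gamma> i) \<and> \<psi> i (fst (snd z)) \<noteq> 0 \<and> \<psi> i (snd (snd z)) = 0 \<and> fst z (snd (snd z)) \<noteq> 0"
  proof
    fix i assume i: "i \<in> I"
    have ex: "\<exists>g\<in>carrier (\<Gamma> i). \<psi> i g \<noteq> 0" using i by (simp add: I_def)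
    obtain \<delta> \<tau> l where "twisted_derivation (\<Gamma> i) (\<lambda>g. tK powi \<psi> i g) \<delta>" "\<tau> \<in> carrier (\<Gamma> i)" "l \<in> carrier (\<Gamma> i)"
      "\<psi> i \<tau> \<noteq> 0" "\<psi> i l = 0" "\<delta> l \<noteq> 0"
      using limit_group_derivation[OF _ _ \<psi>[OF In[OF i]] ex] lim In[OF i] by blast
    then show "\<exists>z. twisted_derivation (\<Gamma> i) (\<lambda>g. tK powi \<psi> i g) (fst z) \<and> fst (snd z) \<in> carrier (\<Gamma> i) \<and>
      snd (snd z) \<in> carrier (\<Gamma> i) \<and> \<psi> i (fst (snd z)) \<noteq> 0 \<and> \<psi> i (snd (snd z)) = 0 \<and> fst z (snd (snd z)) \<noteq> 0"
      by (intro exI[of _ "(\<delta>, \<tau>, l)"]) simp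
  qed
  from bchoice[OF this] obtain z where z: "\<forall>i\<in>I. twisted_derivation (\<Gamma> i) (\<lambda>g. tK powi \<psi> i g) (fst (z i)) \<and> fst (snd (z i)) \<in> carrier (\<Gamma> i) \<and>
      snd (snd (z i)) \<in> carrier (\<Gamma> i) \<and> \<psi> i (fst (snd (z i))) \<noteq> 0 \<and> \<psi> i (snd (snd (z i))) = 0 \<and> fst (z i) (snd (snd (z i))) \<noteq> 0" ..
  define \<delta> where "\<delta> i = fst (z i)" for i
  define \<tau> where "\<tau> i = fst (snd (z i))" for i
  define l where "l i = snd (snd (z i))" for i
  have td: "twisted_derivation (\<Gamma> i) (\<lambda>g. tK powi \<psi> i g) (\<delta> i)" and \<tau>: "\<tau> i \<in> carrier (\<Gamma> i)" "\<psi> i (\<tau> i) \<noteq> 0"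
    and l: "l i \<in> carrier (\<Gamma> i)" "\<psi> i (l i) = 0" "\<delta> i (l i) \<noteq> 0" if "i \<in> I" for i
    using z that unfolding \<delta>_def \<tau>_def l_def by blast+
  define js where "js = sorted_list_of_set I"
  define k where "k = length js"
  have js: "set js = I" "distinct js" using finI by (simp_all add: js_def)
  have kI: "k = card I" using js distinct_card[of js] by (simp add: k_def)
  have k0: "0 < k" using kI Ine finI by (simp add: card_gt_0_iff)
  have kn: "k \<le> n" using card_mono[of "{..<n}" I] In kI by auto
  have jI: "js ! q \<in> I" if "q < k" for q using that js(1) nth_mem[of q js] by (simp add: k_def)
  have jn: "js ! q < n" if "q < k" for q using In[OF jI[OF that]] .
  have jd: "js ! q = js ! q' \<longleftrightarrow> q = q'" if "q < k" "q' < k" for q q'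
    using that js(2) by (simp add: k_def nth_eq_iff_index_eq)
  let ?\<chi> = "\<lambda>i g. tK powi \<psi> i (g i)" and ?d = "\<lambda>i g. \<delta> i (g i)"
  define ds where "ds = map (\<lambda>i. (?\<chi> i, ?d i)) js"
  have dsq: "ds ! q = (?\<chi> (js ! q), ?d (js ! q))" if "q < k" for q using that by (simp add: ds_def k_def)
  \<comment> \<open>Only the factor at position 0 is conjugated, by the m-th power of \<tau>.
    Varying m multiplies the pairing by powers of t and leaves the contributions of the other
    factors unchanged.\<close>
  define a where "a m q = (if q = 0 then \<tau> (js ! q) [^]\<^bsub>\<Gamma> (js ! q)\<^esub> m \<otimes>\<^bsub>\<Gamma> (js ! q)\<^esub> l (js ! q) \<otimes>\<^bsub>\<Gamma> (js ! q)\<^esub> inv\<^bsub>\<Gamma> (js ! q)\<^esub> (\<tau> (js ! q) [^]\<^bsub>\<Gamma> (js ! q)\<^esub> m)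
      else l (js ! q))" for m :: nat and q :: nat
  have a: "a m q \<in> carrier (\<Gamma> (js ! q))" "\<psi> (js ! q) (a m q) = 0"
    "\<delta> (js ! q) (a m q) = (if q = 0 then tK powi (int m * \<psi> (js ! 0) (\<tau> (js ! 0))) else 1) * \<delta> (js ! q) (l (js ! q))"
    if q: "q < k" for m q
  proof -
    let ?i = "js ! q"
    interpret Gi: group "\<Gamma> ?i" by (rule grp[OF jn[OF q]])
    interpret \<psi>i: group_hom "\<Gamma> ?i" integer_group "\<psi> ?i"
      using \<psi>[OF jn[OF q]] Gi.group_axioms by (simp add: group_hom_def group_hom_axioms_def)
    have tm: "\<tau> ?i [^]\<^bsub>\<Gamma> ?i\<^esub> m \<in> carrier (\<Gamma> ?i)" using \<tau>[OF jI[OF q]] by simp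
    have pm: "\<psi> ?i (\<tau> ?i [^]\<^bsub>\<Gamma> ?i\<^esub> m) = int m * \<psi> ?i (\<tau> ?i)"
      using \<tau>[OF jI[OF q]] by (induction m) (simp_all add: algebra_simps)
    let ?c = "\<tau> ?i [^]\<^bsub>\<Gamma> ?i\<^esub> m \<otimes>\<^bsub>\<Gamma> ?i\<^esub> l ?i \<otimes>\<^bsub>\<Gamma> ?i\<^esub> inv\<^bsub>\<Gamma> ?i\<^esub> (\<tau> ?i [^]\<^bsub>\<Gamma> ?i\<^esub> m)"
    have c: "?c \<in> carrier (\<Gamma> ?i)" "\<psi> ?i ?c = 0" using tm l[OF jI[OF q]] by simp_all
    show "a m q \<in> carrier (\<Gamma> ?i)" unfolding a_def using c(1) l(1)[OF jI[OF q]] by (cases "q = 0") (simp_all only: if_True if_False simp_thms)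
    show "\<psi> ?i (a m q) = 0" unfolding a_def using c(2) l(2)[OF jI[OF q]] by (cases "q = 0") (simp_all only: if_True if_False simp_thms)
    show "\<delta> ?i (a m q) = (if q = 0 then tK powi (int m * \<psi> (js ! 0) (\<tau> (js ! 0))) else 1) * \<delta> ?i (l ?i)"
      using twisted_derivation_conj[OF Gi.group_axioms td[OF jI[OF q]] tm l(1)[OF jI[OF q]]] l[OF jI[OF q]] pm
      unfolding a_def by (cases "q = 0") (simp_all only: if_True if_False simp_thms power_int_0_right mult_1_left tK_powi_nonzero)
  qed
  define L where "L m q = ?em (js ! q) (a m q)" for m q
  have Lval: "L m q i = (if i < n then if i = js ! q then a m q else \<one>\<^bsub>\<Gamma> i\<^esub> else undefined)" for m q i
    by (simp add: L_def factor_embedding_def)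
  have LP: "L m q \<in> carrier ?P" if "q < k" for m q
    unfolding L_def by (rule hom_in_carrier[OF factor_embedding_hom[where \<Gamma> = \<Gamma>, OF grp jn[OF that]] a(1)[OF that]])
  have LN: "L m q \<in> carrier ?G" if "q < k" for m q
    using LP[OF that] a(2)[OF that] by (simp add: Coset.kernel_def L_def \<psi>_def)
  have tdG: "twisted_derivation ?G (?\<chi> i) (?d i)" if i: "i \<in> I" for i
    unfolding twisted_derivation_def
  proof (intro ballI)
    fix g h assume "g \<in> carrier ?G" "h \<in> carrier ?G"
    then have gh: "g i \<in> carrier (\<Gamma> i)" "h i \<in> carrier (\<Gamma> i)" using NP(1) In[OF i] by (auto simp: Coset.kernel_def)
    have "(g \<otimes>\<^bsub>?G\<^esub> h) i = g i \<otimes>\<^bsub>\<Gamma> i\<^esub> h i" using In[OF i] by simp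
    then show "?\<chi> i (g \<otimes>\<^bsub>?G\<^esub> h) = ?\<chi> i g * ?\<chi> i h \<and> ?d i (g \<otimes>\<^bsub>?G\<^esub> h) = ?d i g + ?\<chi> i g * ?d i h"
      using td[OF i] gh unfolding twisted_derivation_def by simp
  qed
  have "\<not> homology_finite_dim ?G k"
  proof (rule torus_homology_infinite_dim[where ds = ds and l = L])
    show "length ds = k" by (simp add: ds_def k_def)
    show "\<forall>(\<chi>,d)\<in>set ds. twisted_derivation ?G \<chi> d" using tdG js(1) by (auto simp: ds_def)
    \<comment> \<open>The product of the characters is t to the power \<phi> g, and \<phi> vanishes
      on the kernel.\<close>
    show "char_prod ds g = 1" if g: "g \<in> carrier ?G" for g
    proof -
      have "(\<Sum>i\<leftarrow>js. \<psi> i (g i)) = \<phi> g"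
        using Isum[OF NP(1)] g js by (simp add: sum_list_distinct_conv_sum_set)
      also have "\<dots> = 0" using NP(2) g by simp
      finally show ?thesis unfolding ds_def char_prod_powi[of \<psi> "\<lambda>i g. \<delta> i (g i)"] by simp
    qed
    show "L m q \<otimes>\<^bsub>?G\<^esub> L m j = L m j \<otimes>\<^bsub>?G\<^esub> L m q" if qj: "q < k" "j < k" for m q j
    proof (cases "q = j")
      case False
      show ?thesis
      proof
        fix i
        show "(L m q \<otimes>\<^bsub>?G\<^esub> L m j) i = (L m j \<otimes>\<^bsub>?G\<^esub> L m q) i"
        proof (cases "i < n")
          case True
          interpret Gi: group "\<Gamma> i" by (rule grp[OF True])
          have c: "L m q i \<in> carrier (\<Gamma> i)" "L m j i \<in> carrier (\<Gamma> i)"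
            using LP[OF qj(1)] LP[OF qj(2)] True by auto
          have "L m q i = \<one>\<^bsub>\<Gamma> i\<^esub> \<or> L m j i = \<one>\<^bsub>\<Gamma> i\<^esub>"
            using jd[OF qj] False True by (auto simp: Lval)
          then have "L m q i \<otimes>\<^bsub>\<Gamma> i\<^esub> L m j i = L m j i \<otimes>\<^bsub>\<Gamma> i\<^esub> L m q i"
            using c by (elim disjE) simp_all
          then show ?thesis using True by simp
        qed simp
      qed
    qed simp
    show "fst (ds ! q) (L m j) = 1" if "q < k" "j < k" for m q j
      using jn[OF that(1)] jd[OF that] a(2)[OF that(1), of m] \<psi>1[OF jn[OF that(1)]] by (cases "q = j") (auto simp: dsq that Lval)
    \<comment> \<open>The j-th element has the identity as its coordinate in the q-th factor, and
      derivations vanish at the identity.\<close>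
    show "snd (ds ! q) (L m j) = 0" if qj: "q < k" "j < k" "q \<noteq> j" for m q j
    proof -
      have "\<delta> (js ! q) \<one>\<^bsub>\<Gamma> (js ! q)\<^esub> = 0"
        by (rule twisted_derivation_one[OF grp[OF jn[OF qj(1)]] td[OF jI[OF qj(1)]]]) (simp add: \<psi>1 jn[OF qj(1)])
      then show ?thesis using jn[OF qj(1)] jd[OF qj(1,2)] qj by (simp add: dsq Lval)
    qed
    show "\<forall>m\<in>F. r m = 0" if F: "finite F" and s: "(\<Sum>m\<in>F. of_rat (r m) * (\<Prod>q<k. snd (ds ! q) (L m q))) = 0" for F r
    proof -
      \<comment> \<open>The part of the pairing that does not depend on m. It is nonzero, so the
        relation reduces to one between distinct powers of t.\<close>
      define c where "c = (\<Prod>q<k. \<delta> (js ! q) (l (js ! q)))"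
      have c0: "c \<noteq> 0" using l(3)[OF jI] by (simp add: c_def)
      have "(\<Prod>q<k. snd (ds ! q) (L m q)) = tK powi (int m * \<psi> (js ! 0) (\<tau> (js ! 0))) * c" for m
      proof -
        have "(\<Prod>q<k. snd (ds ! q) (L m q)) = (\<Prod>q<k. (if q = 0 then tK powi (int m * \<psi> (js ! 0) (\<tau> (js ! 0))) else 1) * \<delta> (js ! q) (l (js ! q)))"
          by (rule prod.cong) (simp_all add: dsq Lval jn a(3))
        then show ?thesis using k0 by (simp add: prod.distrib c_def)
      qed
      then have "(\<Sum>m\<in>F. of_rat (r m) * tK powi (int m * \<psi> (js ! 0) (\<tau> (js ! 0)))) * c = 0"
        using s by (simp add: sum_distrib_right mult.assoc)
      then have "(\<Sum>m\<in>F. of_rat (r m) * tK powi (int m * \<psi> (js ! 0) (\<tau> (js ! 0)))) = 0" using c0 by simp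
      then show ?thesis by (rule tK_powi_independent[OF F \<tau>(2)[OF jI[OF k0]]])
    qed
  qed (use k0 LN in auto)
  \<comment> \<open>The kernel itself serves as the subgroup of finite index; it has a single
    coset.\<close>
  moreover have sub: "subgroup ?N ?G" using G.subgroup_self by simp
  moreover have "rcosets\<^bsub>?G\<^esub> ?N \<subseteq> {?N}"
    unfolding RCOSETS_def using G.coset_join2[OF _ sub] by auto
  then have "finite (rcosets\<^bsub>?G\<^esub> ?N)" by (rule finite_subset) simp
  ultimately show ?thesis using kn by blast
qed

end
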